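(* For each $k\in\mathbb Z$ let $\mathcal F_k$ be a closed subspace of $\mathcal U_k$ and let $\omega_k=\begin{bmatrix}\omega_{k,1}\\ \omega_{k,2}\end{bmatrix}:\mathcal F_k\to\begin{bmatrix}\mathcal Y_k\\ \mathcal U_{k-1}\end{bmatrix}$ be a contraction. Let $H\in\mathbb{UM}^2_{\mathrm{ball}}(\mathbf U,\mathbf Y)$ satisfy $$H_{k,k}|_{\mathcal F_k}=\omega_{k,1}\quad(k\in\mathbb Z),\qquad H_{j,k}|_{\mathcal F_k}=H_{j,k-1}\omega_{k,2}\quad(j,k\in\mathbb Z,\ j<k).$$ Then there exists a pair of operator matrices $Z^{(1)}\in\mathbb{UM}^\infty(\mathbf U,\mathbf Y)$, $Z^{(2)}\in\mathbb{UM}^\infty_0(\mathbf U)$ such that (i) $\|Z^{(1)}u\|^2+\|Z^{(2)}u\|^2\le\|u\|^2$ for all $u\in\mathbf U$; (ii) for all $j,k\in\mathbb Z$: $Z^{(1)}_{j,k}|_{\mathcal F_k}$ equals $\omega_{k,1}$ if $j=k$ and $0$ if $j\ne k$, and $Z^{(2)}_{j,k}|_{\mathcal F_k}$ equals $\omega_{k,2}$ if $j=k-1$ and $0$ if $j\ne k-1$; (iii) $H=Z^{(1)}(I_{\mathbf U}-Z^{(2)})^{-1}$. Furthermore, the set of all such pairs $(Z^{(1)},Z^{(2)})$ is in one-to-one correspondence with the set $\mathbf C_{H,\omega}$.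
   Context: For each $k\in\mathbb Z$, $\mathcal U_k$ and $\mathcal Y_k$ are Hilbert spaces; $\mathbf U=\oplus_{k\in\mathbb Z}\mathcal U_k$ and $\mathbf Y=\oplus_{k\in\mathbb Z}\mathcal Y_k$ are the Hilbert direct sums. $\mathbb{UM}(\mathbf U,\mathbf Y)$ is the set of all upper triangular operator matrices $H=[H_{j,k}]_{j,k\in\mathbb Z}$, where $H_{j,k}:\mathcal U_k\to\mathcal Y_j$ is a bounded operator and $H_{j,k}=0$ for $k<j$. $\mathbb{UM}^2_{\mathrm{ball}}(\mathbf U,\mathbf Y)$ is the set of $H\in\mathbb{UM}(\mathbf U,\mathbf Y)$ with $\sum_{j=-\infty}^k\|H_{j,k}u_k\|^2\le\|u_k\|^2$ for all $u_k\in\mathcal U_k$ and all $k\in\mathbb Z$. $\mathbb{UM}^\infty(\mathbf U,\mathbf Y)$ (respectively $\mathbb{UM}^\infty_{\mathrm{ball}}(\mathbf U,\mathbf Y)$) is the set of $H\in\mathbb{UM}(\mathbf U,\mathbf Y)$ that induce bounded (respectively contractive) operators $\mathbf U\to\mathbf Y$; a further subscript $0$ ($\mathbb{UM}^\infty_0$, $\mathbb{UM}^\infty_{\mathrm{ball},0}$) denotes the strictly upper triangular ones ($H_{j,k}=0$ for $k\le j$). When $\mathbf U=\mathbf Y$ one writes $(\mathbf U)$ in place of $(\mathbf U,\mathbf U)$. Products of upper triangular operator matrices are the usual matrix products (finite sums); $\mathbb{UM}(\mathbf U)$ is an algebra with unit $I_{\mathbf U}$, and inverses are taken in this algebra; $M\in\mathbb{UM}(\mathbf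 U)$ is invertible there if and only if every diagonal entry $M_{j,j}$ is invertible. Let $H$ be as in the claim. Let $H_k:\mathcal U_k\to\mathbf Y$ be the contraction given by the $k$-th column of $H$, $D_{H_k}=(I_{\mathcal U_k}-H_k^*H_k)^{1/2}$, and $\mathcal D_{H_k}=\overline{D_{H_k}\mathcal U_k}$. Put $\mathcal F_{H_k}=\overline{D_{H_k}\mathcal F_k}$. Because of the interpolation conditions, $\|D_{H_k}f\|^2=\|D_{\omega_k}f\|^2+\|D_{H_{k-1}}\omega_{k,2}f\|^2$ for $f\in\mathcal F_k$ (with $D_{\omega_k}=(I-\omega_k^*\omega_k)^{1/2}$), so a contraction $\omega_{H_k}:\mathcal F_{H_k}\to\mathcal D_{H_{k-1}}$ is defined by $\omega_{H_k}D_{H_k}f=D_{H_{k-1}}\omega_{k,2}f$ ($f\in\mathcal F_k$). Put $\mathbf D_H=\oplus_{k\in\mathbb Z}\mathcal D_{H_k}$. Then $\mathbf C_{H,\omega}$ is the set of all $C=[C_{j,k}]_{j,k\in\mathbb Z}\in\mathbb{UM}^\infty_{\mathrm{ball},0}(\mathbf D_H)$ such that for all $j,k\in\mathbb Z$, $C_{j,k}|_{\mathcal F_{H_k}}=\omega_{H_k}$ if $j=k-1$ and $C_{j,k}|_{\mathcal F_{H_k}}=0$ if $j\neq k-1$. *)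

theory Defs
  imports "HOL-Analysis.Analysis"
begin

section \<open>Complex Hilbert spaces\<close>

text \<open>The inner product is linear in its first argument. The real structure, the norm and the
  topology are those of the superclass \<^class>\<open>banach\<close>.\<close>

class chilbert_space = banach +
  fixes scaleC :: "complex \<Rightarrow> 'a \<Rightarrow> 'a"  (infixr "*\<^sub>C" 75)
    and cinner :: "'a \<Rightarrow> 'a \<Rightarrow> complex"
  assumes scaleC_add_right: "a *\<^sub>C (x + y) = a *\<^sub>C x + a *\<^sub>C y"
    and scaleC_add_left: "(a + b) *\<^sub>C x = a *\<^sub>C x + b *\<^sub>C x"
    and scaleC_scaleC: "a *\<^sub>C b *\<^sub>C x = (a * b) *\<^sub>C x"
    and scaleC_of_real: "complex_of_real r *\<^sub>C x = scaleR r x"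
    and cinner_commute: "cinner x y = cnj (cinner y x)"
    and cinner_add_left: "cinner (x + y) z = cinner x z + cinner y z"
    and cinner_scaleC_left: "cinner (a *\<^sub>C x) y = a * cinner x y"
    and cinner_norm: "cinner x x = complex_of_real ((norm x)\<^sup>2)"

instantiation complex :: chilbert_space
begin

definition scaleC_complex :: "complex \<Rightarrow> complex \<Rightarrow> complex" where
  "scaleC_complex a x = a * x"

definition cinner_complex :: "complex \<Rightarrow> complex \<Rightarrow> complex" where
  "cinner_complex x y = x * cnj y"

instance
  by standard
    (simp_all add: scaleC_complex_def cinner_complex_def algebra_simps scaleR_conv_of_real
      complex_norm_square[symmetric])

end

lemma cinner_add_right: "cinner x (y + z) = cinner x y + cinner x (z :: 'a :: chilbert_space)"
  by (metis cinner_add_left cinner_commute complex_cnj_add)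

lemma cinner_scaleC_right:
  "cinner x (a *\<^sub>C y) = cnj a * cinner x (y :: 'a :: chilbert_space)"
  by (metis cinner_commute cinner_scaleC_left complex_cnj_mult)

lemma norm_scaleC: "norm (a *\<^sub>C x) = cmod a * norm (x :: 'a :: chilbert_space)"
proof -
  have "complex_of_real ((norm (a *\<^sub>C x))\<^sup>2) = a * cnj a * cinner x x"
    unfolding cinner_norm[symmetric] by (simp add: cinner_scaleC_left cinner_scaleC_right)
  also have "\<dots> = complex_of_real ((cmod a * norm x)\<^sup>2)"
    by (simp add: cinner_norm complex_norm_square[symmetric] power_mult_distrib)
  finally have "(norm (a *\<^sub>C x))\<^sup>2 = (cmod a * norm x)\<^sup>2"
    using of_real_eq_iff by blast
  then show ?thesis
    by (simp add: power2_eq_iff_nonneg)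
qed

lemma cinner_bound: "2 * cmod (cinner x y) \<le> (norm x)\<^sup>2 + (norm (y :: 'a :: chilbert_space))\<^sup>2"
proof (cases "cinner x y = 0")
  case False
  define c where "c = - sgn (cinner x y)"
  have c: "cmod c = 1"
    using False by (simp add: c_def norm_sgn)
  have cc: "cnj c * cinner x y = - complex_of_real (cmod (cinner x y))"
  proof -
    have "cnj (cinner x y) * cinner x y
        = complex_of_real (cmod (cinner x y)) * complex_of_real (cmod (cinner x y))"
      using complex_norm_square[of "cinner x y"] by (simp add: power2_eq_square mult.commute)
    then show ?thesis
      using False by (simp add: c_def sgn_eq field_simps)
  qed
  have "cinner (x + c *\<^sub>C y) (x + c *\<^sub>C y)
      = cinner x x + cinner (c *\<^sub>C y) (c *\<^sub>C y) + (cnj c * cinner x y + cnj (cnj c * cinner x y))"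
    using cinner_commute[of y x]
    by (simp add: cinner_add_left cinner_add_right cinner_scaleC_left cinner_scaleC_right
        distrib_left)
  also have "\<dots> = complex_of_real ((norm x)\<^sup>2 + (norm y)\<^sup>2 - 2 * cmod (cinner x y))"
    unfolding cc by (simp add: cinner_norm norm_scaleC c)
  finally have "(norm (x + c *\<^sub>C y))\<^sup>2 = (norm x)\<^sup>2 + (norm y)\<^sup>2 - 2 * cmod (cinner x y)"
    unfolding cinner_norm using of_real_eq_iff by blast
  then show ?thesis
    by (metis diff_ge_0_iff_ge zero_le_power2)
qed simp

section \<open>Hilbert direct sums over the integers\<close>

text \<open>The Hilbert direct sum of countably many copies, indexed by the integers, of the space
  given by a type.\<close>

typedef (overloaded) 'a ell2 =
  "{f :: int \<Rightarrow> 'a :: chilbert_space. (\<lambda>k. (norm (f k))\<^sup>2) summable_on UNIV}"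
  morphisms coord Abs_ell2
  by (rule exI[of _ "\<lambda>_. 0"]) simp

lemma sq_bounded_summable:
  assumes "\<And>A :: int set. finite A \<Longrightarrow> (\<Sum>k\<in>A. (norm (f k))\<^sup>2) \<le> B"
  shows "(\<lambda>k. (norm (f k))\<^sup>2) summable_on UNIV"
  by (rule nonneg_bdd_above_summable_on) (auto intro!: bdd_aboveI[of _ B] assms)

lemma coord_summable: "(\<lambda>k. (norm (coord x k))\<^sup>2) summable_on UNIV"
  using coord[of x] by simp

lemma ell2_eqI: "(\<And>k. coord x k = coord y k) \<Longrightarrow> x = y"
  by (metis coord_inject ext)

lemma summable_sq_add:
  fixes f g :: "int \<Rightarrow> 'a :: chilbert_space"
  assumes "(\<lambda>k. (norm (f k))\<^sup>2) summable_on UNIV" "(\<lambda>k. (norm (g k))\<^sup>2) summable_on UNIV"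
  shows "(\<lambda>k. (norm (f k + g k))\<^sup>2) summable_on UNIV"
proof (rule summable_on_comparison_test)
  show "(\<lambda>k. 2 * (norm (f k))\<^sup>2 + 2 * (norm (g k))\<^sup>2) summable_on UNIV"
    by (intro summable_on_add summable_on_cmult_right assms)
  fix k
  have "(norm (f k + g k))\<^sup>2 \<le> (norm (f k) + norm (g k))\<^sup>2"
    by (simp add: norm_triangle_ineq power_mono)
  also have "\<dots> \<le> 2 * (norm (f k))\<^sup>2 + 2 * (norm (g k))\<^sup>2"
    using sum_squares_bound[of "norm (f k)" "norm (g k)"] by (simp add: power2_sum)
  finally show "(norm (f k + g k))\<^sup>2 \<le> 2 * (norm (f k))\<^sup>2 + 2 * (norm (g k))\<^sup>2" .
qed auto

lemma summable_sq_scaleC: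
  fixes f :: "int \<Rightarrow> 'a :: chilbert_space"
  assumes "(\<lambda>k. (norm (f k))\<^sup>2) summable_on UNIV"
  shows "(\<lambda>k. (norm (c *\<^sub>C f k))\<^sup>2) summable_on UNIV"
  by (simp add: norm_scaleC power_mult_distrib summable_on_cmult_right assms)

lemma summable_cinner:
  fixes f g :: "int \<Rightarrow> 'a :: chilbert_space"
  assumes "(\<lambda>k. (norm (f k))\<^sup>2) summable_on UNIV" "(\<lambda>k. (norm (g k))\<^sup>2) summable_on UNIV"
  shows "(\<lambda>k. cinner (f k) (g k)) summable_on UNIV"
proof (rule abs_summable_summable, rule summable_on_comparison_test)
  show "(\<lambda>k. (norm (f k))\<^sup>2 + (norm (g k))\<^sup>2) summable_on UNIV"
    by (intro summable_on_add assms)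
  show "norm (cinner (f k) (g k)) \<le> (norm (f k))\<^sup>2 + (norm (g k))\<^sup>2" for k
    using cinner_bound[of "f k" "g k"] norm_ge_zero[of "cinner (f k) (g k)"] by linarith
qed simp

instantiation ell2 :: (chilbert_space) real_normed_vector
begin

definition zero_ell2 :: "'a ell2" where
  "0 = Abs_ell2 (\<lambda>_. 0)"

definition plus_ell2 :: "'a ell2 \<Rightarrow> 'a ell2 \<Rightarrow> 'a ell2" where
  "x + y = Abs_ell2 (\<lambda>k. coord x k + coord y k)"

definition uminus_ell2 :: "'a ell2 \<Rightarrow> 'a ell2" where
  "- x = Abs_ell2 (\<lambda>k. - coord x k)"

definition minus_ell2 :: "'a ell2 \<Rightarrow> 'a ell2 \<Rightarrow> 'a ell2" where
  "x - y = Abs_ell2 (\<lambda>k. coord x k - coord y k)"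

definition scaleR_ell2 :: "real \<Rightarrow> 'a ell2 \<Rightarrow> 'a ell2" where
  "scaleR r x = Abs_ell2 (\<lambda>k. scaleR r (coord x k))"

definition norm_ell2 :: "'a ell2 \<Rightarrow> real" where
  "norm x = sqrt (\<Sum>\<^sub>\<infinity>k. (norm (coord x k))\<^sup>2)"

definition sgn_ell2 :: "'a ell2 \<Rightarrow> 'a ell2" where
  "sgn_ell2 x = scaleR (inverse (norm x)) x"

definition dist_ell2 :: "'a ell2 \<Rightarrow> 'a ell2 \<Rightarrow> real" where
  "dist_ell2 x y = norm (x - y)"

definition uniformity_ell2 :: "('a ell2 \<times> 'a ell2) filter" where
  "uniformity_ell2 = (INF e\<in>{0 <..}. principal {(x, y). dist x y < e})"

definition open_ell2 :: "'a ell2 set \<Rightarrow> bool" where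
  "open_ell2 S = (\<forall>x\<in>S. \<forall>\<^sub>F (x', y) in uniformity. x' = x \<longrightarrow> y \<in> S)"

lemma coord_zero: "coord 0 k = (0 :: 'a)"
  by (simp add: zero_ell2_def Abs_ell2_inverse)

lemma coord_plus: "coord (x + y) k = coord x k + coord (y :: 'a ell2) k"
  by (simp add: plus_ell2_def Abs_ell2_inverse summable_sq_add coord_summable)

lemma coord_uminus: "coord (- x) k = - coord (x :: 'a ell2) k"
  by (simp add: uminus_ell2_def Abs_ell2_inverse coord_summable)

lemma coord_minus: "coord (x - y) k = coord x k - coord (y :: 'a ell2) k"
proof -
  have "(\<lambda>k. (norm (coord x k + - coord y k))\<^sup>2) summable_on UNIV"
    by (rule summable_sq_add) (simp_all add: coord_summable)
  then show ?thesis
    by (simp add: minus_ell2_def Abs_ell2_inverse)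
qed

lemma coord_scaleR: "coord (scaleR r x) k = scaleR r (coord (x :: 'a ell2) k)"
  using summable_sq_scaleC[OF coord_summable, of "complex_of_real r" x]
  by (simp add: scaleR_ell2_def Abs_ell2_inverse scaleC_of_real)

lemma norm_ell2_nonneg: "0 \<le> norm (x :: 'a ell2)"
  by (simp add: norm_ell2_def infsum_nonneg)

lemma norm_ell2_sq: "(norm (x :: 'a ell2))\<^sup>2 = (\<Sum>\<^sub>\<infinity>k. (norm (coord x k))\<^sup>2)"
  by (simp add: norm_ell2_def infsum_nonneg)

lemma L2_le_norm_ell2: "finite A \<Longrightarrow> L2_set (\<lambda>k. norm (coord x k)) A \<le> norm (x :: 'a ell2)"
  unfolding L2_set_def norm_ell2_def
  by (intro real_sqrt_le_mono finite_sum_le_infsum coord_summable) auto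

lemma norm_ell2_leI:
  assumes "\<And>A. finite A \<Longrightarrow> L2_set (\<lambda>k. norm (coord (x :: 'a ell2) k)) A \<le> b" "0 \<le> b"
  shows "norm x \<le> b"
proof -
  have "(\<Sum>\<^sub>\<infinity>k. (norm (coord x k))\<^sup>2) \<le> b\<^sup>2"
  proof (rule infsum_le_finite_sums[OF coord_summable])
    fix A :: "int set" assume "finite A"
    then show "(\<Sum>k\<in>A. (norm (coord x k))\<^sup>2) \<le> b\<^sup>2"
      using assms(1)[of A] by (simp add: L2_set_def sqrt_le_D)
  qed
  then show ?thesis
    unfolding norm_ell2_def using assms(2) by (simp add: real_le_lsqrt)
qed

lemma norm_coord_le: "norm (coord x k) \<le> norm (x :: 'a ell2)"
  using L2_le_norm_ell2[of "{k}" x] by simp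

instance
proof
  fix x y z :: "'a ell2" and a b :: real
  show "dist x y = norm (x - y)" by (fact dist_ell2_def)
  show "sgn x = inverse (norm x) *\<^sub>R x" by (fact sgn_ell2_def)
  show "uniformity = (INF e\<in>{0 <..}. principal {(x :: 'a ell2, y). dist x y < e})"
    by (fact uniformity_ell2_def)
  show "open S \<longleftrightarrow> (\<forall>x\<in>S. \<forall>\<^sub>F (x', y) in uniformity. x' = x \<longrightarrow> y \<in> S)" for S :: "'a ell2 set"
    by (fact open_ell2_def)
  show "x + y + z = x + (y + z)" "x + y = y + x" "0 + x = x" "- x + x = 0" "x - y = x + - y"
    "a *\<^sub>R (x + y) = a *\<^sub>R x + a *\<^sub>R y" "(a + b) *\<^sub>R x = a *\<^sub>R x + b *\<^sub>R x"
    "a *\<^sub>R b *\<^sub>R x = (a * b) *\<^sub>R x" "1 *\<^sub>R x = x"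
    by (rule ell2_eqI; simp add: coord_plus coord_minus coord_uminus coord_zero coord_scaleR
        algebra_simps)+
  show "norm x = 0 \<longleftrightarrow> x = 0"
  proof
    assume "norm x = 0"
    then show "x = 0"
      by (intro ell2_eqI) (metis coord_zero norm_coord_le norm_le_zero_iff)
  qed (simp add: norm_ell2_def coord_zero)
  show "norm (x + y) \<le> norm x + norm y"
  proof (rule norm_ell2_leI)
    fix A :: "int set" assume A: "finite A"
    have "L2_set (\<lambda>k. norm (coord (x + y) k)) A
        \<le> L2_set (\<lambda>k. norm (coord x k) + norm (coord y k)) A"
      by (rule L2_set_mono) (simp_all add: coord_plus norm_triangle_ineq)
    also have "\<dots> \<le> L2_set (\<lambda>k. norm (coord x k)) A + L2_set (\<lambda>k. norm (coord y k)) A"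
      by (rule L2_set_triangle_ineq)
    also have "\<dots> \<le> norm x + norm y"
      by (intro add_mono L2_le_norm_ell2 A)
    finally show "L2_set (\<lambda>k. norm (coord (x + y) k)) A \<le> norm x + norm y" .
  qed (simp add: norm_ell2_nonneg)
  show "norm (a *\<^sub>R x) = \<bar>a\<bar> * norm x"
    by (simp add: norm_ell2_def coord_scaleR power_mult_distrib infsum_cmult_right'
        real_sqrt_mult)
qed

end

instance ell2 :: (chilbert_space) complete_space
proof
  fix X :: "nat \<Rightarrow> 'a ell2"
  assume X: "Cauchy X"
  have "Cauchy (\<lambda>n. coord (X n) k)" for k
    unfolding Cauchy_altdef2
  proof (intro allI impI)
    fix e :: real assume "e > 0"
    then obtain N where "\<forall>n\<ge>N. dist (X n) (X N) < e"
      using X unfolding Cauchy_altdef2 by blast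
    then show "\<exists>N. \<forall>n\<ge>N. dist (coord (X n) k) (coord (X N) k) < e"
      by (metis coord_minus dist_norm le_less_trans norm_coord_le)
  qed
  then have "\<forall>k. \<exists>l. (\<lambda>n. coord (X n) k) \<longlonglongrightarrow> l"
    by (intro allI convergentD Cauchy_convergent)
  then obtain L where L: "\<And>k. (\<lambda>n. coord (X n) k) \<longlonglongrightarrow> L k"
    using choice[of "\<lambda>k l. (\<lambda>n. coord (X n) k) \<longlonglongrightarrow> l"] by blast
  have fin: "L2_set (\<lambda>k. norm (coord (X m) k - L k)) A \<le> e"
    if N: "\<forall>m\<ge>N. \<forall>n\<ge>N. dist (X m) (X n) < e" and m: "m \<ge> N" and A: "finite A" for e N m A
  proof (rule tendsto_upperbound)
    show "(\<lambda>n. L2_set (\<lambda>k. norm (coord (X m) k - coord (X n) k)) A)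
        \<longlonglongrightarrow> L2_set (\<lambda>k. norm (coord (X m) k - L k)) A"
      unfolding L2_set_def by (intro tendsto_intros L)
    show "\<forall>\<^sub>F n in sequentially. L2_set (\<lambda>k. norm (coord (X m) k - coord (X n) k)) A \<le> e"
      unfolding eventually_sequentially
    proof (intro exI[of _ N] allI impI)
      fix n assume "n \<ge> N"
      then have "norm (X m - X n) < e"
        using N m by (simp add: dist_norm)
      then show "L2_set (\<lambda>k. norm (coord (X m) k - coord (X n) k)) A \<le> e"
        using L2_le_norm_ell2[OF A, of "X m - X n"] by (simp add: coord_minus)
    qed
  qed simp
  have sum_diff: "(\<lambda>k. (norm (coord (X m) k - L k))\<^sup>2) summable_on UNIV"
    if N: "\<forall>m\<ge>N. \<forall>n\<ge>N. dist (X m) (X n) < e" and m: "m \<ge> N" for e N m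
  proof (rule sq_bounded_summable)
    fix A :: "int set" assume "finite A"
    then show "(\<Sum>k\<in>A. (norm (coord (X m) k - L k))\<^sup>2) \<le> e\<^sup>2"
      using fin[OF N m] by (simp add: L2_set_def sqrt_le_D)
  qed
  define l where "l = Abs_ell2 L"
  have l: "coord l = L"
  proof -
    obtain N where N: "\<forall>m\<ge>N. \<forall>n\<ge>N. dist (X m) (X n) < 1"
      using X unfolding Cauchy_def by (meson zero_less_one)
    have "(\<lambda>k. (norm (L k - coord (X N) k + coord (X N) k))\<^sup>2) summable_on UNIV"
      using sum_diff[OF N order_refl]
      by (intro summable_sq_add coord_summable) (simp add: norm_minus_commute)
    then show ?thesis
      by (simp add: l_def Abs_ell2_inverse)
  qed
  have "X \<longlonglongrightarrow> l"
  proof (rule LIMSEQ_I)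
    fix e :: real assume e: "e > 0"
    then obtain N where N: "\<forall>m\<ge>N. \<forall>n\<ge>N. dist (X m) (X n) < e / 2"
      using X unfolding Cauchy_def by (meson half_gt_zero)
    have "norm (X n - l) \<le> e / 2" if "n \<ge> N" for n
      by (rule norm_ell2_leI) (use fin[OF N that] e in \<open>simp_all add: coord_minus l\<close>)
    then show "\<exists>N. \<forall>n\<ge>N. norm (X n - l) < e"
      using e by (intro exI[of _ N]) force
  qed
  then show "convergent X"
    by (rule convergentI)
qed

instantiation ell2 :: (chilbert_space) chilbert_space
begin

definition scaleC_ell2 :: "complex \<Rightarrow> 'a ell2 \<Rightarrow> 'a ell2" where
  "c *\<^sub>C x = Abs_ell2 (\<lambda>k. c *\<^sub>C coord x k)"

definition cinner_ell2 :: "'a ell2 \<Rightarrow> 'a ell2 \<Rightarrow> complex" where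
  "cinner x y = (\<Sum>\<^sub>\<infinity>k. cinner (coord x k) (coord y k))"

lemma coord_scaleC: "coord (c *\<^sub>C x) k = c *\<^sub>C coord (x :: 'a ell2) k"
  by (simp add: scaleC_ell2_def Abs_ell2_inverse summable_sq_scaleC coord_summable)

instance
proof
  fix x y z :: "'a ell2" and a b :: complex and r :: real
  show "a *\<^sub>C (x + y) = a *\<^sub>C x + a *\<^sub>C y" "(a + b) *\<^sub>C x = a *\<^sub>C x + b *\<^sub>C x"
    "a *\<^sub>C b *\<^sub>C x = (a * b) *\<^sub>C x" "complex_of_real r *\<^sub>C x = r *\<^sub>R x"
    by (rule ell2_eqI; simp add: coord_plus coord_scaleC coord_scaleR scaleC_add_right
        scaleC_add_left scaleC_scaleC scaleC_of_real)+
  show "cinner x y = cnj (cinner y x)"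
    unfolding cinner_ell2_def infsum_cnj[symmetric]
    by (rule infsum_cong) (rule cinner_commute)
  show "cinner (x + y) z = cinner x z + cinner y z"
    by (simp add: cinner_ell2_def coord_plus cinner_add_left infsum_add summable_cinner
        coord_summable)
  show "cinner (a *\<^sub>C x) y = a * cinner x y"
    by (simp add: cinner_ell2_def coord_scaleC cinner_scaleC_left infsum_cmult_right')
  have "((\<lambda>k. complex_of_real ((norm (coord x k))\<^sup>2)) has_sum complex_of_real ((norm x)\<^sup>2)) UNIV"
    unfolding norm_ell2_sq by (intro has_sum_of_real has_sum_infsum coord_summable)
  then show "cinner x x = complex_of_real ((norm x)\<^sup>2)"
    unfolding cinner_ell2_def cinner_norm by (rule infsumI)
qed

end

section \<open>Operators between closed subspaces\<close>

text \<open>A Hilbert space is represented as a closed subspace of a type of class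
  \<^class>\<open>chilbert_space\<close>. This allows families of Hilbert spaces that vary with an index, and loses
  no generality, since the members of a family are closed subspaces of their direct sum.\<close>

definition closed_csubspace :: "'a :: chilbert_space set \<Rightarrow> bool" where
  "closed_csubspace V \<longleftrightarrow> 0 \<in> V \<and> (\<forall>x\<in>V. \<forall>y\<in>V. x + y \<in> V) \<and> (\<forall>c. \<forall>x\<in>V. c *\<^sub>C x \<in> V) \<and> closed V"

definition hdsum :: "(int \<Rightarrow> 'a :: chilbert_space set) \<Rightarrow> 'a ell2 set" where
  "hdsum U = {u. \<forall>k. coord u k \<in> U k}"

text \<open>Operators on \<open>V\<close> are extensional functions, so that equality of operators is equality of
  functions.\<close>

definition bop :: "'a :: chilbert_space set \<Rightarrow> 'b :: chilbert_space set \<Rightarrow> ('a \<Rightarrow> 'b) set" where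
  "bop V W = {T \<in> V \<rightarrow>\<^sub>E W.
     (\<forall>x\<in>V. \<forall>y\<in>V. T (x + y) = T x + T y) \<and> (\<forall>c. \<forall>x\<in>V. T (c *\<^sub>C x) = c *\<^sub>C T x) \<and>
     (\<exists>B. \<forall>x\<in>V. norm (T x) \<le> B * norm x)}"

definition contractions :: "'a :: chilbert_space set \<Rightarrow> 'b :: chilbert_space set \<Rightarrow> ('a \<Rightarrow> 'b) set"
  where "contractions V W = {T \<in> bop V W. \<forall>x\<in>V. norm (T x) \<le> norm x}"

definition adjoint_op ::
    "'a :: chilbert_space set \<Rightarrow> 'b :: chilbert_space set \<Rightarrow> ('a \<Rightarrow> 'b) \<Rightarrow> ('b \<Rightarrow> 'a)" where
  "adjoint_op V W T =
     (THE S. S \<in> bop W V \<and> (\<forall>x\<in>V. \<forall>y\<in>W. cinner (T x) y = cinner x (S y)))"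

definition positive_op :: "'a :: chilbert_space set \<Rightarrow> ('a \<Rightarrow> 'a) \<Rightarrow> bool" where
  "positive_op V T \<longleftrightarrow>
     T \<in> bop V V \<and> (\<forall>x\<in>V. Im (cinner (T x) x) = 0 \<and> 0 \<le> Re (cinner (T x) x))"

definition sqrt_op :: "'a :: chilbert_space set \<Rightarrow> ('a \<Rightarrow> 'a) \<Rightarrow> ('a \<Rightarrow> 'a)" where
  "sqrt_op V A = (THE D. positive_op V D \<and> (\<forall>x\<in>V. D (D x) = A x))"

definition defect ::
    "'a :: chilbert_space set \<Rightarrow> 'b :: chilbert_space set \<Rightarrow> ('a \<Rightarrow> 'b) \<Rightarrow> ('a \<Rightarrow> 'a)" where
  "defect V W T = sqrt_op V (\<lambda>x\<in>V. x - adjoint_op V W T (T x))"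

section \<open>Upper triangular operator matrices\<close>

text \<open>The entry \<open>H j k\<close> maps the \<open>k\<close>-th space of the domain to the \<open>j\<close>-th space of the range.\<close>

type_synonym ('a, 'b) opmat = "int \<Rightarrow> int \<Rightarrow> 'a \<Rightarrow> 'b"

definition UM :: "(int \<Rightarrow> 'a :: chilbert_space set) \<Rightarrow> (int \<Rightarrow> 'b :: chilbert_space set)
    \<Rightarrow> ('a, 'b) opmat set" where
  "UM U Y = {H. (\<forall>j k. H j k \<in> bop (U k) (Y j)) \<and> (\<forall>j k. k < j \<longrightarrow> (\<forall>u\<in>U k. H j k u = 0))}"

definition UM2_ball :: "(int \<Rightarrow> 'a :: chilbert_space set) \<Rightarrow> (int \<Rightarrow> 'b :: chilbert_space set)
    \<Rightarrow> ('a, 'b) opmat set" where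
  "UM2_ball U Y = {H \<in> UM U Y. \<forall>k. \<forall>u\<in>U k.
     (\<lambda>j. (norm (H j k u))\<^sup>2) summable_on {..k} \<and>
     (\<Sum>\<^sub>\<infinity>j\<in>{..k}. (norm (H j k u))\<^sup>2) \<le> (norm u)\<^sup>2}"

text \<open>\<open>T\<close> is the operator on the direct sums given by the action of the matrix on column vectors.
  Each row of a bounded operator matrix is bounded, so the series converges unconditionally.\<close>

definition induces :: "(int \<Rightarrow> 'a :: chilbert_space set) \<Rightarrow> (int \<Rightarrow> 'b :: chilbert_space set)
    \<Rightarrow> ('a, 'b) opmat \<Rightarrow> ('a ell2 \<Rightarrow> 'b ell2) \<Rightarrow> bool" where
  "induces U Y H T \<longleftrightarrow> T \<in> bop (hdsum U) (hdsum Y) \<and>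
     (\<forall>u\<in>hdsum U. \<forall>j. ((\<lambda>k. H j k (coord u k)) has_sum coord (T u) j) UNIV)"

definition mat_op :: "(int \<Rightarrow> 'a :: chilbert_space set) \<Rightarrow> (int \<Rightarrow> 'b :: chilbert_space set)
    \<Rightarrow> ('a, 'b) opmat \<Rightarrow> ('a ell2 \<Rightarrow> 'b ell2)" where
  "mat_op U Y H = (THE T. induces U Y H T)"

definition UM_inf :: "(int \<Rightarrow> 'a :: chilbert_space set) \<Rightarrow> (int \<Rightarrow> 'b :: chilbert_space set)
    \<Rightarrow> ('a, 'b) opmat set" where
  "UM_inf U Y = {H \<in> UM U Y. \<exists>T. induces U Y H T}"

definition UM_inf_ball :: "(int \<Rightarrow> 'a :: chilbert_space set) \<Rightarrow> (int \<Rightarrow> 'b :: chilbert_space set)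
    \<Rightarrow> ('a, 'b) opmat set" where
  "UM_inf_ball U Y =
     {H \<in> UM U Y. \<exists>T. induces U Y H T \<and> T \<in> contractions (hdsum U) (hdsum Y)}"

definition strictly_upper :: "(int \<Rightarrow> 'a :: chilbert_space set)
    \<Rightarrow> ('a, 'b :: chilbert_space) opmat \<Rightarrow> bool" where
  "strictly_upper U H \<longleftrightarrow> (\<forall>j k. k \<le> j \<longrightarrow> (\<forall>u\<in>U k. H j k u = 0))"

definition UM_inf0 :: "(int \<Rightarrow> 'a :: chilbert_space set) \<Rightarrow> (int \<Rightarrow> 'b :: chilbert_space set)
    \<Rightarrow> ('a, 'b) opmat set" where
  "UM_inf0 U Y = {H \<in> UM_inf U Y. strictly_upper U H}"

definition UM_inf_ball0 :: "(int \<Rightarrow> 'a :: chilbert_space set) \<Rightarrow> (int \<Rightarrow> 'b :: chilbert_space set)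
    \<Rightarrow> ('a, 'b) opmat set" where
  "UM_inf_ball0 U Y = {H \<in> UM_inf_ball U Y. strictly_upper U H}"

text \<open>For upper triangular factors, the terms of the matrix product outside \<open>{j..k}\<close> vanish. In
  all matrix operations below \<open>U\<close> is the family of domain spaces of the result.\<close>

definition mat_mult :: "(int \<Rightarrow> 'a set) \<Rightarrow> ('b, 'c :: chilbert_space) opmat \<Rightarrow> ('a, 'b) opmat
    \<Rightarrow> ('a, 'c) opmat" where
  "mat_mult U M N = (\<lambda>j k. \<lambda>u\<in>U k. \<Sum>i\<in>{j..k}. M j i (N i k u))"

definition mat_diff :: "(int \<Rightarrow> 'a set) \<Rightarrow> ('a, 'b :: chilbert_space) opmat \<Rightarrow> ('a, 'b) opmat
    \<Rightarrow> ('a, 'b) opmat" where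
  "mat_diff U M N = (\<lambda>j k. \<lambda>u\<in>U k. M j k u - N j k u)"

definition mat_id :: "(int \<Rightarrow> 'a set) \<Rightarrow> ('a :: chilbert_space, 'a) opmat" where
  "mat_id U = (\<lambda>j k. \<lambda>u\<in>U k. if j = k then u else 0)"

definition is_mat_inv :: "(int \<Rightarrow> 'a :: chilbert_space set) \<Rightarrow> ('a, 'a) opmat \<Rightarrow> ('a, 'a) opmat
    \<Rightarrow> bool" where
  "is_mat_inv U M N \<longleftrightarrow> N \<in> UM U U \<and> mat_mult U M N = mat_id U \<and> mat_mult U N M = mat_id U"

definition mat_inv :: "(int \<Rightarrow> 'a :: chilbert_space set) \<Rightarrow> ('a, 'a) opmat \<Rightarrow> ('a, 'a) opmat" where
  "mat_inv U M = (THE N. is_mat_inv U M N)"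

section \<open>The interpolation problem\<close>

definition column_op :: "(int \<Rightarrow> 'a :: chilbert_space set) \<Rightarrow> ('a, 'b :: chilbert_space) opmat
    \<Rightarrow> int \<Rightarrow> 'a \<Rightarrow> 'b ell2" where
  "column_op U H k = (\<lambda>u\<in>U k. Abs_ell2 (\<lambda>j. H j k u))"

definition col_defect :: "(int \<Rightarrow> 'a :: chilbert_space set) \<Rightarrow> (int \<Rightarrow> 'b :: chilbert_space set)
    \<Rightarrow> ('a, 'b) opmat \<Rightarrow> int \<Rightarrow> 'a \<Rightarrow> 'a" where
  "col_defect U Y H k = defect (U k) (hdsum Y) (column_op U H k)"

definition defect_space :: "(int \<Rightarrow> 'a :: chilbert_space set) \<Rightarrow> (int \<Rightarrow> 'b :: chilbert_space set)
    \<Rightarrow> ('a, 'b) opmat \<Rightarrow> int \<Rightarrow> 'a set" where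
  "defect_space U Y H k = closure (col_defect U Y H k ` U k)"

definition F_H :: "(int \<Rightarrow> 'a :: chilbert_space set) \<Rightarrow> (int \<Rightarrow> 'b :: chilbert_space set)
    \<Rightarrow> (int \<Rightarrow> 'a set) \<Rightarrow> ('a, 'b) opmat \<Rightarrow> int \<Rightarrow> 'a set" where
  "F_H U Y F H k = closure (col_defect U Y H k ` F k)"

definition omega_H :: "(int \<Rightarrow> 'a :: chilbert_space set) \<Rightarrow> (int \<Rightarrow> 'b :: chilbert_space set)
    \<Rightarrow> (int \<Rightarrow> 'a set) \<Rightarrow> (int \<Rightarrow> 'a \<Rightarrow> 'a) \<Rightarrow> ('a, 'b) opmat \<Rightarrow> int \<Rightarrow> 'a \<Rightarrow> 'a" where
  "omega_H U Y F \<omega>2 H k =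
     (THE T. T \<in> contractions (F_H U Y F H k) (defect_space U Y H (k - 1)) \<and>
        (\<forall>f\<in>F k. T (col_defect U Y H k f) = col_defect U Y H (k - 1) (\<omega>2 k f)))"

definition C_set :: "(int \<Rightarrow> 'a :: chilbert_space set) \<Rightarrow> (int \<Rightarrow> 'b :: chilbert_space set)
    \<Rightarrow> (int \<Rightarrow> 'a set) \<Rightarrow> (int \<Rightarrow> 'a \<Rightarrow> 'a) \<Rightarrow> ('a, 'b) opmat \<Rightarrow> ('a, 'a) opmat set" where
  "C_set U Y F \<omega>2 H =
     {C \<in> UM_inf_ball0 (defect_space U Y H) (defect_space U Y H).
        \<forall>j k. \<forall>x\<in>F_H U Y F H k. C j k x = (if j = k - 1 then omega_H U Y F \<omega>2 H k x else 0)}"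

text \<open>The existence of the inverse of \<open>I - Z2\<close> is automatic for strictly upper triangular \<open>Z2\<close>; it
  is stated explicitly because \<^const>\<open>mat_inv\<close> is arbitrary on non-invertible matrices.\<close>

definition Z_pairs :: "(int \<Rightarrow> 'a :: chilbert_space set) \<Rightarrow> (int \<Rightarrow> 'b :: chilbert_space set)
    \<Rightarrow> (int \<Rightarrow> 'a set) \<Rightarrow> (int \<Rightarrow> 'a \<Rightarrow> 'b) \<Rightarrow> (int \<Rightarrow> 'a \<Rightarrow> 'a) \<Rightarrow> ('a, 'b) opmat
    \<Rightarrow> (('a, 'b) opmat \<times> ('a, 'a) opmat) set" where
  "Z_pairs U Y F \<omega>1 \<omega>2 H =
     {(Z1, Z2). Z1 \<in> UM_inf U Y \<and> Z2 \<in> UM_inf0 U U \<and>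
        (\<forall>u\<in>hdsum U. (norm (mat_op U Y Z1 u))\<^sup>2 + (norm (mat_op U U Z2 u))\<^sup>2 \<le> (norm u)\<^sup>2) \<and>
        (\<forall>j k. \<forall>f\<in>F k. Z1 j k f = (if j = k then \<omega>1 k f else 0) \<and>
                         Z2 j k f = (if j = k - 1 then \<omega>2 k f else 0)) \<and>
        (\<exists>N. is_mat_inv U (mat_diff U (mat_id U) Z2) N) \<and>
        H = mat_mult U Z1 (mat_inv U (mat_diff U (mat_id U) Z2))}"

end

theory Submission
  imports Defs
begin

text \<open>A solution \<open>Z2\<close> determines \<open>Z1 = H (I - Z2)\<close> and is determined by the unitriangular matrix
  \<open>N = (I - Z2)\<^sup>-\<^sup>1\<close>; likewise a strictly upper triangular \<open>C\<close> is determined by \<open>M = (I - C)\<^sup>-\<^sup>1\<close>.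
  Substituting \<open>u = (I - Z2) v\<close> turns the contractivity of the pair into
  \<open>Re \<langle>(2 N - I) u, u\<rangle> \<ge> \<parallel>H u\<parallel>\<^sup>2\<close> for finitely supported \<open>u\<close>, where \<open>2 N - I\<close> is the Cayley transform
  of \<open>Z2\<close>. The kernel of this form has the diagonal entries \<open>I - H\<^sub>k\<^sup>* H\<^sub>k = D\<^sub>k\<^sup>2\<close>, so positivity makes
  it factor through the defect operators: \<open>N\<^sub>j\<^sub>k = D\<^sub>j M\<^sub>j\<^sub>k D\<^sub>k + H\<^sub>j\<^sup>* H\<^sub>k\<close> for \<open>j \<le> k\<close>, with \<open>M\<close>
  unitriangular on the defect spaces and \<open>Re \<langle>(2 M - I) w, w\<rangle> \<ge> 0\<close>, which says that \<open>C\<close> is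
  contractive. This relation between \<open>N\<close> and \<open>M\<close> is the bijection. The interpolation conditions on
  \<open>Z2\<close> and on \<open>C\<close> both say that a column of the resolvent continues the preceding one, and they
  correspond because the columns \<open>H\<^sub>k f\<close> and \<open>H\<^sub>k\<^sub>-\<^sub>1 \<omega>\<^sub>k\<^sub>2 f\<close> differ only in row \<open>k\<close>. A solution exists
  because the weighted shift built from \<open>\<omega>\<^sub>H\<close> and the projections onto \<open>F\<^sub>H\<close> is an admissible \<open>C\<close>.\<close>

section \<open>Hilbert spaces\<close>

text \<open>\<open>UM2_ball\<close> bounds only the columns, so neither \<open>H\<close> nor the
  resolvents need induce bounded operators, and the substitution \<open>u = (I - Z2) v\<close>
  cannot be made on the whole direct sum. It works on finite blocks because compression of upper
  triangular matrices to an interval \<open>{m..n}\<close> is multiplicative: the indices between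
  two members of an interval belong to it. So the truncated resolvent inverts the truncated
  \<open>I - C\<close>, and limits enter only when blocks are compared with operators or with full
  columns. Resolvents are used because \<open>N\<close> depends on \<open>M\<close> in an affine
  way, entry by entry, whereas \<open>Z2\<close> depends on \<open>C\<close> through inverses. The
  factor 2 is due to symmetrisation: \<open>N + N\<^sup>* - I\<close> has the entries of
  \<open>N\<close> above the diagonal and \<open>I\<close> on it, so subtracting the Gram matrix of
  the columns leaves \<open>N\<^sub>j\<^sub>k - H\<^sub>j\<^sup>* H\<^sub>k\<close> for
  \<open>j < k\<close> and \<open>D\<^sub>k\<^sup>2\<close> for \<open>j = k\<close>. The
  factorisation through the defects is read off from the 2 by 2 principal blocks of this kernel.
  Existence is shown on the side of \<open>C\<close>, where a contraction can be written down
  directly.\<close>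

lemma scaleC_zero_left [simp]: "0 *\<^sub>C x = (0 :: 'a :: chilbert_space)"
  using scaleC_of_real[of 0 x] by simp

lemma scaleC_minus_one: "(-1) *\<^sub>C x = - (x :: 'a :: chilbert_space)"
  using scaleC_of_real[of "-1" x] by simp

lemma scaleR_scaleC: "r *\<^sub>R x = complex_of_real r *\<^sub>C (x :: 'a :: chilbert_space)"
  by (simp add: scaleC_of_real)

lemma bounded_bilinear_scaleC: "bounded_bilinear (scaleC :: complex \<Rightarrow> 'a \<Rightarrow> 'a :: chilbert_space)"
proof
  show "\<exists>K. \<forall>a b. norm (a *\<^sub>C (b :: 'a)) \<le> norm a * norm b * K"
    by (rule exI[of _ 1]) (simp add: norm_scaleC)
qed (simp_all add: scaleC_add_left scaleC_add_right scaleR_scaleC scaleC_scaleC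
       scaleC_complex_def mult.commute)

interpretation scaleC: bounded_bilinear "scaleC :: complex \<Rightarrow> 'a \<Rightarrow> 'a :: chilbert_space"
  by (rule bounded_bilinear_scaleC)

text \<open>\<open>cinner_bound\<close> is the arithmetic-geometric form of Cauchy-Schwarz. On unit
  vectors it already has the sharp constant, and homogeneity gives the rest.\<close>

lemma norm_cinner_le: "cmod (cinner x y) \<le> norm x * norm (y :: 'a :: chilbert_space)"
proof (cases "x = 0 \<or> y = 0")
  case True
  have "cinner 0 y = 0" "cinner x 0 = 0"
    using cinner_scaleC_left[of 0 0 y] cinner_scaleC_right[of x 0 0] by simp_all
  then show ?thesis using True by auto
next
  case False
  then have "norm x > 0" "norm y > 0" by auto
  then have "2 * (cmod (cinner x y) / (norm x * norm y)) \<le> 2"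
    using cinner_bound[of "(1 / norm x) *\<^sub>R x" "(1 / norm y) *\<^sub>R y"]
    by (simp add: scaleR_scaleC cinner_scaleC_left cinner_scaleC_right norm_mult norm_scaleC norm_divide
        mult.commute del: of_real_divide)
  then show ?thesis
    using \<open>norm x > 0\<close> \<open>norm y > 0\<close> by (simp add: field_simps)
qed

lemma bounded_bilinear_cinner: "bounded_bilinear (cinner :: 'a \<Rightarrow> 'a :: chilbert_space \<Rightarrow> complex)"
proof
  show "\<exists>K. \<forall>a b. norm (cinner a (b :: 'a)) \<le> norm a * norm b * K"
    by (rule exI[of _ 1]) (simp add: norm_cinner_le)
qed (simp_all add: cinner_add_left cinner_add_right scaleR_scaleC cinner_scaleC_left
       cinner_scaleC_right scaleC_complex_def)

interpretation cinner: bounded_bilinear "cinner :: 'a \<Rightarrow> 'a :: chilbert_space \<Rightarrow> complex"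
  by (rule bounded_bilinear_cinner)

lemmas [simp] = scaleC.zero_right cinner.zero_left cinner.zero_right

lemma Re_cinner_commute: "Re (cinner x y) = Re (cinner y (x :: 'a :: chilbert_space))"
  by (metis cinner_commute complex_cnj(1) complex.sel(1) complex_cnj_cnj cnj.simps(1))

lemma norm_sq_Re: "(norm (x :: 'a :: chilbert_space))\<^sup>2 = Re (cinner x x)"
  by (simp add: cinner_norm)

lemma norm_add_sq:
  "(norm (x + y))\<^sup>2 = (norm x)\<^sup>2 + (norm y)\<^sup>2 + 2 * Re (cinner x (y :: 'a :: chilbert_space))"
  by (simp add: norm_sq_Re cinner.add_left cinner.add_right Re_cinner_commute[of y x])

lemma norm_diff_sq:
  "(norm (x - y))\<^sup>2 = (norm x)\<^sup>2 + (norm y)\<^sup>2 - 2 * Re (cinner x (y :: 'a :: chilbert_space))"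
  by (simp add: norm_sq_Re cinner.diff_left cinner.diff_right Re_cinner_commute[of y x])

lemma cinner_eq_self_zeroD: "cinner x x = 0 \<Longrightarrow> x = (0 :: 'a :: chilbert_space)"
  by (simp add: cinner_norm)

section \<open>Closed subspaces and bounded operators between them\<close>

locale csub =
  fixes V :: "'a :: chilbert_space set"
  assumes closed_csubspace: "closed_csubspace V"
begin

lemma zero_mem [simp]: "0 \<in> V"
  using closed_csubspace by (simp add: closed_csubspace_def)

lemma add_mem: "x \<in> V \<Longrightarrow> y \<in> V \<Longrightarrow> x + y \<in> V"
  using closed_csubspace by (simp add: closed_csubspace_def)

lemma scaleC_mem: "x \<in> V \<Longrightarrow> c *\<^sub>C x \<in> V"
  using closed_csubspace by (simp add: closed_csubspace_def)

lemma scaleR_mem: "x \<in> V \<Longrightarrow> c *\<^sub>R x \<in> V"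
  by (simp add: scaleR_scaleC scaleC_mem)

lemma uminus_mem: "x \<in> V \<Longrightarrow> - x \<in> V"
  using scaleC_mem[of x "-1"] by (simp add: scaleC_minus_one)

lemma diff_mem: "x \<in> V \<Longrightarrow> y \<in> V \<Longrightarrow> x - y \<in> V"
  using add_mem[of x "- y"] uminus_mem[of y] by simp

lemma sum_mem: "(\<And>i. i \<in> I \<Longrightarrow> f i \<in> V) \<Longrightarrow> sum f I \<in> V"
  by (induction I rule: infinite_finite_induct) (auto intro: add_mem)

lemma closed: "closed V"
  using closed_csubspace by (simp add: closed_csubspace_def)

lemmas mem = zero_mem add_mem scaleC_mem scaleR_mem uminus_mem diff_mem sum_mem

end

lemma bopI:
  assumes "T \<in> V \<rightarrow>\<^sub>E W" "\<And>x y. x \<in> V \<Longrightarrow> y \<in> V \<Longrightarrow> T (x + y) = T x + T y"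
    "\<And>c x. x \<in> V \<Longrightarrow> T (c *\<^sub>C x) = c *\<^sub>C T x" "\<And>x. x \<in> V \<Longrightarrow> norm (T x) \<le> B * norm x"
  shows "T \<in> bop V W"
  using assms unfolding bop_def by blast

lemma bop_restrictI:
  assumes "csub V" "\<And>x. x \<in> V \<Longrightarrow> T x \<in> W" "\<And>x y. x \<in> V \<Longrightarrow> y \<in> V \<Longrightarrow> T (x + y) = T x + T y"
    "\<And>c x. x \<in> V \<Longrightarrow> T (c *\<^sub>C x) = c *\<^sub>C T x" "\<And>x. x \<in> V \<Longrightarrow> norm (T x) \<le> B * norm x"
  shows "restrict T V \<in> bop V W"
  by (rule bopI[where B = B]) (use assms in \<open>auto simp: csub.add_mem csub.scaleC_mem\<close>)

lemma bop_mem: "T \<in> bop V W \<Longrightarrow> x \<in> V \<Longrightarrow> T x \<in> W"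
  by (auto simp: bop_def)

lemma bop_add: "T \<in> bop V W \<Longrightarrow> x \<in> V \<Longrightarrow> y \<in> V \<Longrightarrow> T (x + y) = T x + T y"
  by (auto simp: bop_def)

lemma bop_scaleC: "T \<in> bop V W \<Longrightarrow> x \<in> V \<Longrightarrow> T (c *\<^sub>C x) = c *\<^sub>C T x"
  by (auto simp: bop_def)

lemma bop_bound:
  assumes "T \<in> bop V W"
  obtains B where "B \<ge> 0" "\<And>x. x \<in> V \<Longrightarrow> norm (T x) \<le> B * norm x"
proof -
  obtain B where B: "\<And>x. x \<in> V \<Longrightarrow> norm (T x) \<le> B * norm x"
    using assms unfolding bop_def by blast
  show thesis
  \<comment> \<open>On the zero space a negative \<open>B\<close> passes the definition of
    \<open>bop\<close>, hence the maximum with 0.\<close>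
  proof (rule that[of "max B 0"])
    show "norm (T x) \<le> max B 0 * norm x" if "x \<in> V" for x
      using B[OF that] mult_right_mono[of B "max B 0" "norm x"] by simp
  qed simp
qed

lemma bop_eqI:
  assumes "S \<in> bop V W" "T \<in> bop V W'" "\<And>x. x \<in> V \<Longrightarrow> S x = T x"
  shows "S = T"
  using assms by (intro extensionalityI[of S V T]) (auto simp: bop_def PiE_def)

context csub begin

lemma bop_zero [simp]: "T \<in> bop V W \<Longrightarrow> T 0 = 0"
  using bop_scaleC[of T V W 0 0] by simp

lemma bop_diff: "T \<in> bop V W \<Longrightarrow> x \<in> V \<Longrightarrow> y \<in> V \<Longrightarrow> T (x - y) = T x - T y"
  using bop_add[of T V W "x - y" y] by (simp add: mem)

lemma bop_sum: "T \<in> bop V W \<Longrightarrow> (\<And>i. i \<in> I \<Longrightarrow> f i \<in> V) \<Longrightarrow> T (sum f I) = (\<Sum>i\<in>I. T (f i))"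
  by (induction I rule: infinite_finite_induct) (auto simp: bop_add mem)

lemma bop_continuous_on: assumes "T \<in> bop V W" shows "continuous_on V T"
proof -
  obtain B where B: "B \<ge> 0" "\<And>x. x \<in> V \<Longrightarrow> norm (T x) \<le> B * norm x"
    using bop_bound[OF assms] by blast
  have "B-lipschitz_on V T"
    by (rule lipschitz_onI) (use assms B mem in \<open>auto simp: dist_norm bop_diff[symmetric]\<close>)
  then show ?thesis by (rule lipschitz_on_continuous_on)
qed

lemma bop_compose:
  assumes "T \<in> bop V W" "S \<in> bop W X"
  shows "(\<lambda>x\<in>V. S (T x)) \<in> bop V X"
proof -
  obtain B where B: "B \<ge> 0" "\<And>x. x \<in> V \<Longrightarrow> norm (T x) \<le> B * norm x"
    using bop_bound[OF assms(1)] by blast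
  obtain C where C: "C \<ge> 0" "\<And>x. x \<in> W \<Longrightarrow> norm (S x) \<le> C * norm x"
    using bop_bound[OF assms(2)] by blast
  show ?thesis
  proof (rule bop_restrictI[where B = "C * B"])
    show "norm (S (T x)) \<le> C * B * norm x" if "x \<in> V" for x
    proof -
      have "norm (S (T x)) \<le> C * norm (T x)"
        using C(2) bop_mem[OF assms(1) that] .
      also have "\<dots> \<le> C * (B * norm x)"
        by (intro mult_left_mono B C that)
      finally show ?thesis by simp
    qed
  qed (use assms csub_axioms in \<open>auto simp: bop_mem bop_add bop_scaleC\<close>)
qed

lemma bop_restrict_add:
  assumes "S \<in> bop V W" "T \<in> bop V W" "csub W"
  shows "(\<lambda>x\<in>V. S x + T x) \<in> bop V W"
proof -
  obtain B where B: "B \<ge> 0" "\<And>x. x \<in> V \<Longrightarrow> norm (S x) \<le> B * norm x"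
    using bop_bound[OF assms(1)] by blast
  obtain C where C: "C \<ge> 0" "\<And>x. x \<in> V \<Longrightarrow> norm (T x) \<le> C * norm x"
    using bop_bound[OF assms(2)] by blast
  show ?thesis
  proof (rule bop_restrictI[where B = "B + C"])
    show "norm (S x + T x) \<le> (B + C) * norm x" if "x \<in> V" for x
      using norm_triangle_le[OF add_mono[OF B(2)[OF that] C(2)[OF that]]]
      by (simp add: distrib_right)
  qed (use assms csub_axioms in \<open>auto simp: bop_mem bop_add bop_scaleC csub.add_mem scaleC_add_right\<close>)
qed

lemma bop_restrict_scaleC:
  assumes "T \<in> bop V W" "csub W"
  shows "(\<lambda>x\<in>V. c *\<^sub>C T x) \<in> bop V W"
proof -
  obtain B where B: "B \<ge> 0" "\<And>x. x \<in> V \<Longrightarrow> norm (T x) \<le> B * norm x"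
    using bop_bound[OF assms(1)] by blast
  show ?thesis
  proof (rule bop_restrictI[where B = "cmod c * B"])
    show "norm (c *\<^sub>C T x) \<le> cmod c * B * norm x" if "x \<in> V" for x
      using mult_left_mono[OF B(2)[OF that], of "cmod c"] by (simp add: norm_scaleC)
  qed (use assms csub_axioms in \<open>auto simp: bop_mem bop_add bop_scaleC csub.scaleC_mem
      scaleC_add_right scaleC_scaleC mult.commute\<close>)
qed

lemma bop_restrict_diff:
  assumes "S \<in> bop V W" "T \<in> bop V W" "csub W"
  shows "(\<lambda>x\<in>V. S x - T x) \<in> bop V W"
proof -
  have "(\<lambda>x\<in>V. S x + (\<lambda>x\<in>V. (-1) *\<^sub>C T x) x) \<in> bop V W"
    by (intro bop_restrict_add bop_restrict_scaleC assms)
  moreover have "(\<lambda>x\<in>V. S x + (\<lambda>x\<in>V. (-1) *\<^sub>C T x) x) = (\<lambda>x\<in>V. S x - T x)"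
    by (auto simp: scaleC_minus_one)
  ultimately show ?thesis by simp
qed

lemma bop_restrict_zero: "csub W \<Longrightarrow> (\<lambda>x\<in>V. 0) \<in> bop V W"
  by (rule bop_restrictI[where B = 0]) (auto simp: csub_axioms csub.zero_mem)

lemma bop_restrict_id: "(\<lambda>x\<in>V. x) \<in> bop V V"
  by (rule bop_restrictI[where B = 1]) (auto simp: csub_axioms)

lemma bop_restrict_sum:
  assumes "csub W" "\<And>i. i \<in> I \<Longrightarrow> T i \<in> bop V W"
  shows "(\<lambda>x\<in>V. \<Sum>i\<in>I. T i x) \<in> bop V W"
  using assms(2)
proof (induction I rule: infinite_finite_induct)
  case (insert i I)
  have "(\<lambda>x\<in>V. T i x + (\<lambda>x\<in>V. \<Sum>i\<in>I. T i x) x) \<in> bop V W"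
    by (intro bop_restrict_add insert assms(1)) auto
  moreover have "(\<lambda>x\<in>V. T i x + (\<lambda>x\<in>V. \<Sum>i\<in>I. T i x) x) = (\<lambda>x\<in>V. \<Sum>i\<in>insert i I. T i x)"
    using insert.hyps by (auto simp: fun_eq_iff)
  ultimately show ?case by (simp only:)
qed (simp_all add: bop_restrict_zero assms)

end

lemma csub_closure:
  assumes "0 \<in> S" "\<And>x y. x \<in> S \<Longrightarrow> y \<in> S \<Longrightarrow> x + y \<in> S" "\<And>c x. x \<in> S \<Longrightarrow> c *\<^sub>C x \<in> S"
  shows "csub (closure S)"
proof
  have "x + y \<in> closure S" if "x \<in> closure S" "y \<in> closure S" for x y
  proof -
    from that obtain f g where "\<forall>n. f n \<in> S" "f \<longlonglongrightarrow> x" "\<forall>n. g n \<in> S" "g \<longlonglongrightarrow> y"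
      unfolding closure_sequential by blast
    then show ?thesis
      unfolding closure_sequential
      by (intro exI[of _ "\<lambda>n. f n + g n"]) (auto intro: tendsto_add assms)
  qed
  moreover have "c *\<^sub>C x \<in> closure S" if "x \<in> closure S" for c x
  proof -
    from that obtain f where "\<forall>n. f n \<in> S" "f \<longlonglongrightarrow> x"
      unfolding closure_sequential by blast
    then show ?thesis
      unfolding closure_sequential
      by (intro exI[of _ "\<lambda>n. c *\<^sub>C f n"]) (auto intro: scaleC.tendsto tendsto_const assms)
  qed
  ultimately show "closed_csubspace (closure S)"
    using assms(1) closure_subset[of S] by (auto simp: closed_csubspace_def)
qed

lemma (in csub) csub_closure_image:
  assumes "T \<in> bop V W"
  shows "csub (closure (T ` V))"
proof (rule csub_closure)
  show "0 \<in> T ` V"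
    using bop_zero[OF assms] zero_mem by (metis image_eqI)
  show "x + y \<in> T ` V" if "x \<in> T ` V" "y \<in> T ` V" for x y
    using that assms by (auto simp: bop_add[OF assms, symmetric] intro!: imageI add_mem)
  show "c *\<^sub>C x \<in> T ` V" if "x \<in> T ` V" for c x
    using that assms by (auto simp: bop_scaleC[OF assms, symmetric] intro!: imageI scaleC_mem)
qed

lemma bop_eq_on_closure:
  assumes "csub (closure S)" "T \<in> bop (closure S) W" "T' \<in> bop (closure S) W'"
    "\<And>x. x \<in> S \<Longrightarrow> T x = T' x" "x \<in> closure S"
  shows "T x = T' x"
proof -
  from assms(5) obtain f where f: "\<forall>n. f n \<in> S" "f \<longlonglongrightarrow> x"
    unfolding closure_sequential by blast
  then have in_cl: "\<forall>\<^sub>F n in sequentially. f n \<in> closure S"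
    using closure_subset by (auto intro!: always_eventually)
  have "(\<lambda>n. T (f n)) \<longlonglongrightarrow> T x"
    using continuous_on_tendsto_compose[OF csub.bop_continuous_on[OF assms(1,2)] f(2) assms(5) in_cl] .
  moreover have "(\<lambda>n. T' (f n)) \<longlonglongrightarrow> T' x"
    using continuous_on_tendsto_compose[OF csub.bop_continuous_on[OF assms(1,3)] f(2) assms(5) in_cl] .
  ultimately show ?thesis
    using assms(4) f(1) LIMSEQ_unique by fastforce
qed

section \<open>The Riesz representation theorem\<close>

lemma linear_term_eq_zero:
  fixes s d :: real
  assumes "s \<ge> 0" "\<And>t. 0 \<le> t\<^sup>2 * s + 2 * t * d"
  shows "d = 0"
proof -
  \<comment> \<open>The quadratic is least at \<open>t = - d / s\<close>; the denominator
    \<open>s + 1\<close> still gives a negative value for nonzero \<open>d\<close> and makes sense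
    for \<open>s = 0\<close>.\<close>
  have "(- d / (s + 1))\<^sup>2 * s + 2 * (- d / (s + 1)) * d = - (d\<^sup>2 * (s + 2)) / (s + 1)\<^sup>2"
    using assms(1) by (simp add: power2_eq_square divide_simps) (simp add: algebra_simps)
  with assms(2)[of "- d / (s + 1)"] have "d\<^sup>2 * (s + 2) / (s + 1)\<^sup>2 \<le> 0"
    by simp
  then show ?thesis
    using assms(1) by (simp add: divide_le_0_iff mult_le_0_iff zero_less_power)
qed

text \<open>If \<open>v\<close> represents \<open>\<phi>\<close>, then
  \<open>J x = (norm (x - v))\<^sup>2 - (norm v)\<^sup>2\<close>, so \<open>v\<close> has to be the
  minimiser of \<open>J\<close>. Completeness enters through a minimising sequence, which is Cauchy
  by the parallelogram law.\<close>

theorem (in csub) riesz_representation: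
  fixes \<phi> :: "'a \<Rightarrow> complex"
  assumes add: "\<And>x y. x \<in> V \<Longrightarrow> y \<in> V \<Longrightarrow> \<phi> (x + y) = \<phi> x + \<phi> y"
    and scale: "\<And>c x. x \<in> V \<Longrightarrow> \<phi> (c *\<^sub>C x) = c * \<phi> x"
    and bound: "\<And>x. x \<in> V \<Longrightarrow> cmod (\<phi> x) \<le> B * norm x"
  obtains v where "v \<in> V" "\<And>x. x \<in> V \<Longrightarrow> \<phi> x = cinner x v"
proof -
  define J where "J x = (norm x)\<^sup>2 - 2 * Re (\<phi> x)" for x
  have "restrict \<phi> V \<in> bop V UNIV"
    by (rule bop_restrictI[where B = B])
      (use assms csub_axioms in \<open>auto simp: scaleC_complex_def\<close>)
  from bop_continuous_on[OF this] have cont_\<phi>: "continuous_on V \<phi>"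
    by (simp cong: continuous_on_cong_simp)
  have lower: "J x \<ge> - (B\<^sup>2)" if "x \<in> V" for x
  proof -
    have "Re (\<phi> x) \<le> B * norm x"
      using bound[OF that] complex_Re_le_cmod[of "\<phi> x"] by linarith
    moreover have "(norm x)\<^sup>2 - 2 * (B * norm x) + B\<^sup>2 \<ge> 0"
      using zero_le_power2[of "norm x - B"] by (simp add: power2_diff algebra_simps)
    ultimately show ?thesis by (simp add: J_def)
  qed
  define I where "I = Inf (J ` V)"
  have bdd: "bdd_below (J ` V)"
    using lower by (auto intro!: bdd_belowI)
  have I_le: "I \<le> J x" if "x \<in> V" for x
    unfolding I_def using bdd that by (intro cInf_lower) auto
  have "V \<noteq> {}"
    using zero_mem by blast
  then have "\<exists>x\<in>V. J x < I + inverse (real (Suc n))" for n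
    using cInf_lessD[of "J ` V" "I + inverse (real (Suc n))"] zero_mem by (auto simp: I_def simp del: of_nat_Suc)
  then obtain f where f: "\<And>n. f n \<in> V" "\<And>n. J (f n) < I + inverse (real (Suc n))"
    by metis
  \<comment> \<open>Parallelogram law with midpoint \<open>z\<close>: the left side equals
    \<open>2 * J x + 2 * J y - 4 * J z\<close>, because the contributions of \<open>\<phi>\<close>
    cancel.\<close>
  have par: "(norm (x - y))\<^sup>2 \<le> 2 * (J x - I) + 2 * (J y - I)" if xy: "x \<in> V" "y \<in> V" for x y
  proof -
    define z where "z = (1/2) *\<^sub>R (x + y)"
    have z: "z \<in> V" unfolding z_def using xy by (intro mem)
    have \<phi>_z: "\<phi> z = (\<phi> x + \<phi> y) / 2"
      using xy by (simp add: z_def scaleR_scaleC scale add mem)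
    moreover have norm_z: "norm z = norm (x + y) / 2"
      unfolding z_def norm_scaleR by simp
    have "(norm z)\<^sup>2 = ((norm x)\<^sup>2 + (norm y)\<^sup>2 + 2 * Re (cinner x y)) / 4"
      by (simp add: norm_z power_divide norm_add_sq)
    moreover have "Re (\<phi> z) = (Re (\<phi> x) + Re (\<phi> y)) / 2"
      by (simp add: \<phi>_z)
    ultimately have "4 * J z = (norm x)\<^sup>2 + (norm y)\<^sup>2 + 2 * Re (cinner x y) - 4 * Re (\<phi> x) - 4 * Re (\<phi> y)"
      by (simp add: J_def)
    then show ?thesis
      using I_le[OF z] by (simp add: norm_diff_sq J_def)
  qed
  have "Cauchy f"
  proof (rule metric_CauchyI)
    fix e :: real assume e: "e > 0"
    obtain N where N: "inverse (real (Suc N)) < e\<^sup>2 / 4"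
      using reals_Archimedean[of "e\<^sup>2 / 4"] e by auto
    show "\<exists>M. \<forall>m\<ge>M. \<forall>n\<ge>M. dist (f m) (f n) < e"
    proof (intro exI[of _ N] allI impI)
      fix m n assume mn: "m \<ge> N" "n \<ge> N"
      have le: "inverse (real (Suc k)) \<le> inverse (real (Suc N))" if "k \<ge> N" for k
        using that by (simp add: field_simps)
      have "(norm (f m - f n))\<^sup>2 < e\<^sup>2"
        using par[OF f(1) f(1), of m n] f(2)[of m] f(2)[of n] le[OF mn(1)] le[OF mn(2)] N by argo
      then show "dist (f m) (f n) < e"
        using e by (simp add: dist_norm power_less_imp_less_base)
    qed
  qed
  then obtain v where v: "f \<longlonglongrightarrow> v"
    using Cauchy_convergent convergentD by blast
  have vV: "v \<in> V"
    using closed f(1) v closed_sequentially by blast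
  have "(\<lambda>n. J (f n)) \<longlonglongrightarrow> J v"
    unfolding J_def
    by (intro tendsto_intros v continuous_on_tendsto_compose[OF cont_\<phi>] vV always_eventually allI f)
  moreover have "(\<lambda>n. I + inverse (real (Suc n))) \<longlonglongrightarrow> I"
    using LIMSEQ_inverse_real_of_nat_add by simp
  ultimately have Jv: "J v \<le> I"
    by (rule LIMSEQ_le) (use f(2) less_imp_le in blast)
  have Re_eq: "Re (\<phi> x) = Re (cinner x v)" if x: "x \<in> V" for x
  proof -
    define d where "d = Re (cinner x v) - Re (\<phi> x)"
    \<comment> \<open>First variation: along \<open>v + t *\<^sub>R x\<close> the functional is
      least at \<open>t = 0\<close>, and \<open>d\<close> is half of its derivative there.\<close>
    have "0 \<le> t\<^sup>2 * (norm x)\<^sup>2 + 2 * t * d" for t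
    proof -
      have "J (v + t *\<^sub>R x) \<ge> J v"
        using I_le[of "v + t *\<^sub>R x"] Jv vV x by (simp add: mem)
      moreover have "\<phi> (v + t *\<^sub>R x) = \<phi> v + t * \<phi> x"
        using vV x by (simp add: add scale mem scaleR_scaleC)
      ultimately show ?thesis
        using Re_cinner_commute[of x v]
        by (simp add: J_def norm_add_sq power_mult_distrib cinner.scaleR_right d_def algebra_simps)
    qed
    then have "d = 0"
      by (rule linear_term_eq_zero[rotated]) simp
    then show ?thesis by (simp add: d_def)
  qed
  have "\<phi> x = cinner x v" if x: "x \<in> V" for x
  proof (rule complex_eqI)
    show "Re (\<phi> x) = Re (cinner x v)" by (rule Re_eq[OF x])
    \<comment> \<open>Multiplication by \<open>-\<i>\<close> turns the imaginary parts into real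
      parts.\<close>
    have "Re (\<phi> ((-\<i>) *\<^sub>C x)) = Re (cinner ((-\<i>) *\<^sub>C x) v)"
      by (rule Re_eq) (use x in \<open>rule mem\<close>)
    then show "Im (\<phi> x) = Im (cinner x v)"
      unfolding scale[OF x] cinner_scaleC_left by simp
  qed
  with vV show thesis by (rule that)
qed

section \<open>Extension and adjoints\<close>

text \<open>Factorisation in the style of Douglas: the estimate makes \<open>g x\<close> a Lipschitz
  function of \<open>D x\<close>, so \<open>g\<close> factors through the range of \<open>D\<close>,
  and the factor extends to the closure by uniform continuity. All operators on defect spaces,
  including \<open>\<omega>H\<close>, are obtained in this way.\<close>

lemma (in csub) bop_extension:
  assumes D: "D \<in> bop V X" and g: "g \<in> bop V W" and W: "csub W"
    and le: "\<And>x. x \<in> V \<Longrightarrow> norm (g x) \<le> c * norm (D x)"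
  obtains T where "T \<in> bop (closure (D ` V)) W" "\<And>x. x \<in> V \<Longrightarrow> T (D x) = g x"
    "\<And>z. z \<in> closure (D ` V) \<Longrightarrow> norm (T z) \<le> c * norm z"
proof -
  define S where "S = D ` V"
  \<comment> \<open>Any preimage will do: two of them differ by a vector on which \<open>D\<close>,
    and hence \<open>g\<close>, vanishes.\<close>
  define T0 where "T0 z = g (SOME x. x \<in> V \<and> D x = z)" for z
  have T0: "T0 (D x) = g x" if x: "x \<in> V" for x
  proof -
    define y where "y = (SOME y. y \<in> V \<and> D y = D x)"
    have y: "y \<in> V" "D y = D x"
      unfolding y_def using someI_ex[of "\<lambda>y. y \<in> V \<and> D y = D x"] x by auto
    have "norm (g (y - x)) \<le> c * norm (D (y - x))"
      by (rule le) (use x y in \<open>intro mem\<close>)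
    then have "g y = g x"
      using x y by (simp add: bop_diff[OF D] bop_diff[OF g])
    then show ?thesis by (simp add: T0_def y_def)
  qed
  have "uniformly_continuous_on S T0"
  proof (rule lipschitz_on_uniformly_continuous)
    \<comment> \<open>A negative \<open>c\<close> is possible (it forces \<open>D\<close> to vanish
      on \<open>V\<close>), while a Lipschitz constant has to be nonnegative.\<close>
    show "\<bar>c\<bar>-lipschitz_on S T0"
    proof (rule lipschitz_onI)
      fix z w assume "z \<in> S" "w \<in> S"
      then obtain x y where xy: "x \<in> V" "z = D x" "y \<in> V" "w = D y"
        by (auto simp: S_def)
      then have "norm (T0 z - T0 w) = norm (g (x - y))"
        by (simp add: T0 bop_diff[OF g])
      also have "\<dots> \<le> c * norm (D (x - y))"
        by (rule le) (use xy in \<open>intro mem\<close>)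
      also have "\<dots> \<le> \<bar>c\<bar> * norm (z - w)"
        using xy by (simp add: bop_diff[OF D] mult_right_mono)
      finally show "dist (T0 z) (T0 w) \<le> \<bar>c\<bar> * dist z w"
        by (simp add: dist_norm)
    qed simp
  qed
  then obtain T where T: "uniformly_continuous_on (closure S) T" "\<And>z. z \<in> S \<Longrightarrow> T0 z = T z"
    by (rule uniformly_continuous_on_extension_on_closure) blast
  have TD: "T (D x) = g x" if "x \<in> V" for x
    using T(2)[of "D x"] T0[OF that] that by (simp add: S_def)
  have cont: "continuous_on (closure S) T"
    using T(1) by (rule uniformly_continuous_imp_continuous)
  \<comment> \<open>Every point of the closure is a limit of \<open>D (f n)\<close> for which
    \<open>g (f n)\<close> converges as well; range, linearity and bound of \<open>T\<close> are all
    read off from such sequences.\<close>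
  have seq: "\<exists>f. (\<forall>n. f n \<in> V) \<and> (\<lambda>n. D (f n)) \<longlonglongrightarrow> z \<and> (\<lambda>n. g (f n)) \<longlonglongrightarrow> T z"
    if z: "z \<in> closure S" for z
  proof -
    from z obtain h where h: "\<forall>n. h n \<in> S" "h \<longlonglongrightarrow> z"
      unfolding closure_sequential by blast
    from h(1) have "\<forall>n. \<exists>x. x \<in> V \<and> h n = D x" by (auto simp: S_def)
    then obtain f where f: "\<And>n. f n \<in> V" "\<And>n. h n = D (f n)" by metis
    have "(\<lambda>n. T (h n)) \<longlonglongrightarrow> T z"
      by (rule continuous_on_tendsto_compose[OF cont h(2) z])
        (use h(1) closure_subset in \<open>auto intro!: always_eventually\<close>)
    moreover have "h = (\<lambda>n. D (f n))"
      using f(2) by blast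
    ultimately show ?thesis
      using f(1) h(2) by (intro exI[of _ f]) (simp add: TD[OF f(1)])
  qed
  have DS: "D x \<in> closure S" if "x \<in> V" for x
    using closure_subset[of S] that by (auto simp: S_def)
  have S: "csub (closure S)"
    unfolding S_def by (rule csub_closure_image[OF D])
  have bnd: "norm (T z) \<le> c * norm z" if "z \<in> closure S" for z
  proof -
    from seq[OF that] obtain f where f: "\<And>n. f n \<in> V" "(\<lambda>n. D (f n)) \<longlonglongrightarrow> z" "(\<lambda>n. g (f n)) \<longlonglongrightarrow> T z"
      by blast
    show ?thesis
      by (rule LIMSEQ_le[OF tendsto_norm[OF f(3)] tendsto_mult_left[OF tendsto_norm[OF f(2)]]])
        (use le f(1) in blast)
  qed
  show thesis
  proof (rule that[of "restrict T (closure S)"])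
    show "restrict T (closure S) \<in> bop (closure (D ` V)) W"
      unfolding S_def[symmetric]
    proof (rule bop_restrictI[OF S _ _ _ bnd])
      show "T z \<in> W" if "z \<in> closure S" for z
      proof -
        from seq[OF that] obtain f where f: "\<And>n. f n \<in> V" "(\<lambda>n. g (f n)) \<longlonglongrightarrow> T z"
          by blast
        show ?thesis
          using closed_sequentially[OF csub.closed[OF W] _ f(2)] bop_mem[OF g f(1)] by blast
      qed
      show "T (z + w) = T z + T w" if zw: "z \<in> closure S" "w \<in> closure S" for z w
      proof -
        from seq[OF zw(1)] obtain f where f: "\<And>n. f n \<in> V" "(\<lambda>n. D (f n)) \<longlonglongrightarrow> z" "(\<lambda>n. g (f n)) \<longlonglongrightarrow> T z"
          by blast
        from seq[OF zw(2)] obtain h where h: "\<And>n. h n \<in> V" "(\<lambda>n. D (h n)) \<longlonglongrightarrow> w" "(\<lambda>n. g (h n)) \<longlonglongrightarrow> T w"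
          by blast
        have "(\<lambda>n. T (D (f n) + D (h n))) \<longlonglongrightarrow> T (z + w)"
          by (rule continuous_on_tendsto_compose[OF cont tendsto_add[OF f(2) h(2)] csub.add_mem[OF S zw]])
            (use DS f(1) h(1) csub.add_mem[OF S] in \<open>auto intro!: always_eventually\<close>)
        moreover have "T (D (f n) + D (h n)) = g (f n) + g (h n)" for n
          using TD[of "f n + h n"] f(1)[of n] h(1)[of n] by (simp add: bop_add[OF D] bop_add[OF g] mem)
        ultimately show ?thesis
          using tendsto_add[OF f(3) h(3)] LIMSEQ_unique by simp
      qed
      show "T (a *\<^sub>C z) = a *\<^sub>C T z" if z: "z \<in> closure S" for a z
      proof -
        from seq[OF z] obtain f where f: "\<And>n. f n \<in> V" "(\<lambda>n. D (f n)) \<longlonglongrightarrow> z" "(\<lambda>n. g (f n)) \<longlonglongrightarrow> T z"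
          by blast
        have "(\<lambda>n. T (a *\<^sub>C D (f n))) \<longlonglongrightarrow> T (a *\<^sub>C z)"
          by (rule continuous_on_tendsto_compose[OF cont scaleC.tendsto[OF tendsto_const f(2)] csub.scaleC_mem[OF S z]])
            (use DS f(1) csub.scaleC_mem[OF S] in \<open>auto intro!: always_eventually\<close>)
        moreover have "T (a *\<^sub>C D (f n)) = a *\<^sub>C g (f n)" for n
          using TD[of "a *\<^sub>C f n"] f(1)[of n] by (simp add: bop_scaleC[OF D] bop_scaleC[OF g] mem)
        ultimately show ?thesis
          using LIMSEQ_unique[OF _ scaleC.tendsto[OF tendsto_const f(3)]] by simp
      qed
    qed
    show "restrict T (closure S) (D x) = g x" if "x \<in> V" for x
      using TD[OF that] that closure_subset[of S] by (auto simp: S_def)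
    show "norm (restrict T (closure S) z) \<le> c * norm z" if "z \<in> closure (D ` V)" for z
      using bnd that by (simp add: S_def)
  qed
qed

lemma (in csub) eq_by_cinner:
  assumes "x \<in> V" "y \<in> V" "\<And>z. z \<in> V \<Longrightarrow> cinner z x = cinner z y"
  shows "x = y"
proof -
  have "cinner (x - y) (x - y) = 0"
    using assms(3)[of "x - y"] assms(1,2) by (simp add: cinner.diff_right mem)
  then show ?thesis
    using cinner_eq_self_zeroD by fastforce
qed

text \<open>\<open>P y\<close> is the Riesz vector of the functional
  \<open>\<lambda>x. cinner x y\<close> on \<open>V\<close>. The projection serves to extend
  \<open>\<omega>H\<close> from \<open>FH\<close> to the whole defect space.\<close>

lemma (in csub) orthogonal_projection:
  obtains P where "P \<in> bop UNIV V" "\<And>x. x \<in> V \<Longrightarrow> P x = x" "\<And>x. norm (P x) \<le> norm x"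
proof -
  have "\<exists>p\<in>V. \<forall>x\<in>V. cinner x y = cinner x p" for y
  proof (rule riesz_representation[of "\<lambda>x. cinner x y" "norm y"])
    show "cmod (cinner x y) \<le> norm y * norm x" for x
      using norm_cinner_le[of x y] by (simp add: mult.commute)
  qed (auto simp: cinner_add_left cinner_scaleC_left)
  then obtain P where P: "\<And>y. P y \<in> V" "\<And>x y. x \<in> V \<Longrightarrow> cinner x y = cinner x (P y)"
    by metis
  have le: "norm (P y) \<le> norm y" for y
  proof -
    have "(norm (P y))\<^sup>2 = Re (cinner (P y) y)"
      by (simp add: P(1) P(2)[symmetric] norm_sq_Re)
    also have "\<dots> \<le> norm (P y) * norm y"
      using complex_Re_le_cmod norm_cinner_le order_trans by blast
    finally show ?thesis
      by (cases "norm (P y) = 0") (simp_all add: power2_eq_square)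
  qed
  show thesis
  proof (rule that[of P])
    show "P \<in> bop UNIV V"
    proof (rule bopI[where B = 1])
      show "P (x + y) = P x + P y" for x y
        by (rule eq_by_cinner) (simp_all add: P(1) mem cinner_add_right P(2)[symmetric])
      show "P (c *\<^sub>C x) = c *\<^sub>C P x" for c x
        by (rule eq_by_cinner) (simp_all add: P(1) mem cinner_scaleC_right P(2)[symmetric])
    qed (use P le in auto)
    show "P x = x" if "x \<in> V" for x
      by (rule eq_by_cinner) (simp_all add: P(1) that P(2)[symmetric])
  qed (rule le)
qed

lemma bop_adjoint:
  assumes V: "csub V" and W: "csub W" and T: "T \<in> bop V W"
  shows "adjoint_op V W T \<in> bop W V" (is ?A)
    and "\<And>x y. x \<in> V \<Longrightarrow> y \<in> W \<Longrightarrow> cinner (T x) y = cinner x (adjoint_op V W T y)" (is "\<And>x y. _ \<Longrightarrow> _ \<Longrightarrow> ?B x y")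
proof -
  interpret V: csub V by fact
  interpret W: csub W by fact
  obtain B where B: "B \<ge> 0" "\<And>x. x \<in> V \<Longrightarrow> norm (T x) \<le> B * norm x"
    using bop_bound[OF T] by blast
  have "\<exists>p\<in>V. \<forall>x\<in>V. cinner (T x) y = cinner x p" for y
  proof -
    have "cmod (cinner (T x) y) \<le> (norm y * B) * norm x" if "x \<in> V" for x
      using norm_cinner_le[of "T x" y] mult_right_mono[OF B(2)[OF that], of "norm y"] by (simp add: ac_simps)
    then show ?thesis
      by (rule V.riesz_representation[of "\<lambda>x. cinner (T x) y" "norm y * B", rotated 2])
        (auto simp: bop_add[OF T] bop_scaleC[OF T] cinner_add_left cinner_scaleC_left)
  qed
  then obtain S where S: "\<And>y. S y \<in> V" "\<And>x y. x \<in> V \<Longrightarrow> cinner (T x) y = cinner x (S y)"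
    by metis
  have "restrict S W \<in> bop W V"
  proof (rule bop_restrictI[OF W, where B = B])
    show "S (x + y) = S x + S y" for x y
      by (rule V.eq_by_cinner) (simp_all add: S(1) V.mem cinner_add_right S(2)[symmetric])
    show "S (c *\<^sub>C x) = c *\<^sub>C S x" for c x
      by (rule V.eq_by_cinner) (simp_all add: S(1) V.mem cinner_scaleC_right S(2)[symmetric])
    show "norm (S y) \<le> B * norm y" for y
    proof -
      have "(norm (S y))\<^sup>2 = Re (cinner (T (S y)) y)"
        by (simp add: S(1) S(2)[symmetric] norm_sq_Re)
      also have "\<dots> \<le> norm (T (S y)) * norm y"
        using complex_Re_le_cmod norm_cinner_le order_trans by blast
      also have "\<dots> \<le> B * norm (S y) * norm y"
        by (intro mult_right_mono B S) simp
      finally show ?thesis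
        using B(1) by (cases "norm (S y) = 0") (simp_all add: power2_eq_square)
    qed
  qed (rule S)
  then have ex: "restrict S W \<in> bop W V \<and> (\<forall>x\<in>V. \<forall>y\<in>W. cinner (T x) y = cinner x (restrict S W y))"
    using S by simp
  \<comment> \<open>\<open>adjoint_op\<close> is a definite description, so its value is known only
    once uniqueness is.\<close>
  have uniq: "S' = restrict S W"
    if S': "S' \<in> bop W V \<and> (\<forall>x\<in>V. \<forall>y\<in>W. cinner (T x) y = cinner x (S' y))" for S'
  proof (rule bop_eqI)
    show "S' y = restrict S W y" if "y \<in> W" for y
    proof (rule V.eq_by_cinner)
      show "cinner z (S' y) = cinner z (restrict S W y)" if "z \<in> V" for z
        using S' ex that \<open>y \<in> W\<close> by (metis (no_types, lifting))
    qed (use S' that S in \<open>auto simp: bop_mem\<close>)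
  qed (use S' ex in auto)
  have "adjoint_op V W T = restrict S W"
    unfolding adjoint_op_def using ex uniq by (rule the_equality)
  then show ?A "\<And>x y. x \<in> V \<Longrightarrow> y \<in> W \<Longrightarrow> ?B x y"
    using ex by auto
qed

section \<open>The binomial series of the square root\<close>

lemma alternating_gbinomial_Suc:
  "real (Suc n) * ((- 1) ^ Suc n * (a gchoose Suc n)) = (real n - a) * ((- 1) ^ n * (a gchoose n))"
proof -
  have "real (Suc n) * (a gchoose Suc n) = (a - real n) * (a gchoose n)"
    using gbinomial_mult_1[of a n] by (simp add: left_diff_distrib)
  then have "(- 1) ^ Suc n * (real (Suc n) * (a gchoose Suc n)) = (- 1) ^ Suc n * ((a - real n) * (a gchoose n))"
    by (simp only:)
  moreover have "(- 1) ^ Suc n * ((a - real n) * (a gchoose n)) = (real n - a) * ((- 1) ^ n * (a gchoose n))"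
    by (simp add: left_diff_distrib right_diff_distrib)
  ultimately show ?thesis
    by (metis mult.left_commute)
qed

text \<open>The Taylor coefficients of \<open>sqrt (1 - x)\<close> at 0.\<close>

definition sqrt_coeff :: "nat \<Rightarrow> real" where
  "sqrt_coeff n = (- 1) ^ n * (1 / 2 gchoose n)"

lemma sqrt_coeff_0 [simp]: "sqrt_coeff 0 = 1"
  by (simp add: sqrt_coeff_def)

text \<open>From index 1 on, the recurrence passes from one coefficient to the next by a positive
  factor, because \<open>n - 1 / 2 > 0\<close>; all of them keep the sign of the first, which is
  \<open>- 1 / 2\<close>.\<close>

lemma sqrt_coeff_nonpos: "sqrt_coeff (Suc n) \<le> 0"
proof (induction n)
  case 0 show ?case by (simp add: sqrt_coeff_def)
next
  case (Suc n)
  have "real (Suc (Suc n)) * sqrt_coeff (Suc (Suc n)) = (real (Suc n) - 1 / 2) * sqrt_coeff (Suc n)"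
    unfolding sqrt_coeff_def by (rule alternating_gbinomial_Suc)
  also have "\<dots> \<le> 0"
    using Suc by (intro mult_nonneg_nonpos) auto
  finally show ?case
    by (simp add: mult_le_0_iff del: of_nat_Suc)
qed

text \<open>Partial sums are the coefficients of \<open>sqrt (1 - x) / (1 - x)\<close>, that is, of
  the power of \<open>1 - x\<close> with exponent \<open>- 1 / 2\<close>, and the same recurrence
  shows that these are positive.\<close>

lemma sqrt_coeff_sum_pos: "(\<Sum>k\<le>n. sqrt_coeff k) > 0"
proof -
  have pos: "(- 1) ^ n * (- 1 / 2 gchoose n :: real) > 0" for n
  proof (induction n)
    case (Suc n)
    have "real (Suc n) * ((- 1) ^ Suc n * (- 1 / 2 gchoose Suc n))
        = (real n - (- 1 / 2)) * ((- 1) ^ n * (- 1 / 2 gchoose n))"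
      by (rule alternating_gbinomial_Suc)
    also have "\<dots> > 0"
      by (rule mult_pos_pos[OF _ Suc]) simp
    finally show ?case
      using zero_less_mult_pos by (metis of_nat_0_less_iff zero_less_Suc)
  qed simp
  show ?thesis
    using gbinomial_sum_lower_neg[of "1 / 2 :: real" n] pos[of n]
    by (simp add: sqrt_coeff_def mult.commute)
qed

lemma sqrt_coeff_abs_summable: "(\<lambda>n. \<bar>sqrt_coeff n\<bar>) summable_on UNIV"
proof (rule nonneg_bdd_above_summable_on)
  show "bdd_above (sum (\<lambda>n. \<bar>sqrt_coeff n\<bar>) ` {F. F \<subseteq> UNIV \<and> finite F})"
  proof (rule bdd_aboveI2[of _ _ 2])
    fix F :: "nat set" assume "F \<in> {F. F \<subseteq> UNIV \<and> finite F}"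
    then obtain N where N: "F \<subseteq> {..N}"
      by (auto simp: finite_nat_iff_bounded_le)
    have "(\<Sum>n\<in>F. \<bar>sqrt_coeff n\<bar>) \<le> (\<Sum>n\<le>N. \<bar>sqrt_coeff n\<bar>)"
      by (rule sum_mono2) (use N in auto)
    \<comment> \<open>Only the coefficient at 0 is positive, and it is 1, so the sum of absolute
      values is 2 minus a positive partial sum.\<close>
    also have "\<dots> = (\<Sum>n\<le>N. (if n = 0 then 2 else 0) - sqrt_coeff n)"
      by (rule sum.cong) (use sqrt_coeff_nonpos in \<open>auto simp: gr0_conv_Suc abs_of_nonpos\<close>)
    also have "\<dots> \<le> 2"
      using sqrt_coeff_sum_pos[of N] by (simp add: sum_subtractf)
    finally show "(\<Sum>n\<in>F. \<bar>sqrt_coeff n\<bar>) \<le> 2" .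
  qed
qed simp

lemma sqrt_coeff_infsum_nonneg: "(\<Sum>\<^sub>\<infinity>n. sqrt_coeff n) \<ge> 0"
proof -
  have "sqrt_coeff summable_on UNIV"
    by (rule abs_summable_summable) (simp add: sqrt_coeff_abs_summable)
  then have "sqrt_coeff sums (\<Sum>\<^sub>\<infinity>n. sqrt_coeff n)"
    by (intro has_sum_imp_sums has_sum_infsum)
  then have "(\<lambda>n. \<Sum>k\<le>n. sqrt_coeff k) \<longlonglongrightarrow> (\<Sum>\<^sub>\<infinity>n. sqrt_coeff n)"
    by (simp add: sums_def_le)
  then show ?thesis
    by (rule LIMSEQ_le_const) (auto intro: less_imp_le[OF sqrt_coeff_sum_pos])
qed

text \<open>Vandermonde with \<open>1 / 2 + 1 / 2 = 1\<close> collapses the convolution to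
  \<open>1 gchoose k\<close>: as a formal power series, the root squares to
  \<open>1 - x\<close>.\<close>

lemma sqrt_coeff_convolution:
  "(\<Sum>i\<le>k. sqrt_coeff i * sqrt_coeff (k - i)) = (if k = 0 then 1 else if k = 1 then - 1 else 0)"
proof -
  have "(\<Sum>i\<le>k. sqrt_coeff i * sqrt_coeff (k - i))
      = (\<Sum>i\<le>k. (- 1) ^ k * ((1 / 2 gchoose i) * (1 / 2 gchoose (k - i))))"
  proof (rule sum.cong)
    fix i assume "i \<in> {..k}"
    then have "(- 1 :: real) ^ k = (- 1) ^ i * (- 1) ^ (k - i)"
      by (simp add: power_add[symmetric])
    then show "sqrt_coeff i * sqrt_coeff (k - i)
        = (- 1) ^ k * ((1 / 2 gchoose i) * (1 / 2 gchoose (k - i)))"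
      unfolding sqrt_coeff_def by simp
  qed simp
  also have "\<dots> = (- 1) ^ k * (1 gchoose k)"
    using gbinomial_Vandermonde[of "1/2 :: real" "1/2" k]
    by (simp add: sum_distrib_left[symmetric] atMost_atLeast0)
  also have "\<dots> = (if k = 0 then 1 else if k = 1 then - 1 else 0)"
  proof -
    have "(1 gchoose k :: real) = of_nat (1 choose k)"
      by (simp add: binomial_gbinomial)
    then show ?thesis
      by (cases k rule: nat.exhaust) (auto simp: binomial_eq_0)
  qed
  finally show ?thesis .
qed

lemma (in csub) has_sum_mem:
  assumes "(f has_sum s) A" "\<And>i. i \<in> A \<Longrightarrow> f i \<in> V"
  shows "s \<in> V"
proof (rule Lim_in_closed_set[OF closed])
  show "(sum f \<longlongrightarrow> s) (finite_subsets_at_top A)"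
    using assms(1) by (simp add: has_sum_def)
  show "\<forall>\<^sub>F F in finite_subsets_at_top A. sum f F \<in> V"
    by (rule eventually_finite_subsets_at_top_weakI) (auto intro!: sum_mem assms(2))
qed simp

lemma (in csub) bop_has_sum:
  assumes T: "T \<in> bop V W" and "(f has_sum s) A" "\<And>i. i \<in> A \<Longrightarrow> f i \<in> V"
  shows "((\<lambda>i. T (f i)) has_sum T s) A"
proof -
  have "((\<lambda>F. T (sum f F)) \<longlongrightarrow> T s) (finite_subsets_at_top A)"
  proof (rule continuous_on_tendsto_compose[OF bop_continuous_on[OF T]])
    show "(sum f \<longlongrightarrow> s) (finite_subsets_at_top A)"
      using assms(2) by (simp add: has_sum_def)
    show "\<forall>\<^sub>F F in finite_subsets_at_top A. sum f F \<in> V"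
      by (rule eventually_finite_subsets_at_top_weakI) (auto intro!: sum_mem assms(3))
  qed (rule has_sum_mem[OF assms(2,3)])
  moreover have "\<forall>\<^sub>F F in finite_subsets_at_top A. T (sum f F) = (\<Sum>i\<in>F. T (f i))"
    by (rule eventually_finite_subsets_at_top_weakI) (auto intro!: bop_sum[OF T] assms(3))
  ultimately show ?thesis
    unfolding has_sum_def by (rule Lim_transform_eventually)
qed

section \<open>Defect operators\<close>

text \<open>Polarisation: reality of the form at \<open>x + y\<close> relates the imaginary parts of
  the two mixed terms, reality at \<open>x + \<i> *\<^sub>C y\<close> their real parts.\<close>

lemma (in csub) positive_op_symmetric:
  assumes B: "positive_op V B" and x: "x \<in> V" and y: "y \<in> V"
  shows "cinner (B x) y = cinner x (B y)"
proof -
  have bop: "B \<in> bop V V"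
    using B by (simp add: positive_op_def)
  have Im: "Im (cinner (B z) z) = 0" if "z \<in> V" for z
    using B that by (simp add: positive_op_def)
  have "Im (cinner (B (x + y)) (x + y)) = 0" "Im (cinner (B (x + \<i> *\<^sub>C y)) (x + \<i> *\<^sub>C y)) = 0"
    by (intro Im mem x y)+
  then have "Im (cinner (B x) y) = - Im (cinner (B y) x)" "Re (cinner (B x) y) = Re (cinner (B y) x)"
    using Im[OF x] Im[OF y]
    by (simp_all add: bop_add[OF bop] bop_scaleC[OF bop] mem x y cinner_add_left cinner_add_right
        cinner_scaleC_left cinner_scaleC_right)
  then show ?thesis
    by (subst cinner_commute[of x]) (simp add: complex_eq_iff)
qed

text \<open>The nonnegative form is minimal at \<open>y\<close>, so its first variation in the
  direction \<open>B y\<close> vanishes; by symmetry that variation is a multiple of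
  \<open>(norm (B y))\<^sup>2\<close>.\<close>

lemma (in csub) positive_op_eq_zero:
  assumes B: "positive_op V B" and y: "y \<in> V" and zero: "Re (cinner (B y) y) = 0"
  shows "B y = 0"
proof -
  have bop: "B \<in> bop V V"
    using B by (simp add: positive_op_def)
  define w where "w = B y"
  have w: "w \<in> V" unfolding w_def using bop y by (rule bop_mem)
  have pos: "Re (cinner (B z) z) \<ge> 0" if "z \<in> V" for z
    using B that by (simp add: positive_op_def)
  have "(norm w)\<^sup>2 = 0"
  proof (rule linear_term_eq_zero)
    show "Re (cinner (B w) w) \<ge> 0" by (rule pos[OF w])
    fix t :: real
    have "0 \<le> Re (cinner (B (y + t *\<^sub>R w)) (y + t *\<^sub>R w))"
      by (intro pos mem y w)
    also have "\<dots> = t\<^sup>2 * Re (cinner (B w) w) + t * Re (cinner (B y) w) + t * Re (cinner (B w) y)"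
      using zero by (simp add: bop_add[OF bop] bop_scaleC[OF bop] mem y w scaleR_scaleC
          cinner_add_left cinner_add_right cinner_scaleC_left cinner_scaleC_right power2_eq_square
          algebra_simps)
    also have "Re (cinner (B w) y) = (norm w)\<^sup>2"
      unfolding positive_op_symmetric[OF B w y] by (simp add: w_def norm_sq_Re)
    also have "Re (cinner (B y) w) = (norm w)\<^sup>2"
      by (simp add: w_def norm_sq_Re)
    finally show "0 \<le> t\<^sup>2 * Re (cinner (B w) w) + 2 * t * (norm w)\<^sup>2"
      by simp
  qed
  then show ?thesis by (simp add: w_def)
qed

text \<open>For \<open>y = D x - B x\<close>, commutation gives
  \<open>D y + B y = D (D x) - B (B x) = 0\<close>. Two nonnegative forms with sum 0 at
  \<open>y\<close> both vanish there, whence \<open>D y = B y = 0\<close>, and symmetry carries this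
  over to \<open>cinner y y = 0\<close>.\<close>

lemma (in csub) positive_op_sqrt_unique:
  assumes D: "positive_op V D" and B: "positive_op V B"
    and eq: "\<And>x. x \<in> V \<Longrightarrow> D (D x) = B (B x)"
    and comm: "\<And>x. x \<in> V \<Longrightarrow> D (B x) = B (D x)"
  shows "D = B"
proof (rule bop_eqI)
  show bD: "D \<in> bop V V" and bB: "B \<in> bop V V"
    using assms by (auto simp: positive_op_def)
  fix x assume x: "x \<in> V"
  define y where "y = D x - B x"
  have y: "y \<in> V" unfolding y_def using x bD bB by (intro mem) (auto simp: bop_mem)
  have "D y + B y = 0"
    using x eq[OF x] comm[OF x] by (simp add: y_def bop_diff[OF bD] bop_diff[OF bB] bop_mem[OF bD] bop_mem[OF bB])
  then have "Re (cinner (D y) y) + Re (cinner (B y) y) = 0"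
    by (metis cinner_add_left cinner.zero_left plus_complex.sel(1) zero_complex.sel(1))
  moreover have "Re (cinner (D y) y) \<ge> 0" "Re (cinner (B y) y) \<ge> 0"
    using D B y by (auto simp: positive_op_def)
  ultimately have "D y = 0" "B y = 0"
    using positive_op_eq_zero[OF D y] positive_op_eq_zero[OF B y] by linarith+
  then have "cinner (D x - B x) y = 0"
    using positive_op_symmetric[OF D x y] positive_op_symmetric[OF B x y]
    by (simp add: cinner.diff_left)
  then show "D x = B x"
    using cinner_eq_self_zeroD[of y] by (simp add: y_def)
qed

section \<open>The square root of \<open>I - T\<close> for a symmetric contraction
  \<open>T\<close>\<close>

locale symmetric_contraction = csub V for V :: "'a :: chilbert_space set" +
  fixes T :: "'a \<Rightarrow> 'a"
  assumes T_bop: "T \<in> bop V V"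
    and T_le: "x \<in> V \<Longrightarrow> norm (T x) \<le> norm x"
    and T_symmetric: "x \<in> V \<Longrightarrow> y \<in> V \<Longrightarrow> cinner (T x) y = cinner x (T y)"
begin

lemma funpow_mem: "x \<in> V \<Longrightarrow> (T ^^ n) x \<in> V"
  by (induction n) (auto simp: bop_mem[OF T_bop])

lemma funpow_le: "x \<in> V \<Longrightarrow> norm ((T ^^ n) x) \<le> norm x"
  by (induction n) (auto intro: order_trans[OF T_le[OF funpow_mem]])

lemma funpow_add_distrib: "x \<in> V \<Longrightarrow> y \<in> V \<Longrightarrow> (T ^^ n) (x + y) = (T ^^ n) x + (T ^^ n) y"
  by (induction n) (auto simp: bop_add[OF T_bop] funpow_mem)

lemma funpow_scaleC: "x \<in> V \<Longrightarrow> (T ^^ n) (c *\<^sub>C x) = c *\<^sub>C (T ^^ n) x"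
  by (induction n) (auto simp: bop_scaleC[OF T_bop] funpow_mem)

lemma funpow_symmetric: "x \<in> V \<Longrightarrow> y \<in> V \<Longrightarrow> cinner ((T ^^ n) x) y = cinner x ((T ^^ n) y)"
proof (induction n arbitrary: x y)
  case (Suc n)
  then show ?case
    by (simp add: T_symmetric funpow_mem Suc.IH bop_mem[OF T_bop] flip: funpow_swap1)
qed simp

lemma funpow_bop: "restrict (T ^^ n) V \<in> bop V V"
  by (rule bop_restrictI[where B = 1])
    (use csub_axioms in \<open>auto simp: funpow_mem funpow_le funpow_add_distrib funpow_scaleC\<close>)

text \<open>The binomial series of \<open>sqrt (I - T)\<close>. Absolute summability of the
  coefficients covers \<open>norm (T x) = norm x\<close> as well, the boundary of the disc of
  convergence, which defect operators of contractions do reach.\<close>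

definition root :: "'a \<Rightarrow> 'a" where
  "root = (\<lambda>x\<in>V. \<Sum>\<^sub>\<infinity>n. sqrt_coeff n *\<^sub>R (T ^^ n) x)"

lemma root_has_sum:
  assumes x: "x \<in> V"
  shows "((\<lambda>n. sqrt_coeff n *\<^sub>R (T ^^ n) x) has_sum root x) UNIV"
proof -
  have "(\<lambda>n. sqrt_coeff n *\<^sub>R (T ^^ n) x) summable_on UNIV"
  proof (rule abs_summable_summable, rule summable_on_comparison_test)
    show "(\<lambda>n. \<bar>sqrt_coeff n\<bar> * norm x) summable_on UNIV"
      by (intro summable_on_cmult_left sqrt_coeff_abs_summable)
    show "norm (sqrt_coeff n *\<^sub>R (T ^^ n) x) \<le> \<bar>sqrt_coeff n\<bar> * norm x" for n
      using funpow_le[OF x] by (simp add: mult_left_mono)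
  qed auto
  then show ?thesis
    using x by (simp add: root_def has_sum_infsum)
qed

lemma root_mem: "x \<in> V \<Longrightarrow> root x \<in> V"
  by (rule has_sum_mem[OF root_has_sum]) (auto simp: mem funpow_mem)

lemma root_bop: "root \<in> bop V V"
proof -
  define B where "B = (\<Sum>\<^sub>\<infinity>n. \<bar>sqrt_coeff n\<bar>)"
  have "restrict root V \<in> bop V V"
  proof (rule bop_restrictI[where B = B])
    show "root (x + y) = root x + root y" if "x \<in> V" "y \<in> V" for x y
    proof (rule has_sum_unique[OF root_has_sum])
      show "((\<lambda>n. sqrt_coeff n *\<^sub>R (T ^^ n) (x + y)) has_sum root x + root y) UNIV"
        using has_sum_add[OF root_has_sum[OF that(1)] root_has_sum[OF that(2)]] that
        by (simp add: funpow_add_distrib scaleR_add_right)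
    qed (use that in \<open>intro mem\<close>)
    show "root (c *\<^sub>C x) = c *\<^sub>C root x" if "x \<in> V" for c x
    proof (rule has_sum_unique[OF root_has_sum])
      show "((\<lambda>n. sqrt_coeff n *\<^sub>R (T ^^ n) (c *\<^sub>C x)) has_sum c *\<^sub>C root x) UNIV"
        using has_sum_bounded_linear[OF scaleC.bounded_linear_right root_has_sum[OF that]] that
        by (simp add: funpow_scaleC scaleC.scaleR_right)
    qed (use that in \<open>intro mem\<close>)
    show "norm (root x) \<le> B * norm x" if "x \<in> V" for x
    proof -
      have sm: "(\<lambda>n. \<bar>sqrt_coeff n\<bar> * norm x) summable_on UNIV"
        by (intro summable_on_cmult_left sqrt_coeff_abs_summable)
      have le: "norm (sqrt_coeff n *\<^sub>R (T ^^ n) x) \<le> \<bar>sqrt_coeff n\<bar> * norm x" for n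
        using funpow_le[OF that] by (simp add: mult_left_mono)
      have as: "(\<lambda>n. norm (sqrt_coeff n *\<^sub>R (T ^^ n) x)) summable_on UNIV"
        by (rule summable_on_comparison_test[OF sm le]) auto
      have "norm (root x) \<le> (\<Sum>\<^sub>\<infinity>n. norm (sqrt_coeff n *\<^sub>R (T ^^ n) x))"
        by (rule norm_has_sum_bound[OF has_sum_infsum[OF as] root_has_sum[OF that]])
      also have "\<dots> \<le> (\<Sum>\<^sub>\<infinity>n. \<bar>sqrt_coeff n\<bar> * norm x)"
        by (rule infsum_mono[OF as sm le])
      also have "\<dots> = B * norm x"
        unfolding B_def by (rule infsum_cmult_left) (simp add: sqrt_coeff_abs_summable)
      finally show ?thesis .
    qed
  qed (use csub_axioms root_mem in auto)
  then show ?thesis by (simp add: root_def)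
qed

text \<open>Meant for a rival square root \<open>B\<close> of \<open>I - T\<close>: it supplies the
  commutation that \<open>positive_op_sqrt_unique\<close> demands.\<close>

lemma root_commute:
  assumes B: "B \<in> bop V V" "\<And>x. x \<in> V \<Longrightarrow> B (T x) = T (B x)" and x: "x \<in> V"
  shows "B (root x) = root (B x)"
proof -
  have "B ((T ^^ n) x) = (T ^^ n) (B x)" for n
    by (induction n) (simp_all add: B x funpow_mem)
  then have "B (sqrt_coeff n *\<^sub>R (T ^^ n) x) = sqrt_coeff n *\<^sub>R (T ^^ n) (B x)" for n
    by (simp add: scaleR_scaleC bop_scaleC[OF B(1)] funpow_mem x)
  moreover have "((\<lambda>n. B (sqrt_coeff n *\<^sub>R (T ^^ n) x)) has_sum B (root x)) UNIV"
    by (rule bop_has_sum[OF B(1) root_has_sum[OF x]]) (auto intro!: mem funpow_mem x)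
  ultimately show ?thesis
    using root_has_sum[OF bop_mem[OF B(1) x]] has_sum_unique by fastforce
qed

lemma root_symmetric:
  assumes x: "x \<in> V" and y: "y \<in> V"
  shows "cinner (root x) y = cinner x (root y)"
proof -
  have "((\<lambda>n. cinner (sqrt_coeff n *\<^sub>R (T ^^ n) x) y) has_sum cinner (root x) y) UNIV"
    by (rule has_sum_bounded_linear[OF cinner.bounded_linear_left root_has_sum[OF x]])
  moreover have "((\<lambda>n. cinner x (sqrt_coeff n *\<^sub>R (T ^^ n) y)) has_sum cinner x (root y)) UNIV"
    by (rule has_sum_bounded_linear[OF cinner.bounded_linear_right root_has_sum[OF y]])
  ultimately show ?thesis
    using has_sum_unique by (simp add: funpow_symmetric[OF x y] cinner.scaleR_left cinner.scaleR_right)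
qed

text \<open>For \<open>n > 0\<close> the coefficient is nonpositive and the real part of
  \<open>cinner ((T ^^ n) x) x\<close> is at most \<open>(norm x)\<^sup>2\<close>. Replacing
  \<open>T\<close> by the identity thus only lowers each term, and the coefficients have a
  nonnegative sum.\<close>

lemma root_positive:
  assumes x: "x \<in> V"
  shows "Re (cinner (root x) x) \<ge> 0"
proof -
  have sm: "sqrt_coeff summable_on UNIV"
    by (rule abs_summable_summable) (simp add: sqrt_coeff_abs_summable)
  have "((\<lambda>n. Re (cinner (sqrt_coeff n *\<^sub>R (T ^^ n) x) x)) has_sum Re (cinner (root x) x)) UNIV"
    by (intro has_sum_bounded_linear[OF bounded_linear_Re]
        has_sum_bounded_linear[OF cinner.bounded_linear_left] root_has_sum x)
  moreover have "((\<lambda>n. sqrt_coeff n * (norm x)\<^sup>2) has_sum (\<Sum>\<^sub>\<infinity>n. sqrt_coeff n) * (norm x)\<^sup>2) UNIV"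
    by (intro has_sum_cmult_left has_sum_infsum sm)
  moreover have "sqrt_coeff n * (norm x)\<^sup>2 \<le> Re (cinner (sqrt_coeff n *\<^sub>R (T ^^ n) x) x)" for n
  proof (cases n)
    case (Suc k)
    have "Re (cinner ((T ^^ n) x) x) \<le> norm ((T ^^ n) x) * norm x"
      using complex_Re_le_cmod norm_cinner_le order_trans by blast
    also have "\<dots> \<le> (norm x)\<^sup>2"
      unfolding power2_eq_square by (intro mult_right_mono funpow_le x) simp
    finally show ?thesis
      unfolding Suc cinner.scaleR_left using sqrt_coeff_nonpos[of k]
      by (simp add: mult_left_mono_neg)
  qed (simp add: norm_sq_Re)
  ultimately have "(\<Sum>\<^sub>\<infinity>n. sqrt_coeff n) * (norm x)\<^sup>2 \<le> Re (cinner (root x) x)"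
    using has_sum_mono by blast
  then show ?thesis
    using sqrt_coeff_infsum_nonneg by (meson order_trans zero_le_mult_iff zero_le_power2)
qed

lemma positive_op_root: "positive_op V root"
proof -
  have "Im (cinner (root x) x) = 0" if "x \<in> V" for x
    using root_symmetric[OF that that] cinner_commute[of "root x" x]
    by (simp add: complex_eq_iff)
  then show ?thesis
    using root_bop root_positive by (simp add: positive_op_def)
qed

lemma root_root:
  assumes x: "x \<in> V"
  shows "root (root x) = x - T x"
proof -
  \<comment> \<open>Cauchy product: the double series is absolutely summable, so it may be regrouped
    by the exponent \<open>k = n + m\<close>, where the convolution identity leaves only
    \<open>k = 0\<close> and \<open>k = 1\<close>.\<close>
  define f where "f = (\<lambda>(n, m). (sqrt_coeff n * sqrt_coeff m) *\<^sub>R (T ^^ (n + m)) x)"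
  have f_summable: "f summable_on UNIV \<times> UNIV"
  proof (rule abs_summable_summable, rule summable_on_comparison_test)
    define h where "h = (\<lambda>(n, m). sqrt_coeff n * sqrt_coeff m * norm x)"
    have "(\<lambda>m. norm (h (n, m))) summable_on UNIV" for n
      unfolding h_def using sqrt_coeff_abs_summable
      by (simp add: abs_mult summable_on_cmult_left summable_on_cmult_right)
    moreover have "(\<Sum>\<^sub>\<infinity>m. norm (h (n, m))) = \<bar>sqrt_coeff n\<bar> * ((\<Sum>\<^sub>\<infinity>m. \<bar>sqrt_coeff m\<bar>) * norm x)" for n
      unfolding h_def by (simp add: abs_mult infsum_cmult_right' infsum_cmult_left' mult.assoc)
    then have "(\<lambda>n. norm (\<Sum>\<^sub>\<infinity>m. norm (h (n, m)))) summable_on UNIV"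
      using sqrt_coeff_abs_summable by (simp add: abs_mult infsum_nonneg summable_on_cmult_left)
    ultimately show "(\<lambda>p. norm (h p)) summable_on UNIV \<times> UNIV"
      unfolding Infinite_Sum.abs_summable_on_Sigma_iff by blast
    show "norm (f p) \<le> norm (h p)" if "p \<in> UNIV \<times> UNIV" for p
      by (cases p) (simp add: f_def h_def abs_mult mult_left_mono funpow_le[OF x])
  qed simp
  have inner: "(\<Sum>\<^sub>\<infinity>m. f (n, m)) = sqrt_coeff n *\<^sub>R (T ^^ n) (root x)" for n
  proof -
    have "((\<lambda>m. restrict (T ^^ n) V (sqrt_coeff m *\<^sub>R (T ^^ m) x)) has_sum restrict (T ^^ n) V (root x)) UNIV"
      by (rule bop_has_sum[OF funpow_bop root_has_sum[OF x]]) (auto intro!: mem funpow_mem x)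
    then have "((\<lambda>m. sqrt_coeff m *\<^sub>R (T ^^ (n + m)) x) has_sum (T ^^ n) (root x)) UNIV"
      by (simp add: mem funpow_mem x root_mem scaleR_scaleC funpow_scaleC funpow_add)
    from has_sum_scaleR[OF this, of "sqrt_coeff n"] show ?thesis
      by (intro infsumI) (simp add: f_def)
  qed
  have bij: "bij_betw (\<lambda>(k, i). (i, k - i)) (SIGMA k:UNIV. {..k}) (UNIV \<times> (UNIV :: nat set))"
    by (rule bij_betwI[where g = "\<lambda>(n, m). (n + m, n)"]) auto
  have "root (root x) = (\<Sum>\<^sub>\<infinity>n. \<Sum>\<^sub>\<infinity>m. f (n, m))"
    using infsumI[OF root_has_sum[OF root_mem[OF x]]] by (simp add: inner)
  also have "\<dots> = infsum f (UNIV \<times> UNIV)"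
    by (rule infsum_Sigma_banach[OF f_summable])
  also have "\<dots> = infsum (\<lambda>p. f ((\<lambda>(k, i). (i, k - i)) p)) (SIGMA k:UNIV. {..k})"
    by (rule infsum_reindex_bij_betw[OF bij, symmetric])
  also have "\<dots> = (\<Sum>\<^sub>\<infinity>k. \<Sum>\<^sub>\<infinity>i\<in>{..k}. f (i, k - i))"
    using infsum_Sigma_banach[of "\<lambda>p. f ((\<lambda>(k, i). (i, k - i)) p)" UNIV "\<lambda>k. {..k}"]
      summable_on_reindex_bij_betw[OF bij, of f] f_summable by simp
  also have "\<dots> = (\<Sum>\<^sub>\<infinity>k. (\<Sum>i\<le>k. sqrt_coeff i * sqrt_coeff (k - i)) *\<^sub>R (T ^^ k) x)"
    by (rule infsum_cong) (simp add: f_def scaleR_sum_left)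
  also have "\<dots> = (\<Sum>\<^sub>\<infinity>k\<in>{0, 1}. (if k = 0 then 1 else - 1) *\<^sub>R (T ^^ k) x)"
    by (rule infsum_cong_neutral) (auto simp: sqrt_coeff_convolution)
  also have "\<dots> = x - T x"
    by simp
  finally show ?thesis .
qed

lemma sqrt_op_eq_root:
  assumes A: "\<And>x. x \<in> V \<Longrightarrow> A x = x - T x"
  shows "sqrt_op V A = root"
  unfolding sqrt_op_def
proof (rule the_equality)
  show "positive_op V root \<and> (\<forall>x\<in>V. root (root x) = A x)"
    using positive_op_root A by (simp add: root_root)
  fix B assume B: "positive_op V B \<and> (\<forall>x\<in>V. B (B x) = A x)"
  then have bop: "B \<in> bop V V"
    by (simp add: positive_op_def)
  \<comment> \<open>Being a root of \<open>I - T\<close>, the operator \<open>B\<close> commutes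
    with \<open>T = I - B\<^sup>2\<close>.\<close>
  have TB: "T x = x - B (B x)" if "x \<in> V" for x
    using B A that by simp
  have "B (T x) = T (B x)" if "x \<in> V" for x
    using that by (simp add: TB bop_mem[OF bop] bop_diff[OF bop])
  then show "B = root"
    using B by (intro positive_op_sqrt_unique positive_op_root) (auto simp: root_commute[OF bop] root_root A)
qed

end

lemma defect_properties:
  assumes V: "csub V" and W: "csub W" and T: "T \<in> contractions V W"
  shows defect_bop: "defect V W T \<in> bop V V"
    and defect_symmetric: "\<And>x y. x \<in> V \<Longrightarrow> y \<in> V \<Longrightarrow> cinner (defect V W T x) y = cinner x (defect V W T y)"
    and defect_cinner: "\<And>x y. x \<in> V \<Longrightarrow> y \<in> V \<Longrightarrow>
      cinner (defect V W T x) (defect V W T y) = cinner x y - cinner (T x) (T y)"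
proof -
  interpret V: csub V by fact
  interpret W: csub W by fact
  have bop: "T \<in> bop V W" and le: "\<And>x. x \<in> V \<Longrightarrow> norm (T x) \<le> norm x"
    using T by (auto simp: contractions_def)
  define S where "S = adjoint_op V W T"
  have S: "S \<in> bop W V" "\<And>x y. x \<in> V \<Longrightarrow> y \<in> W \<Longrightarrow> cinner (T x) y = cinner x (S y)"
    unfolding S_def using bop_adjoint[OF V W bop] by auto
  have S': "cinner y (T x) = cinner (S y) x" if "x \<in> V" "y \<in> W" for x y
    using S(2)[OF that] by (metis cinner_commute)
  have S_le: "norm (S y) \<le> norm y" if y: "y \<in> W" for y
  proof -
    have Sy: "S y \<in> V" using S(1) y by (rule bop_mem)
    have "(norm (S y))\<^sup>2 = Re (cinner (T (S y)) y)"
      by (simp add: S(2) Sy y norm_sq_Re)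
    also have "\<dots> \<le> norm (T (S y)) * norm y"
      using complex_Re_le_cmod norm_cinner_le order_trans by blast
    also have "\<dots> \<le> norm (S y) * norm y"
      by (intro mult_right_mono le Sy) simp
    finally show ?thesis
      by (cases "norm (S y) = 0") (simp_all add: power2_eq_square)
  qed
  have STV: "S (T x) \<in> V" if "x \<in> V" for x
    using that bop S(1) by (simp add: bop_mem)
  interpret symmetric_contraction V "\<lambda>x\<in>V. S (T x)"
  proof
    show "(\<lambda>x\<in>V. S (T x)) \<in> bop V V"
      by (rule V.bop_compose[OF bop S(1)])
    show "norm ((\<lambda>x\<in>V. S (T x)) x) \<le> norm x" if "x \<in> V" for x
      using S_le[OF bop_mem[OF bop that]] le[OF that] that by simp
    show "cinner ((\<lambda>x\<in>V. S (T x)) x) y = cinner x ((\<lambda>x\<in>V. S (T x)) y)" if "x \<in> V" "y \<in> V" for x y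
      using that by (simp add: S(2)[symmetric] S'[symmetric] bop_mem[OF bop])
  qed
  have D: "defect V W T = root"
    unfolding defect_def S_def[symmetric] by (rule sqrt_op_eq_root) simp
  show "defect V W T \<in> bop V V"
    unfolding D by (rule root_bop)
  show "cinner (defect V W T x) y = cinner x (defect V W T y)" if "x \<in> V" "y \<in> V" for x y
    unfolding D by (rule root_symmetric[OF that])
  show "cinner (defect V W T x) (defect V W T y) = cinner x y - cinner (T x) (T y)"
    if "x \<in> V" "y \<in> V" for x y
    using that by (simp add: D root_symmetric root_mem root_root cinner.diff_right S(2) bop_mem[OF bop])
qed

section \<open>The algebra of upper triangular matrices\<close>

locale csubs =
  fixes V :: "int \<Rightarrow> 'a :: chilbert_space set"
  assumes csub: "csub (V k)"
begin

sublocale csub "V k" for k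
  by (rule csub)

end

lemma UM_bop: "H \<in> UM U Y \<Longrightarrow> H j k \<in> bop (U k) (Y j)"
  by (simp add: UM_def)

lemma UM_zero: "H \<in> UM U Y \<Longrightarrow> k < j \<Longrightarrow> u \<in> U k \<Longrightarrow> H j k u = 0"
  by (simp add: UM_def)

lemmas UM_mem = bop_mem[OF UM_bop]
lemmas UM_add = bop_add[OF UM_bop]

lemma (in csubs) UM_zero_right [simp]: "H \<in> UM V Y \<Longrightarrow> H j k 0 = 0"
  by (rule bop_zero[OF UM_bop])

lemma UM_eqI:
  assumes "A \<in> UM U Y" "B \<in> UM U Y" "\<And>j k u. j \<le> k \<Longrightarrow> u \<in> U k \<Longrightarrow> A j k u = B j k u"
  shows "A = B"
proof (intro ext[of A B] ext[of "A _" "B _"])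
  fix j k
  show "A j k = B j k"
    by (rule bop_eqI[OF UM_bop[OF assms(1)] UM_bop[OF assms(2)]])
      (metis assms UM_zero linorder_not_le)
qed

lemma mat_id_apply: "u \<in> U k \<Longrightarrow> mat_id U j k u = (if j = k then u else 0)"
  by (simp add: mat_id_def)

lemma mat_diff_apply: "u \<in> U k \<Longrightarrow> mat_diff U A B j k u = A j k u - B j k u"
  by (simp add: mat_diff_def)

lemma mat_mult_apply: "u \<in> U k \<Longrightarrow> mat_mult U A B j k u = (\<Sum>i\<in>{j..k}. A j i (B i k u))"
  by (simp add: mat_mult_def)

text \<open>Triangularity kills the terms outside \<open>{j..k}\<close>, so several products can be
  summed over one common range; associativity is then an exchange of finite sums.\<close>

lemma mat_mult_eq_sum:
  assumes "csubs V" "M \<in> UM V W" "N \<in> UM U V" "u \<in> U k" "{j..k} \<subseteq> K" "finite K"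
  shows "mat_mult U M N j k u = (\<Sum>i\<in>K. M j i (N i k u))"
proof -
  interpret csubs V by fact
  have "(\<Sum>i\<in>{j..k}. M j i (N i k u)) = (\<Sum>i\<in>K. M j i (N i k u))"
  proof (rule sum.mono_neutral_left)
    show "\<forall>i\<in>K - {j..k}. M j i (N i k u) = 0"
    proof
      fix i assume "i \<in> K - {j..k}"
      then consider "i < j" | "k < i" by force
      then show "M j i (N i k u) = 0"
        using assms by cases (simp_all add: UM_zero UM_mem)
    qed
  qed (use assms in auto)
  then show ?thesis
    using assms(4) by (simp add: mat_mult_def)
qed

lemma mat_mult_mem_UM:
  assumes "csubs U" "csubs V" "csubs W" "M \<in> UM V W" "N \<in> UM U V"
  shows "mat_mult U M N \<in> UM U W"
proof -
  interpret U: csubs U by fact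
  interpret V: csubs V by fact
  interpret W: csubs W by fact
  have "mat_mult U M N j k \<in> bop (U k) (W j)" for j k
  proof -
    have "(\<lambda>u\<in>U k. \<Sum>i\<in>{j..k}. (\<lambda>u\<in>U k. M j i (N i k u)) u) \<in> bop (U k) (W j)"
      by (rule U.bop_restrict_sum[OF W.csub U.bop_compose[OF UM_bop[OF assms(5)] UM_bop[OF assms(4)]]])
    then show ?thesis
      by (simp add: mat_mult_def cong: restrict_cong)
  qed
  then show ?thesis
    by (simp add: UM_def mat_mult_def)
qed

lemma mat_mult_assoc:
  assumes "csubs U" "csubs V" "csubs W" "csubs X" "A \<in> UM W X" "B \<in> UM V W" "C \<in> UM U V"
  shows "mat_mult U (mat_mult V A B) C = mat_mult U A (mat_mult U B C)"
proof (rule UM_eqI)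
  show "mat_mult U (mat_mult V A B) C \<in> UM U X" "mat_mult U A (mat_mult U B C) \<in> UM U X"
    by (rule mat_mult_mem_UM assms)+
  interpret W: csubs W by fact
  fix j k :: int and u assume u: "u \<in> U k"
  have inner_left: "mat_mult V A B j i (C i k u) = (\<Sum>l\<in>{j..k}. A j l (B l i (C i k u)))"
    if "i \<in> {j..k}" for i
    by (rule mat_mult_eq_sum[OF assms(3,5,6) UM_mem[OF assms(7) u]]) (use that in auto)
  have inner_right: "mat_mult U B C l k u = (\<Sum>i\<in>{j..k}. B l i (C i k u))" if "l \<in> {j..k}" for l
    by (rule mat_mult_eq_sum[OF assms(2,6,7) u]) (use that in auto)
  have linear: "A j l (\<Sum>i\<in>{j..k}. B l i (C i k u)) = (\<Sum>i\<in>{j..k}. A j l (B l i (C i k u)))" for l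
    by (rule W.bop_sum[OF UM_bop[OF assms(5)] UM_mem[OF assms(6) UM_mem[OF assms(7) u]]])
  have "mat_mult U (mat_mult V A B) C j k u
      = (\<Sum>i\<in>{j..k}. \<Sum>l\<in>{j..k}. A j l (B l i (C i k u)))"
    unfolding mat_mult_apply[of u U k _ C, OF u] using inner_left by (rule sum.cong[OF refl])
  also have "\<dots> = (\<Sum>l\<in>{j..k}. A j l (\<Sum>i\<in>{j..k}. B l i (C i k u)))"
    unfolding linear by (rule sum.swap)
  also have "\<dots> = mat_mult U A (mat_mult U B C) j k u"
    unfolding mat_mult_apply[of u U k A, OF u] by (rule sum.cong[OF refl]) (simp add: inner_right)
  finally show "mat_mult U (mat_mult V A B) C j k u = mat_mult U A (mat_mult U B C) j k u" .
qed

lemma (in csubs) mat_id_mem_UM: "mat_id V \<in> UM V V"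
proof -
  have "(\<lambda>u\<in>V k. if j = k then u else 0) \<in> bop (V k) (V j)" for j k
    by (cases "j = k") (simp_all add: bop_restrict_id bop_restrict_zero csub)
  then show ?thesis by (simp add: UM_def mat_id_def)
qed

lemma mat_diff_mem_UM:
  assumes "csubs U" "csubs W" "A \<in> UM U W" "B \<in> UM U W"
  shows "mat_diff U A B \<in> UM U W"
proof -
  interpret U: csubs U by fact
  interpret W: csubs W by fact
  show ?thesis
    using U.bop_restrict_diff[OF UM_bop[OF assms(3)] UM_bop[OF assms(4)] W.csub]
    by (simp add: UM_def mat_diff_def UM_zero[OF assms(3)] UM_zero[OF assms(4)])
qed

lemma mat_mult_id_left:
  assumes "csubs U" "csubs V" "M \<in> UM U V"
  shows "mat_mult U (mat_id V) M = M"
proof (rule UM_eqI[OF mat_mult_mem_UM[OF assms(1,2,2)]])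
  interpret V: csubs V by fact
  show "mat_id V \<in> UM V V" by (rule V.mat_id_mem_UM)
  fix j k :: int and u assume "j \<le> k" "u \<in> U k"
  then show "mat_mult U (mat_id V) M j k u = M j k u"
    using assms(3) by (simp add: mat_mult_apply mat_id_apply UM_mem)
qed (use assms in auto)

lemma mat_mult_id_right:
  assumes "csubs U" "csubs V" "M \<in> UM U V"
  shows "mat_mult U M (mat_id U) = M"
proof (rule UM_eqI[OF mat_mult_mem_UM[OF assms(1,1,2)]])
  interpret U: csubs U by fact
  show "mat_id U \<in> UM U U" by (rule U.mat_id_mem_UM)
  fix j k :: int and u assume "j \<le> k" "u \<in> U k"
  then show "mat_mult U M (mat_id U) j k u = M j k u"
    using assms(3) by (simp add: mat_mult_apply mat_id_apply if_distrib[of "M _ _"] cong: if_cong)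
qed (use assms in auto)

lemma mat_mult_diff_right:
  assumes "csubs U" "csubs V" "M \<in> UM V W" "A \<in> UM U V" "B \<in> UM U V" "u \<in> U k"
  shows "mat_mult U M (mat_diff U A B) j k u = mat_mult U M A j k u - mat_mult U M B j k u"
proof -
  interpret V: csubs V by fact
  show ?thesis
    using assms(6)
    by (simp add: mat_mult_apply mat_diff_apply V.bop_diff[OF UM_bop[OF assms(3)]]
        UM_mem[OF assms(4)] UM_mem[OF assms(5)] sum_subtractf)
qed

lemma mat_mult_diff_left:
  assumes "C \<in> UM U V" "u \<in> U k"
  shows "mat_mult U (mat_diff V A B) C j k u = mat_mult U A C j k u - mat_mult U B C j k u"
  using assms by (simp add: mat_mult_apply mat_diff_apply UM_mem sum_subtractf)

section \<open>Neumann series, inverses and resolvents\<close>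

primrec mat_power :: "(int \<Rightarrow> 'a :: chilbert_space set) \<Rightarrow> ('a, 'a) opmat \<Rightarrow> nat \<Rightarrow> ('a, 'a) opmat" where
  "mat_power U C 0 = mat_id U"
| "mat_power U C (Suc n) = mat_mult U C (mat_power U C n)"

definition unitriangular :: "(int \<Rightarrow> 'a :: chilbert_space set) \<Rightarrow> ('a, 'a) opmat \<Rightarrow> bool" where
  "unitriangular U A \<longleftrightarrow> A \<in> UM U U \<and> (\<forall>k. \<forall>u\<in>U k. A k k u = u)"

context csubs begin

lemma csubs_self: "csubs V" ..

lemmas mat_mult_id_left_self = mat_mult_id_left[OF csubs_self csubs_self]
  and mat_mult_id_right_self = mat_mult_id_right[OF csubs_self csubs_self]

lemma unitriangular_one_minus:
  assumes "C \<in> UM V V" "strictly_upper V C"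
  shows "unitriangular V (mat_diff V (mat_id V) C)"
  using assms mat_diff_mem_UM[OF csubs_self csubs_self mat_id_mem_UM assms(1)]
  by (auto simp: unitriangular_def mat_diff_apply mat_id_apply strictly_upper_def)

lemma strictly_upper_one_minus:
  assumes "unitriangular V A"
  shows "mat_diff V (mat_id V) A \<in> UM V V" "strictly_upper V (mat_diff V (mat_id V) A)"
  using assms mat_diff_mem_UM[OF csubs_self csubs_self mat_id_mem_UM, of A]
  by (auto simp: unitriangular_def mat_diff_apply mat_id_apply strictly_upper_def UM_zero order_le_less)

lemma one_minus_one_minus:
  assumes "A \<in> UM V V"
  shows "mat_diff V (mat_id V) (mat_diff V (mat_id V) A) = A"
  by (rule UM_eqI[OF mat_diff_mem_UM[OF csubs_self csubs_self mat_id_mem_UM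
      mat_diff_mem_UM[OF csubs_self csubs_self mat_id_mem_UM assms]] assms])
    (simp add: mat_diff_apply)

lemma mat_power_mem_UM: "C \<in> UM V V \<Longrightarrow> mat_power V C n \<in> UM V V"
  by (induction n) (auto intro: mat_id_mem_UM mat_mult_mem_UM csubs_self)

text \<open>Each strictly upper factor moves the support at least one diagonal further up. This
  makes the Neumann series finite in every entry.\<close>

lemma mat_power_zero:
  assumes "C \<in> UM V V" "strictly_upper V C" "k < j + int n" "u \<in> V k"
  shows "mat_power V C n j k u = 0"
  using assms(3)
proof (induction n arbitrary: j)
  case 0
  then show ?case using assms(4) by (simp add: mat_id_apply)
next
  case (Suc n)
  have "C j i (mat_power V C n i k u) = 0" if "i \<in> {j..k}" for i
  proof (cases "i = j")
    case True
    then show ?thesis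
      using assms(2) UM_mem[OF mat_power_mem_UM[OF assms(1)] assms(4)]
      by (simp add: strictly_upper_def)
  next
    case False
    then have "mat_power V C n i k u = 0"
      using that Suc by auto
    then show ?thesis using assms(1) by simp
  qed
  then show ?case
    using assms(4) by (simp add: mat_mult_apply)
qed

lemma unitriangular_right_inverse:
  assumes A: "unitriangular V A"
  obtains N where "unitriangular V N" "mat_mult V A N = mat_id V"
proof -
  define C where "C = mat_diff V (mat_id V) A"
  have C: "C \<in> UM V V" "strictly_upper V C"
    unfolding C_def using strictly_upper_one_minus[OF A] by auto
  have AC: "A = mat_diff V (mat_id V) C"
    unfolding C_def using A by (simp add: one_minus_one_minus unitriangular_def)
  \<comment> \<open>Powers beyond \<open>k - j\<close> vanish at the entry in question. For
    \<open>k < j\<close> the number \<open>nat (k - j)\<close> is 0, and what is left is the entry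
    of \<open>mat_id\<close>, which is zero there.\<close>
  define N where "N = (\<lambda>j k. \<lambda>u\<in>V k. \<Sum>n\<le>nat (k - j). mat_power V C n j k u)"
  have N_bop: "N j k \<in> bop (V k) (V j)" for j k
    unfolding N_def by (intro bop_restrict_sum csub UM_bop mat_power_mem_UM C)
  have N_zero: "N j k u = 0" if "k < j" "u \<in> V k" for j k u
    using that by (simp add: N_def mat_id_apply)
  have N: "N \<in> UM V V"
    using N_bop N_zero by (simp add: UM_def)
  have "unitriangular V N"
    using N by (simp add: unitriangular_def N_def mat_id_apply)
  moreover have "mat_mult V A N = mat_id V"
  proof (rule UM_eqI[OF mat_mult_mem_UM mat_id_mem_UM])
    show "A \<in> UM V V" using A by (simp add: unitriangular_def)
    fix j k :: int and u assume jk: "j \<le> k" and u: "u \<in> V k"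
    have "mat_mult V C N j k u = (\<Sum>i\<in>{j..k}. C j i (\<Sum>n\<le>nat (k - j). mat_power V C n i k u))"
      unfolding mat_mult_apply[of u V k, OF u]
    proof (rule sum.cong[OF refl])
      fix i assume i: "i \<in> {j..k}"
      \<comment> \<open>The range of the inner sum varies with \<open>i\<close>; vanishing powers
        are added to make it uniform.\<close>
      have "(\<Sum>n\<le>nat (k - i). mat_power V C n i k u) = (\<Sum>n\<le>nat (k - j). mat_power V C n i k u)"
        by (rule sum.mono_neutral_left) (use i u in \<open>auto intro!: mat_power_zero C\<close>)
      then show "C j i (N i k u) = C j i (\<Sum>n\<le>nat (k - j). mat_power V C n i k u)"
        using u by (simp add: N_def)
    qed
    also have "\<dots> = (\<Sum>i\<in>{j..k}. \<Sum>n\<le>nat (k - j). C j i (mat_power V C n i k u))"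
      by (rule sum.cong[OF refl]) (rule bop_sum[OF UM_bop[OF C(1)] UM_mem[OF mat_power_mem_UM[OF C(1)] u]])
    also have "\<dots> = (\<Sum>n\<le>nat (k - j). mat_power V C (Suc n) j k u)"
      by (subst sum.swap) (simp add: mat_mult_apply[of u V k, OF u])
    also have "\<dots> = N j k u - mat_id V j k u"
    proof -
      have "mat_power V C (Suc (nat (k - j))) j k u = 0"
        by (rule mat_power_zero) (use C jk u in auto)
      then have "(\<Sum>n\<le>nat (k - j). mat_power V C (Suc n) j k u) + mat_id V j k u
          = (\<Sum>n\<le>nat (k - j). mat_power V C n j k u)"
        using sum.atMost_Suc_shift[of "\<lambda>n. mat_power V C n j k u" "nat (k - j)"]
        by (simp add: add.commute)
      then show ?thesis
        using u by (simp add: N_def algebra_simps)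
    qed
    finally show "mat_mult V A N j k u = mat_id V j k u"
      unfolding AC mat_mult_diff_left[OF N u] mat_mult_id_left_self[OF N] by simp
  qed (use csubs_self N in auto)
  ultimately show thesis by (rule that)
qed

text \<open>The right inverse \<open>N\<close> is unitriangular and so has a right inverse
  \<open>B\<close> of its own; associativity forces \<open>B = A\<close>, which makes
  \<open>N\<close> two-sided.\<close>

lemma unitriangular_inverse:
  assumes A: "unitriangular V A"
  shows "is_mat_inv V A (mat_inv V A)" "unitriangular V (mat_inv V A)"
proof -
  obtain N where N: "unitriangular V N" "mat_mult V A N = mat_id V"
    using unitriangular_right_inverse[OF A] .
  obtain B where B: "unitriangular V B" "mat_mult V N B = mat_id V"
    using unitriangular_right_inverse[OF N(1)] .
  have mem: "A \<in> UM V V" "N \<in> UM V V" "B \<in> UM V V"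
    using A N B by (auto simp: unitriangular_def)
  have "mat_mult V (mat_mult V A N) B = mat_mult V A (mat_mult V N B)"
    by (intro mat_mult_assoc[of V V V V] csubs_self mem)
  then have "B = A"
    by (simp add: N B mat_mult_id_left_self mat_mult_id_right_self mem)
  then have inv: "is_mat_inv V A N"
    using N B mem by (simp add: is_mat_inv_def)
  have "N' = N" if N': "is_mat_inv V A N'" for N'
  proof -
    have "mat_mult V (mat_mult V N' A) N = mat_mult V N' (mat_mult V A N)"
      using N' by (intro mat_mult_assoc[of V V V V] csubs_self mem) (simp add: is_mat_inv_def)
    then show ?thesis
      using N' inv by (simp add: is_mat_inv_def mat_mult_id_left_self mat_mult_id_right_self)
  qed
  then have "mat_inv V A = N"
    unfolding mat_inv_def using inv by (intro the_equality)
  then show "is_mat_inv V A (mat_inv V A)" "unitriangular V (mat_inv V A)"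
    using inv N by simp_all
qed

lemma mat_inv_eqI:
  assumes A: "unitriangular V A" and N: "is_mat_inv V A N"
  shows "mat_inv V A = N"
proof -
  note inv = unitriangular_inverse(1)[OF A]
  have "mat_mult V (mat_mult V N A) (mat_inv V A) = mat_mult V N (mat_mult V A (mat_inv V A))"
    using A N inv by (intro mat_mult_assoc[of V V V V] csubs_self) (auto simp: unitriangular_def is_mat_inv_def)
  then show ?thesis
    using N inv mat_mult_id_left_self[of "mat_inv V A"]
      mat_mult_id_right_self[of N]
    by (auto simp: is_mat_inv_def)
qed

lemma mat_inv_mat_inv:
  assumes A: "unitriangular V A"
  shows "mat_inv V (mat_inv V A) = A"
proof (rule mat_inv_eqI)
  show "unitriangular V (mat_inv V A)"
    by (rule unitriangular_inverse(2)[OF A])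
  show "is_mat_inv V (mat_inv V A) A"
    using A unitriangular_inverse(1)[OF A] by (simp add: is_mat_inv_def unitriangular_def)
qed

definition resolvent :: "('a, 'a) opmat \<Rightarrow> ('a, 'a) opmat" where
  "resolvent C = mat_inv V (mat_diff V (mat_id V) C)"

definition resolvent_inv :: "('a, 'a) opmat \<Rightarrow> ('a, 'a) opmat" where
  "resolvent_inv N = mat_diff V (mat_id V) (mat_inv V N)"

lemma resolvent:
  assumes "C \<in> UM V V" "strictly_upper V C"
  shows "unitriangular V (resolvent C)" "resolvent C \<in> UM V V" "resolvent_inv (resolvent C) = C"
    and "mat_mult V (mat_diff V (mat_id V) C) (resolvent C) = mat_id V"
    and "mat_mult V (resolvent C) (mat_diff V (mat_id V) C) = mat_id V"
    and "is_mat_inv V (mat_diff V (mat_id V) C) (resolvent C)"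
  using unitriangular_inverse[OF unitriangular_one_minus[OF assms]] assms
  by (auto simp: resolvent_def resolvent_inv_def mat_inv_mat_inv unitriangular_one_minus
      one_minus_one_minus is_mat_inv_def)

lemma resolvent_inv:
  assumes "unitriangular V N"
  shows "resolvent_inv N \<in> UM V V" "strictly_upper V (resolvent_inv N)" "resolvent (resolvent_inv N) = N"
proof -
  note inv = unitriangular_inverse[OF assms]
  show "resolvent_inv N \<in> UM V V" "strictly_upper V (resolvent_inv N)"
    unfolding resolvent_inv_def by (rule strictly_upper_one_minus[OF inv(2)])+
  show "resolvent (resolvent_inv N) = N"
    using inv(2) by (simp add: resolvent_def resolvent_inv_def one_minus_one_minus mat_inv_mat_inv[OF assms] unitriangular_def)
qed

lemma resolvent_eq_iff:
  assumes "C \<in> UM V V" "strictly_upper V C" "C' \<in> UM V V" "strictly_upper V C'"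
  shows "resolvent C = resolvent C' \<longleftrightarrow> C = C'"
  using resolvent(3)[OF assms(1,2)] resolvent(3)[OF assms(3,4)] by metis

lemma one_minus_resolvent_apply:
  assumes "C \<in> UM V V" "strictly_upper V C" "u \<in> V k"
  shows "resolvent C j k u - (\<Sum>i\<in>{j..k}. C j i (resolvent C i k u)) = (if j = k then u else 0)"
  using fun_cong[OF fun_cong[OF fun_cong[OF resolvent(4)[OF assms(1,2)]]], of j k u] assms(3)
    resolvent(2)[OF assms(1,2)]
  by (simp add: mat_mult_diff_left mat_mult_id_left_self mat_mult_apply[of u V k C, OF assms(3)] mat_id_apply)

lemma resolvent_one_minus_apply:
  assumes "C \<in> UM V V" "strictly_upper V C" "u \<in> V k"
  shows "resolvent C j k u - (\<Sum>i\<in>{j..k}. resolvent C j i (C i k u)) = (if j = k then u else 0)"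
  using fun_cong[OF fun_cong[OF fun_cong[OF resolvent(5)[OF assms(1,2)]]], of j k u] assms(3)
    mat_mult_diff_right[OF csubs_self csubs_self resolvent(2)[OF assms(1,2)] mat_id_mem_UM assms(1,3), of j]
    resolvent(2)[OF assms(1,2)]
  by (simp add: mat_mult_id_right_self mat_mult_apply[of u V k _ C, OF assms(3)] mat_id_apply)

text \<open>With \<open>N = resolvent C\<close>, column \<open>k\<close> of
  \<open>N (I - C) = I\<close> says that off the diagonal \<open>N\<close> applied to column
  \<open>k\<close> of \<open>C\<close> is column \<open>k\<close> of \<open>N\<close>; if the former
  has the single entry \<open>y\<close>, this is column \<open>k - 1\<close> of \<open>N\<close> at
  \<open>y\<close>. The converse uses the other order, \<open>(I - C) N = I\<close>.\<close>

lemma column_shift_iff_resolvent: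
  assumes C: "C \<in> UM V V" "strictly_upper V C" and x: "x \<in> V k" and y: "y \<in> V (k - 1)"
  shows "(\<forall>j. C j k x = (if j = k - 1 then y else 0)) \<longleftrightarrow>
    (\<forall>j<k. resolvent C j k x = resolvent C j (k - 1) y)"
proof
  assume shift: "\<forall>j. C j k x = (if j = k - 1 then y else 0)"
  show "\<forall>j<k. resolvent C j k x = resolvent C j (k - 1) y"
  proof (intro allI impI)
    fix j assume "j < k"
    then have "(\<Sum>i\<in>{j..k}. resolvent C j i (C i k x)) = resolvent C j (k - 1) y"
      using shift resolvent(2)[OF C] by (simp add: if_distrib[of "resolvent C j _"] cong: if_cong)
    then show "resolvent C j k x = resolvent C j (k - 1) y"
      using resolvent_one_minus_apply[OF C x, of j] \<open>j < k\<close> by simp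
  qed
next
  assume eq: "\<forall>j<k. resolvent C j k x = resolvent C j (k - 1) y"
  show "\<forall>j. C j k x = (if j = k - 1 then y else 0)"
  proof
    fix j
    show "C j k x = (if j = k - 1 then y else 0)"
    proof (cases "j < k")
      case True
      \<comment> \<open>Splitting off \<open>i = k\<close>, where the resolvent is the identity,
        isolates \<open>C j k x\<close>. The remaining sum is the one for column
        \<open>k - 1\<close> at \<open>y\<close>, so the equations of the two columns can be
        subtracted.\<close>
      then have "{j..k} = insert k {j..k - 1}" by auto
      moreover have "resolvent C k k x = x"
        using resolvent(1)[OF C] x by (simp add: unitriangular_def)
      ultimately have "(\<Sum>i\<in>{j..k}. C j i (resolvent C i k x))
          = C j k x + (\<Sum>i\<in>{j..k - 1}. C j i (resolvent C i (k - 1) y))"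
        using eq by simp
      then show ?thesis
        using one_minus_resolvent_apply[OF C x, of j] one_minus_resolvent_apply[OF C y, of j] eq True
        by (simp add: algebra_simps split: if_splits)
    next
      case False
      then show ?thesis using C(2) x by (simp add: strictly_upper_def)
    qed
  qed
qed

end

section \<open>Contractive matrices and their finite blocks\<close>

lemma bounded_linear_coord: "bounded_linear (\<lambda>u. coord u k)"
  by (rule bounded_linear_intro[where K = 1]) (simp_all add: coord_plus coord_scaleR norm_coord_le)

lemma coord_sum: "coord (sum f I) k = (\<Sum>i\<in>I. coord (f i) k)"
  by (rule linear_sum[OF bounded_linear.linear[OF bounded_linear_coord]])

lemma (in csubs) csub_hdsum: "csub (hdsum V)"
proof
  have "hdsum V = (\<Inter>k. (\<lambda>u. coord u k) -` V k)"
    by (auto simp: hdsum_def)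
  moreover have "closed ((\<lambda>u. coord u k) -` V k)" for k
    by (intro continuous_closed_vimage closed linear_continuous_on bounded_linear_coord
        linear_continuous_at)
  ultimately have "closed (hdsum V)"
    by auto
  then show "closed_csubspace (hdsum V)"
    by (auto simp: closed_csubspace_def hdsum_def coord_zero coord_plus coord_scaleC mem)
qed

lemma sum_norm_coord_le: "finite J \<Longrightarrow> (\<Sum>j\<in>J. (norm (coord x j))\<^sup>2) \<le> (norm x)\<^sup>2"
  unfolding norm_ell2_sq by (rule finite_sum_le_infsum) (auto simp: coord_summable)

lemma finite_support_ell2:
  assumes "finite I"
  obtains x where "\<And>k. coord x k = (if k \<in> I then v k else 0)" "(norm x)\<^sup>2 = (\<Sum>k\<in>I. (norm (v k))\<^sup>2)"
proof -
  define f where "f k = (if k \<in> I then v k else 0)" for k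
  have hs: "((\<lambda>k. (norm (f k))\<^sup>2) has_sum (\<Sum>k\<in>I. (norm (v k))\<^sup>2)) UNIV"
    by (rule has_sum_finite_neutralI[OF assms]) (auto simp: f_def)
  then have "coord (Abs_ell2 f) = f"
    by (intro Abs_ell2_inverse) (auto simp: summable_on_def)
  then show thesis
    using infsumI[OF hs] by (intro that[of "Abs_ell2 f"]) (simp_all add: norm_ell2_sq f_def)
qed

text \<open>Cauchy criterion for the net of finite partial sums. It is applied to the rows of
  contractive matrices, where sums of squares are controlled but the norms of the terms need not be
  summable.\<close>

lemma summable_on_if_norm_sq_sum_le:
  fixes f :: "'i \<Rightarrow> 'a :: banach"
  assumes g: "g summable_on UNIV" and le: "\<And>F. finite F \<Longrightarrow> (norm (sum f F))\<^sup>2 \<le> sum g F"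
  shows "f summable_on UNIV"
proof -
  have "\<exists>P. eventually P (finite_subsets_at_top UNIV) \<and>
      (\<forall>F F'. P F \<and> P F' \<longrightarrow> dist (sum f F) (sum f F') < e)" if e: "e > 0" for e :: real
  proof -
    have g_nonneg: "g i \<ge> 0" for i
      using order_trans[OF zero_le_power2 le[of "{i}"]] by simp
    have "(sum g \<longlongrightarrow> infsum g UNIV) (finite_subsets_at_top UNIV)"
      using has_sum_infsum[OF g] by (simp add: has_sum_def)
    then have "\<forall>\<^sub>F F in finite_subsets_at_top UNIV. dist (sum g F) (infsum g UNIV) < (e / 2)\<^sup>2"
      using e by (intro tendstoD) auto
    then obtain F0 where F0: "finite F0" "dist (sum g F0) (infsum g UNIV) < (e / 2)\<^sup>2"
      unfolding eventually_finite_subsets_at_top by (metis order_refl subset_UNIV)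
    have small: "dist (sum f F) (sum f F0) < e / 2" if F: "finite F" "F0 \<subseteq> F" for F
    proof -
      have "sum g F \<le> infsum g UNIV"
        by (rule finite_sum_le_infsum[OF g F(1)]) (auto simp: g_nonneg)
      then have "sum g (F - F0) < (e / 2)\<^sup>2"
        using F0(2) sum_diff[OF F, of g] unfolding dist_real_def by linarith
      then have "(norm (sum f (F - F0)))\<^sup>2 < (e / 2)\<^sup>2"
        using le[of "F - F0"] F(1) by (intro le_less_trans[OF le]) auto
      then have "norm (sum f (F - F0)) < e / 2"
        by (rule power_less_imp_less_base) (use e in simp)
      then show ?thesis
        unfolding dist_norm sum_diff[OF F, of f] .
    qed
    show ?thesis
    proof (intro exI[of _ "\<lambda>F. finite F \<and> F0 \<subseteq> F"] conjI allI impI)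
      show "\<forall>\<^sub>F F in finite_subsets_at_top UNIV. finite F \<and> F0 \<subseteq> F"
        unfolding eventually_finite_subsets_at_top using F0(1) by (intro exI[of _ F0]) simp
      fix F F' assume "(finite F \<and> F0 \<subseteq> F) \<and> finite F' \<and> F0 \<subseteq> F'"
      then show "dist (sum f F) (sum f F') < e"
        using small[of F] small[of F'] dist_triangle2[of "sum f F" "sum f F'" "sum f F0"] by linarith
    qed
  qed
  then have "cauchy_filter (filtermap (sum f) (finite_subsets_at_top UNIV))"
    unfolding cauchy_filter_metric_filtermap by blast
  moreover have "complete (UNIV :: 'a set)"
    by (meson Cauchy_convergent UNIV_I complete_def convergent_def)
  moreover have "filtermap (sum f) (finite_subsets_at_top UNIV) \<noteq> bot"
    by (simp add: filtermap_bot_iff)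
  ultimately have "\<exists>L. filtermap (sum f) (finite_subsets_at_top UNIV) \<le> nhds L"
    unfolding complete_uniform by auto
  then obtain L where "(sum f \<longlongrightarrow> L) (finite_subsets_at_top UNIV)"
    unfolding filterlim_def by blast
  then show ?thesis
    unfolding summable_on_def has_sum_def by blast
qed

lemma induces_unique:
  assumes "induces U Y H T" "induces U Y H T'"
  shows "T = T'"
proof (rule bop_eqI)
  show "T \<in> bop (hdsum U) (hdsum Y)" "T' \<in> bop (hdsum U) (hdsum Y)"
    using assms by (auto simp: induces_def)
  show "T u = T' u" if "u \<in> hdsum U" for u
  proof (rule ell2_eqI)
    show "coord (T u) j = coord (T' u) j" for j
      using assms that has_sum_unique unfolding induces_def by blast
  qed
qed

lemma mat_op_eqI: "induces U Y H T \<Longrightarrow> mat_op U Y H = T"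
  unfolding mat_op_def by (blast intro: induces_unique the_equality)

lemma induces_mat_op: "H \<in> UM_inf U Y \<Longrightarrow> induces U Y H (mat_op U Y H)"
  using mat_op_eqI by (fastforce simp: UM_inf_def)

text \<open>Contractivity of \<open>A\<close> stacked on \<open>B\<close>, tested on finitely
  supported vectors. Rows and columns run over the same interval because products of triangular
  matrices restrict to such blocks; other finite sets of rows and columns are reached by enlarging
  the interval.\<close>

definition block_contractive :: "(int \<Rightarrow> 'a :: chilbert_space set) \<Rightarrow> ('a, 'b :: chilbert_space) opmat
    \<Rightarrow> ('a, 'c :: chilbert_space) opmat \<Rightarrow> bool" where
  "block_contractive V A B \<longleftrightarrow> (\<forall>m n v. (\<forall>k. v k \<in> V k) \<longrightarrow>
     (\<Sum>j\<in>{m..n}. (norm (\<Sum>k\<in>{m..n}. A j k (v k)))\<^sup>2 + (norm (\<Sum>k\<in>{m..n}. B j k (v k)))\<^sup>2)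
     \<le> (\<Sum>k\<in>{m..n}. (norm (v k))\<^sup>2))"

context csubs begin

lemma block_contractive_finite:
  assumes bc: "block_contractive V A B" and A: "A \<in> UM V Y" and B: "B \<in> UM V W"
    and fin: "finite J" "finite K" and v: "\<And>k. k \<in> K \<Longrightarrow> v k \<in> V k"
  shows "(\<Sum>j\<in>J. (norm (\<Sum>k\<in>K. A j k (v k)))\<^sup>2 + (norm (\<Sum>k\<in>K. B j k (v k)))\<^sup>2)
     \<le> (\<Sum>k\<in>K. (norm (v k))\<^sup>2)"
proof -
  \<comment> \<open>Inserting 0 keeps \<open>Min\<close> and \<open>Max\<close> meaningful when
    \<open>J\<close> and \<open>K\<close> are empty.\<close>
  define I where "I = {Min (insert 0 (J \<union> K))..Max (insert 0 (J \<union> K))}"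
  have I: "J \<subseteq> I" "K \<subseteq> I" "finite I"
    using fin by (auto simp: I_def)
  define w where "w k = (if k \<in> K then v k else 0)" for k
  have w: "\<forall>k. w k \<in> V k"
    using v by (simp add: w_def)
  have eq: "(\<Sum>k\<in>I. A j k (w k)) = (\<Sum>k\<in>K. A j k (v k))" "(\<Sum>k\<in>I. B j k (w k)) = (\<Sum>k\<in>K. B j k (v k))" for j
    by (rule sum.mono_neutral_cong_right; use I A B in \<open>auto simp: w_def\<close>)+
  have "(\<Sum>j\<in>J. (norm (\<Sum>k\<in>K. A j k (v k)))\<^sup>2 + (norm (\<Sum>k\<in>K. B j k (v k)))\<^sup>2)
      \<le> (\<Sum>j\<in>I. (norm (\<Sum>k\<in>I. A j k (w k)))\<^sup>2 + (norm (\<Sum>k\<in>I. B j k (w k)))\<^sup>2)"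
    unfolding eq by (rule sum_mono2) (use I in auto)
  also have "\<dots> \<le> (\<Sum>k\<in>I. (norm (w k))\<^sup>2)"
    using bc w unfolding block_contractive_def I_def by blast
  also have "\<dots> = (\<Sum>k\<in>K. (norm (v k))\<^sup>2)"
    by (rule sum.mono_neutral_cong_right) (use I in \<open>auto simp: w_def\<close>)
  finally show ?thesis .
qed

lemma block_contractive_commute: "block_contractive V A B \<Longrightarrow> block_contractive V B A"
  by (simp add: block_contractive_def add.commute)

lemma block_contractive_summable:
  assumes bc: "block_contractive V A B" and A: "A \<in> UM V Y" and B: "B \<in> UM V W" and u: "u \<in> hdsum V"
  shows "(\<lambda>k. A j k (coord u k)) summable_on UNIV"
proof (rule summable_on_if_norm_sq_sum_le[OF coord_summable[of u]])
  fix F :: "int set" assume "finite F"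
  then have "(norm (\<Sum>k\<in>F. A j k (coord u k)))\<^sup>2 + (norm (\<Sum>k\<in>F. B j k (coord u k)))\<^sup>2 \<le> (\<Sum>k\<in>F. (norm (coord u k))\<^sup>2)"
    using block_contractive_finite[OF bc A B, of "{j}" F "coord u"] u by (simp add: hdsum_def)
  then show "(norm (\<Sum>k\<in>F. A j k (coord u k)))\<^sup>2 \<le> (\<Sum>k\<in>F. (norm (coord u k))\<^sup>2)"
    using zero_le_power2[of "norm (\<Sum>k\<in>F. B j k (coord u k))"] by linarith
qed

lemma block_contractive_has_sum_le:
  assumes bc: "block_contractive V A B" and A: "A \<in> UM V Y" and B: "B \<in> UM V W" and u: "u \<in> hdsum V"
    and a: "\<And>j. ((\<lambda>k. A j k (coord u k)) has_sum a j) UNIV"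
    and b: "\<And>j. ((\<lambda>k. B j k (coord u k)) has_sum b j) UNIV"
    and J: "finite J"
  shows "(\<Sum>j\<in>J. (norm (a j))\<^sup>2 + (norm (b j))\<^sup>2) \<le> (norm u)\<^sup>2"
proof (rule tendsto_upperbound)
  show "((\<lambda>K. \<Sum>j\<in>J. (norm (\<Sum>k\<in>K. A j k (coord u k)))\<^sup>2 + (norm (\<Sum>k\<in>K. B j k (coord u k)))\<^sup>2)
      \<longlongrightarrow> (\<Sum>j\<in>J. (norm (a j))\<^sup>2 + (norm (b j))\<^sup>2)) (finite_subsets_at_top UNIV)"
    using a b unfolding has_sum_def by (intro tendsto_intros)
  show "\<forall>\<^sub>F K in finite_subsets_at_top UNIV.
      (\<Sum>j\<in>J. (norm (\<Sum>k\<in>K. A j k (coord u k)))\<^sup>2 + (norm (\<Sum>k\<in>K. B j k (coord u k)))\<^sup>2) \<le> (norm u)\<^sup>2"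
  proof (rule eventually_finite_subsets_at_top_weakI)
    fix K :: "int set" assume K: "finite K"
    have "(\<Sum>j\<in>J. (norm (\<Sum>k\<in>K. A j k (coord u k)))\<^sup>2 + (norm (\<Sum>k\<in>K. B j k (coord u k)))\<^sup>2)
        \<le> (\<Sum>k\<in>K. (norm (coord u k))\<^sup>2)"
      by (rule block_contractive_finite[OF bc A B J K]) (use u in \<open>simp add: hdsum_def\<close>)
    also have "\<dots> \<le> (norm u)\<^sup>2"
      by (rule sum_norm_coord_le[OF K])
    finally show "(\<Sum>j\<in>J. (norm (\<Sum>k\<in>K. A j k (coord u k)))\<^sup>2 + (norm (\<Sum>k\<in>K. B j k (coord u k)))\<^sup>2) \<le> (norm u)\<^sup>2" .
  qed
qed simp

lemma block_contractive_induces: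
  assumes Y: "csubs Y" and bc: "block_contractive V A B" and A: "A \<in> UM V Y" and B: "B \<in> UM V W"
  shows "A \<in> UM_inf V Y"
proof -
  interpret Y: csubs Y by fact
  define a where "a u j = (\<Sum>\<^sub>\<infinity>k. A j k (coord u k))" for u j
  have a: "((\<lambda>k. A j k (coord u k)) has_sum a u j) UNIV" if "u \<in> hdsum V" for u j
    unfolding a_def by (intro has_sum_infsum block_contractive_summable[OF bc A B that])
  have bound: "(\<Sum>j\<in>J. (norm (a u j))\<^sup>2) \<le> (norm u)\<^sup>2" if u: "u \<in> hdsum V" and J: "finite J" for u J
  proof -
    have "(\<Sum>j\<in>J. (norm (a u j))\<^sup>2) \<le> (\<Sum>j\<in>J. (norm (a u j))\<^sup>2 + (norm (\<Sum>\<^sub>\<infinity>k. B j k (coord u k)))\<^sup>2)"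
      by (rule sum_mono) simp
    also have "\<dots> \<le> (norm u)\<^sup>2"
      by (rule block_contractive_has_sum_le[OF bc A B u a[OF u] _ J])
        (intro has_sum_infsum block_contractive_summable[OF block_contractive_commute[OF bc] B A u])
    finally show ?thesis .
  qed
  define T where "T u = Abs_ell2 (a u)" for u
  have coord_T: "coord (T u) = a u" if "u \<in> hdsum V" for u
    unfolding T_def by (rule Abs_ell2_inverse) (use sq_bounded_summable bound that in blast)
  have a_add: "a (u + v) j = a u j + a v j" if "u \<in> hdsum V" "v \<in> hdsum V" for u v j
  proof (rule has_sum_unique[OF a])
    show "u + v \<in> hdsum V"
      by (rule csub.add_mem[OF csub_hdsum that])
    show "((\<lambda>k. A j k (coord (u + v) k)) has_sum a u j + a v j) UNIV"
      using has_sum_add[OF a[OF that(1)] a[OF that(2)]] that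
      by (simp add: coord_plus UM_add[OF A] hdsum_def)
  qed
  have a_scale: "a (c *\<^sub>C u) j = c *\<^sub>C a u j" if "u \<in> hdsum V" for c u j
  proof (rule has_sum_unique[OF a])
    show "c *\<^sub>C u \<in> hdsum V"
      by (rule csub.scaleC_mem[OF csub_hdsum that])
    show "((\<lambda>k. A j k (coord (c *\<^sub>C u) k)) has_sum c *\<^sub>C a u j) UNIV"
      using has_sum_bounded_linear[OF scaleC.bounded_linear_right a[OF that]] that
      by (simp add: coord_scaleC bop_scaleC[OF UM_bop[OF A]] hdsum_def)
  qed
  have a_mem: "a u j \<in> Y j" if "u \<in> hdsum V" for u j
    by (rule Y.has_sum_mem[OF a[OF that]]) (use that in \<open>simp add: hdsum_def UM_mem[OF A]\<close>)
  have "restrict T (hdsum V) \<in> bop (hdsum V) (hdsum Y)"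
  proof (rule bop_restrictI[OF csub_hdsum, where B = 1])
    show "T u \<in> hdsum Y" if "u \<in> hdsum V" for u
      using coord_T[OF that] a_mem[OF that] by (simp add: hdsum_def)
    show "T (u + v) = T u + T v" if "u \<in> hdsum V" "v \<in> hdsum V" for u v
      by (rule ell2_eqI) (simp add: coord_T csub.add_mem[OF csub_hdsum] that coord_plus a_add)
    show "T (c *\<^sub>C u) = c *\<^sub>C T u" if "u \<in> hdsum V" for c u
      by (rule ell2_eqI) (simp add: coord_T csub.scaleC_mem[OF csub_hdsum] that coord_scaleC a_scale)
    show "norm (T u) \<le> 1 * norm u" if "u \<in> hdsum V" for u
    proof -
      have "(norm (T u))\<^sup>2 \<le> (norm u)\<^sup>2"
        unfolding norm_ell2_sq[of "T u"]
        by (rule infsum_le_finite_sums[OF coord_summable]) (simp add: coord_T[OF that] bound[OF that])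
      then show ?thesis by simp
    qed
  qed
  then have "induces V Y A (restrict T (hdsum V))"
    using a by (simp add: induces_def coord_T)
  then show ?thesis
    using A by (auto simp: UM_inf_def)
qed

text \<open>From blocks to operators, first the columns and then the rows exhaust the integers.
  Conversely, a block is the operator at a finitely supported vector with some rows of the output
  dropped.\<close>

theorem block_contractive_iff:
  assumes Y: "csubs Y" and W: "csubs W" and A: "A \<in> UM V Y" and B: "B \<in> UM V W"
  shows "block_contractive V A B \<longleftrightarrow> A \<in> UM_inf V Y \<and> B \<in> UM_inf V W \<and>
    (\<forall>u\<in>hdsum V. (norm (mat_op V Y A u))\<^sup>2 + (norm (mat_op V W B u))\<^sup>2 \<le> (norm u)\<^sup>2)"
    (is "?L \<longleftrightarrow> ?R")
proof
  assume bc: ?L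
  have A': "A \<in> UM_inf V Y"
    by (rule block_contractive_induces[OF Y bc A B])
  have B': "B \<in> UM_inf V W"
    by (rule block_contractive_induces[OF W block_contractive_commute[OF bc] B A])
  have "(norm (mat_op V Y A u))\<^sup>2 + (norm (mat_op V W B u))\<^sup>2 \<le> (norm u)\<^sup>2" if u: "u \<in> hdsum V" for u
  proof -
    have hs: "((\<lambda>k. A j k (coord u k)) has_sum coord (mat_op V Y A u) j) UNIV"
      "((\<lambda>k. B j k (coord u k)) has_sum coord (mat_op V W B u) j) UNIV" for j
      using induces_mat_op[OF A'] induces_mat_op[OF B'] u by (auto simp: induces_def)
    have "(norm (mat_op V Y A u))\<^sup>2 + (norm (mat_op V W B u))\<^sup>2
        = (\<Sum>\<^sub>\<infinity>j. (norm (coord (mat_op V Y A u) j))\<^sup>2 + (norm (coord (mat_op V W B u) j))\<^sup>2)"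
      unfolding norm_ell2_sq by (intro infsum_add[symmetric] coord_summable)
    also have "\<dots> \<le> (norm u)\<^sup>2"
      by (rule infsum_le_finite_sums)
        (auto intro!: summable_on_add coord_summable block_contractive_has_sum_le[OF bc A B u hs])
    finally show ?thesis .
  qed
  with A' B' show ?R by blast
next
  assume R: ?R
  show ?L
    unfolding block_contractive_def
  proof (intro allI impI)
    fix m n :: int and v assume v: "\<forall>k. v k \<in> V k"
    obtain x where x: "\<And>k. coord x k = (if k \<in> {m..n} then v k else 0)"
      "(norm x)\<^sup>2 = (\<Sum>k\<in>{m..n}. (norm (v k))\<^sup>2)"
      using finite_support_ell2[of "{m..n}" v] by auto
    have xV: "x \<in> hdsum V"
      using v by (simp add: hdsum_def x(1))
    have "((\<lambda>k. A j k (coord x k)) has_sum (\<Sum>k\<in>{m..n}. A j k (v k))) UNIV" for j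
      by (rule has_sum_finite_neutralI[of "{m..n}"]) (use A in \<open>auto simp: x(1)\<close>)
    then have a: "coord (mat_op V Y A x) j = (\<Sum>k\<in>{m..n}. A j k (v k))" for j
      using induces_mat_op[of A V Y] R xV has_sum_unique by (fastforce simp: induces_def)
    have "((\<lambda>k. B j k (coord x k)) has_sum (\<Sum>k\<in>{m..n}. B j k (v k))) UNIV" for j
      by (rule has_sum_finite_neutralI[of "{m..n}"]) (use B in \<open>auto simp: x(1)\<close>)
    then have b: "coord (mat_op V W B x) j = (\<Sum>k\<in>{m..n}. B j k (v k))" for j
      using induces_mat_op[of B V W] R xV has_sum_unique by (fastforce simp: induces_def)
    have "(\<Sum>j\<in>{m..n}. (norm (\<Sum>k\<in>{m..n}. A j k (v k)))\<^sup>2 + (norm (\<Sum>k\<in>{m..n}. B j k (v k)))\<^sup>2)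
        \<le> (norm (mat_op V Y A x))\<^sup>2 + (norm (mat_op V W B x))\<^sup>2"
      unfolding sum.distrib a[symmetric] b[symmetric] by (intro add_mono sum_norm_coord_le) auto
    also have "\<dots> \<le> (norm x)\<^sup>2"
      using R xV by blast
    finally show "(\<Sum>j\<in>{m..n}. (norm (\<Sum>k\<in>{m..n}. A j k (v k)))\<^sup>2 + (norm (\<Sum>k\<in>{m..n}. B j k (v k)))\<^sup>2)
        \<le> (\<Sum>k\<in>{m..n}. (norm (v k))\<^sup>2)"
      unfolding x(2) .
  qed
qed

text \<open>For a row \<open>j\<close> with \<open>m \<le> j\<close> and a column
  \<open>k \<le> n\<close>, all indices from \<open>j\<close> to \<open>k\<close> stay in
  \<open>{m..n}\<close>, so compression to the block respects products.\<close>

lemma block_mat_mult: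
  assumes W: "csubs W" and M: "M \<in> UM W X" and N: "N \<in> UM V W" and v: "\<And>k. v k \<in> V k" and j: "m \<le> j"
  shows "(\<Sum>k\<in>{m..n}. mat_mult V M N j k (v k)) = (\<Sum>i\<in>{m..n}. M j i (\<Sum>k\<in>{m..n}. N i k (v k)))"
proof -
  interpret W: csubs W by fact
  have "(\<Sum>k\<in>{m..n}. mat_mult V M N j k (v k)) = (\<Sum>k\<in>{m..n}. \<Sum>i\<in>{m..n}. M j i (N i k (v k)))"
  proof (rule sum.cong[OF refl])
    fix k assume "k \<in> {m..n}"
    then show "mat_mult V M N j k (v k) = (\<Sum>i\<in>{m..n}. M j i (N i k (v k)))"
      using j by (intro mat_mult_eq_sum[OF W M N v]) auto
  qed
  also have "\<dots> = (\<Sum>i\<in>{m..n}. \<Sum>k\<in>{m..n}. M j i (N i k (v k)))"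
    by (rule sum.swap)
  also have "\<dots> = (\<Sum>i\<in>{m..n}. M j i (\<Sum>k\<in>{m..n}. N i k (v k)))"
    by (rule sum.cong[OF refl], rule W.bop_sum[OF UM_bop[OF M], symmetric]) (rule UM_mem[OF N v])
  finally show ?thesis .
qed

end

text \<open>The quadratic form of the real part of \<open>2 N - I\<close>, compressed to the block \<open>{m..n}\<close>.\<close>

definition real_part_form :: "('a :: chilbert_space, 'a) opmat \<Rightarrow> int \<Rightarrow> int \<Rightarrow> (int \<Rightarrow> 'a) \<Rightarrow> real" where
  "real_part_form N m n u = 2 * (\<Sum>j\<in>{m..n}. \<Sum>k\<in>{m..n}. Re (cinner (N j k (u k)) (u j)))
     - (\<Sum>k\<in>{m..n}. (norm (u k))\<^sup>2)"

theorem (in csubs) block_contractive_iff_real_part: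
  assumes H: "H \<in> UM V Y" and C: "C \<in> UM V V" "strictly_upper V C"
  shows "block_contractive V (mat_mult V H (mat_diff V (mat_id V) C)) C \<longleftrightarrow>
    (\<forall>m n u. (\<forall>k. u k \<in> V k) \<longrightarrow>
      (\<Sum>j\<in>{m..n}. (norm (\<Sum>k\<in>{m..n}. H j k (u k)))\<^sup>2) \<le> real_part_form (resolvent C) m n u)"
    (is "block_contractive V ?Z C \<longleftrightarrow> ?R")
proof -
  define A where "A = mat_diff V (mat_id V) C"
  have A: "A \<in> UM V V"
    unfolding A_def by (rule mat_diff_mem_UM[OF csubs_self csubs_self mat_id_mem_UM C(1)])
  note N = resolvent(2)[OF C]
  have A_sum: "(\<Sum>k\<in>{m..n}. A j k (w k)) = w j - (\<Sum>k\<in>{m..n}. C j k (w k))"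
    if "j \<in> {m..n}" "\<forall>k. w k \<in> V k" for m n j w
  proof -
    have "(\<Sum>k\<in>{m..n}. A j k (w k)) = (\<Sum>k\<in>{m..n}. if j = k then w k else 0) - (\<Sum>k\<in>{m..n}. C j k (w k))"
      using that by (simp add: A_def mat_diff_apply mat_id_apply sum_subtractf)
    then show ?thesis using that(1) by simp
  qed
  have id_sum: "(\<Sum>k\<in>{m..n}. mat_id V j k (w k)) = w j" if "j \<in> {m..n}" "\<forall>k. w k \<in> V k" for m n j w
    using that by (simp add: mat_id_apply)
  \<comment> \<open>On the block \<open>u = (I - C) w\<close>, hence \<open>C w = w - u\<close>, and
    expanding the square gives \<open>(norm (w j))\<^sup>2 - (norm (w j - u j))\<^sup>2 = 2 * Re
    (cinner (w j) (u j)) - (norm (u j))\<^sup>2\<close>. With \<open>w\<close> expressed through the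
    resolvent, the right side sums to the form.\<close>
  have main: "(\<Sum>j\<in>{m..n}. (norm (\<Sum>k\<in>{m..n}. ?Z j k (w k)))\<^sup>2 + (norm (\<Sum>k\<in>{m..n}. C j k (w k)))\<^sup>2)
        \<le> (\<Sum>k\<in>{m..n}. (norm (w k))\<^sup>2) \<longleftrightarrow>
      (\<Sum>j\<in>{m..n}. (norm (\<Sum>k\<in>{m..n}. H j k (u k)))\<^sup>2) \<le> real_part_form (resolvent C) m n u"
    if w: "\<forall>k. w k \<in> V k" and u: "\<And>j. j \<in> {m..n} \<Longrightarrow> u j = w j - (\<Sum>k\<in>{m..n}. C j k (w k))"
      and wu: "\<And>j. j \<in> {m..n} \<Longrightarrow> w j = (\<Sum>k\<in>{m..n}. resolvent C j k (u k))" for m n u w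
  proof -
    have Z: "(\<Sum>k\<in>{m..n}. ?Z j k (w k)) = (\<Sum>k\<in>{m..n}. H j k (u k))" if "j \<in> {m..n}" for j
      unfolding A_def[symmetric] using that w
      by (subst block_mat_mult[OF csubs_self H A]) (auto simp: A_sum u)
    have "real_part_form (resolvent C) m n u = (\<Sum>j\<in>{m..n}. 2 * Re (cinner (w j) (u j)) - (norm (u j))\<^sup>2)"
      by (simp add: real_part_form_def sum_subtractf sum_distrib_left wu cinner.sum_left)
    also have "\<dots> = (\<Sum>j\<in>{m..n}. (norm (w j))\<^sup>2 - (norm (\<Sum>k\<in>{m..n}. C j k (w k)))\<^sup>2)"
      by (rule sum.cong) (simp_all add: u norm_diff_sq cinner.diff_right flip: norm_sq_Re)
    finally show ?thesis
      by (simp add: sum_subtractf sum.distrib Z) argo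
  qed
  show ?thesis
  proof
    assume bc: "block_contractive V ?Z C"
    show ?R
    proof (intro allI impI)
      fix m n u assume u: "\<forall>k. u k \<in> V k"
      define w where "w j = (\<Sum>k\<in>{m..n}. resolvent C j k (u k))" for j
      have w: "\<forall>k. w k \<in> V k"
        unfolding w_def using u by (auto intro!: sum_mem UM_mem[OF N])
      have "(\<Sum>k\<in>{m..n}. A j k (w k)) = u j" if "j \<in> {m..n}" for j
        using block_mat_mult[OF csubs_self A N, of u m j n] that u
        by (simp add: A_def resolvent(4)[OF C] id_sum w_def)
      then have "u j = w j - (\<Sum>k\<in>{m..n}. C j k (w k))" if "j \<in> {m..n}" for j
        using A_sum[OF that w] that by simp
      from main[OF w this w_def]
      show "(\<Sum>j\<in>{m..n}. (norm (\<Sum>k\<in>{m..n}. H j k (u k)))\<^sup>2) \<le> real_part_form (resolvent C) m n u"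
        using bc w unfolding block_contractive_def by blast
    qed
  next
    assume R: ?R
    show "block_contractive V ?Z C"
      unfolding block_contractive_def
    proof (intro allI impI)
      fix m n w assume w: "\<forall>k. w k \<in> V k"
      define u where "u j = w j - (\<Sum>k\<in>{m..n}. C j k (w k))" for j
      have u: "\<forall>k. u k \<in> V k"
        unfolding u_def using w by (auto intro!: diff_mem sum_mem UM_mem[OF C(1)])
      have "w j = (\<Sum>k\<in>{m..n}. resolvent C j k (u k))" if "j \<in> {m..n}" for j
        using block_mat_mult[OF csubs_self N A, of w m j n] that w
        by (simp add: A_def[symmetric] A_sum u_def id_sum resolvent(5)[OF C, folded A_def])
      from main[OF w u_def this]
      show "(\<Sum>j\<in>{m..n}. (norm (\<Sum>k\<in>{m..n}. ?Z j k (w k)))\<^sup>2 + (norm (\<Sum>k\<in>{m..n}. C j k (w k)))\<^sup>2)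
          \<le> (\<Sum>k\<in>{m..n}. (norm (w k))\<^sup>2)"
        using R u by blast
    qed
  qed
qed

section \<open>The correspondence of resolvents\<close>

lemma csub_UNIV: "csub (UNIV :: 'a :: chilbert_space set)"
  by standard (simp add: closed_csubspace_def)

text \<open>Cauchy-Schwarz for a nonnegative 2 by 2 form that may be degenerate. The phase of
  \<open>c\<close> is chosen to make \<open>c * s\<close> real, which leaves a real quadratic in
  \<open>t\<close>.\<close>

lemma cmod_le_if_form_nonneg:
  assumes nonneg: "\<And>c. 0 \<le> (cmod c)\<^sup>2 * a\<^sup>2 + b\<^sup>2 + 2 * Re (c * s)" and ab: "a \<ge> 0" "b \<ge> 0"
  shows "cmod s \<le> a * b"
proof (cases "s = 0")
  case False
  define \<sigma> where "\<sigma> = cmod s"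
  have \<sigma>: "\<sigma> > 0" using False by (simp add: \<sigma>_def)
  have quad: "0 \<le> t\<^sup>2 * a\<^sup>2 + b\<^sup>2 - 2 * t * \<sigma>" for t :: real
  proof -
    define c where "c = - (complex_of_real (t / \<sigma>) * cnj s)"
    have "(cmod c)\<^sup>2 = t\<^sup>2"
      using \<sigma> by (simp add: c_def norm_mult norm_divide power_mult_distrib power_divide flip: \<sigma>_def)
    moreover have "c * s = - complex_of_real (t / \<sigma> * \<sigma>\<^sup>2)"
      using complex_norm_square[of s] by (simp add: c_def \<sigma>_def ac_simps)
    then have "Re (c * s) = - (t / \<sigma> * \<sigma>\<^sup>2)"
      by (metis Re_complex_of_real of_real_minus)
    then have "Re (c * s) = - (t * \<sigma>)"
      using \<sigma> by (simp add: power2_eq_square)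
    ultimately show ?thesis
      using nonneg[of c] by simp
  qed
  show ?thesis
  proof (cases "b = 0")
    case True
    \<comment> \<open>Without the constant term a small positive \<open>t\<close> already
      contradicts nonnegativity; \<open>a\<^sup>2 + 1\<close> avoids dividing by zero.\<close>
    have "2 * (a\<^sup>2 + 1) * \<sigma>\<^sup>2 \<le> a\<^sup>2 * \<sigma>\<^sup>2"
      using quad[of "\<sigma> / (a\<^sup>2 + 1)"] True sum_power2_gt_zero_iff[of a 1]
      by (simp add: power_divide divide_simps power2_eq_square[of "a\<^sup>2 + 1"] split: if_splits)
        (simp add: power2_eq_square algebra_simps)
    then have "2 * (a\<^sup>2 + 1) \<le> a\<^sup>2"
      using \<sigma> by (simp add: mult_le_cancel_right)
    then have "a\<^sup>2 + 2 \<le> 0"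
      by (simp add: algebra_simps)
    moreover have "a\<^sup>2 + 2 > 0"
      by (rule add_nonneg_pos) simp_all
    ultimately show ?thesis by simp
  next
    case False
    \<comment> \<open>The choice \<open>t = b\<^sup>2 / \<sigma>\<close> makes the linear term
      \<open>- 2 * b\<^sup>2\<close>. Unlike the minimiser \<open>\<sigma> / a\<^sup>2\<close> it
      makes sense for \<open>a = 0\<close>.\<close>
    have "(b\<^sup>2 / \<sigma>)\<^sup>2 * a\<^sup>2 = b\<^sup>2 * ((a * b)\<^sup>2 / \<sigma>\<^sup>2)"
      by (simp add: power2_eq_square)
    moreover have "2 * (b\<^sup>2 / \<sigma>) * \<sigma> = 2 * b\<^sup>2"
      using \<sigma> by simp
    ultimately have "b\<^sup>2 * 1 \<le> b\<^sup>2 * ((a * b)\<^sup>2 / \<sigma>\<^sup>2)"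
      using quad[of "b\<^sup>2 / \<sigma>"] by linarith
    moreover have "b\<^sup>2 > 0"
      using False by simp
    ultimately have "1 \<le> (a * b)\<^sup>2 / \<sigma>\<^sup>2"
      using mult_le_cancel_left_pos by blast
    then have "\<sigma>\<^sup>2 \<le> (a * b)\<^sup>2"
      using \<sigma> by (simp add: le_divide_eq)
    then show ?thesis
      unfolding \<sigma>_def by (rule power2_le_imp_le) (use ab in simp)
  qed
qed (use ab in simp)

text \<open>Folds a Gram sum onto its upper triangle, the only place where resolvents have entries;
  the diagonal is counted twice and is subtracted once.\<close>

lemma sum_sum_symmetric:
  fixes s :: "int \<Rightarrow> int \<Rightarrow> real"
  assumes "finite I" "\<And>j k. s j k = s k j"
  shows "(\<Sum>j\<in>I. \<Sum>k\<in>I. s j k) = 2 * (\<Sum>j\<in>I. \<Sum>k\<in>I. if j \<le> k then s j k else 0) - (\<Sum>j\<in>I. s j j)"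
proof -
  have "(\<Sum>j\<in>I. \<Sum>k\<in>I. s j k) = (\<Sum>j\<in>I. \<Sum>k\<in>I. (if j \<le> k then s j k else 0)
      + (if k \<le> j then s k j else 0) - (if j = k then s j j else 0))"
    by (intro sum.cong refl) (auto simp: assms(2))
  also have "\<dots> = (\<Sum>j\<in>I. \<Sum>k\<in>I. if j \<le> k then s j k else 0)
      + (\<Sum>j\<in>I. \<Sum>k\<in>I. if k \<le> j then s k j else 0) - (\<Sum>j\<in>I. s j j)"
    using assms(1) by (simp add: sum.distrib sum_subtractf)
  also have "(\<Sum>j\<in>I. \<Sum>k\<in>I. if k \<le> j then s k j else 0) = (\<Sum>j\<in>I. \<Sum>k\<in>I. if j \<le> k then s j k else 0)"
    by (rule sum.swap)
  finally show ?thesis by simp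
qed

section \<open>Column defects and linked resolvents\<close>

locale UM2_ball_matrix = U: csubs U + Y: csubs Y
  for U :: "int \<Rightarrow> 'u :: chilbert_space set" and Y :: "int \<Rightarrow> 'y :: chilbert_space set" +
  fixes H :: "('u, 'y) opmat"
  assumes H_ball: "H \<in> UM2_ball U Y"
begin

lemma H_UM: "H \<in> UM U Y"
  using H_ball by (simp add: UM2_ball_def)

abbreviation "col \<equiv> column_op U H"
abbreviation "D \<equiv> col_defect U Y H"
abbreviation "\<D> \<equiv> defect_space U Y H"

lemma coord_col:
  assumes x: "x \<in> U k"
  shows "coord (col k x) j = H j k x" and "norm (col k x) \<le> norm x"
proof -
  have sm: "(\<lambda>j. (norm (H j k x))\<^sup>2) summable_on {..k}" "(\<Sum>\<^sub>\<infinity>j\<in>{..k}. (norm (H j k x))\<^sup>2) \<le> (norm x)\<^sup>2"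
    using H_ball x by (auto simp: UM2_ball_def)
  have "((\<lambda>j. (norm (H j k x))\<^sup>2) has_sum (\<Sum>\<^sub>\<infinity>j\<in>{..k}. (norm (H j k x))\<^sup>2)) {..k}"
    by (rule has_sum_infsum[OF sm(1)])
  then have hs: "((\<lambda>j. (norm (H j k x))\<^sup>2) has_sum (\<Sum>\<^sub>\<infinity>j\<in>{..k}. (norm (H j k x))\<^sup>2)) UNIV"
    by (rule has_sum_cong_neutral[THEN iffD1, rotated -1]) (use x in \<open>auto simp: UM_zero[OF H_UM]\<close>)
  then have c: "coord (Abs_ell2 (\<lambda>j. H j k x)) = (\<lambda>j. H j k x)"
    by (intro Abs_ell2_inverse) (auto simp: summable_on_def)
  then show "coord (col k x) j = H j k x"
    using x by (simp add: column_op_def)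
  have "(norm (col k x))\<^sup>2 \<le> (norm x)\<^sup>2"
    using x c infsumI[OF hs] sm(2) by (simp add: column_op_def norm_ell2_sq)
  then show "norm (col k x) \<le> norm x"
    by simp
qed

lemma col_contraction: "col k \<in> contractions (U k) (hdsum Y)"
proof -
  have "restrict (col k) (U k) \<in> bop (U k) (hdsum Y)"
  proof (rule bop_restrictI[where B = 1])
    show "col k x \<in> hdsum Y" if "x \<in> U k" for x
      using that by (simp add: hdsum_def coord_col UM_mem[OF H_UM])
    show "col k (x + y) = col k x + col k y" if "x \<in> U k" "y \<in> U k" for x y
      using that by (intro ell2_eqI) (simp add: coord_col coord_plus UM_add[OF H_UM] U.mem)
    show "col k (c *\<^sub>C x) = c *\<^sub>C col k x" if "x \<in> U k" for c x
      using that by (intro ell2_eqI) (simp add: coord_col coord_scaleC bop_scaleC[OF UM_bop[OF H_UM]] U.mem)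
  qed (use U.csub coord_col in auto)
  moreover have "restrict (col k) (U k) = col k"
    by (simp add: column_op_def)
  ultimately show ?thesis
    using coord_col(2) by (simp add: contractions_def)
qed

lemma col_bop: "col k \<in> bop (U k) (hdsum Y)"
  using col_contraction by (simp add: contractions_def)

lemma D_bop: "D k \<in> bop (U k) (U k)"
  unfolding col_defect_def by (rule defect_bop[OF U.csub Y.csub_hdsum col_contraction])

lemma D_symmetric: "x \<in> U k \<Longrightarrow> y \<in> U k \<Longrightarrow> cinner (D k x) y = cinner x (D k y)"
  unfolding col_defect_def by (rule defect_symmetric[OF U.csub Y.csub_hdsum col_contraction])

lemma D_cinner: "x \<in> U k \<Longrightarrow> y \<in> U k \<Longrightarrow> cinner (D k x) (D k y) = cinner x y - cinner (col k x) (col k y)"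
  unfolding col_defect_def by (rule defect_cinner[OF U.csub Y.csub_hdsum col_contraction])

lemma D_norm_sq: "x \<in> U k \<Longrightarrow> (norm (D k x))\<^sup>2 = (norm x)\<^sup>2 - (norm (col k x))\<^sup>2"
  by (simp add: norm_sq_Re D_cinner)

lemma D_norm_le: "x \<in> U k \<Longrightarrow> norm (D k x) \<le> norm x"
  by (rule power2_le_imp_le) (simp_all add: D_norm_sq)

sublocale DD: csubs \<D>
  by standard (unfold defect_space_def, rule csub.closed_csubspace[OF U.csub_closure_image[OF D_bop]])

lemma D_mem_defect_space: "x \<in> U k \<Longrightarrow> D k x \<in> \<D> k"
  unfolding defect_space_def by (rule subsetD[OF closure_subset imageI])

lemma defect_space_subset: "\<D> k \<subseteq> U k"
  unfolding defect_space_def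
  by (rule closure_minimal) (use bop_mem[OF D_bop] U.closed in auto)

lemma D_bop_defect_space: "D k \<in> bop (U k) (\<D> k)"
  using D_bop[of k] D_mem_defect_space by (auto simp: bop_def)

text \<open>The range of \<open>D j\<close> is dense in \<open>\<D> j\<close>, so it suffices to
  test with vectors \<open>D j y\<close>.\<close>

lemma defect_space_eqI:
  assumes "a \<in> \<D> j" "b \<in> \<D> j" "\<And>y. y \<in> U j \<Longrightarrow> cinner a (D j y) = cinner b (D j y)"
  shows "a = b"
proof -
  have "closed {z. cinner (a - b) z = 0}"
    by (intro closed_Collect_eq continuous_on_const
        linear_continuous_on[OF cinner.bounded_linear_right])
  then have "\<D> j \<subseteq> {z. cinner (a - b) z = 0}"
    unfolding defect_space_def using assms(3)
    by (intro closure_minimal) (auto simp: cinner.diff_left)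
  then have "cinner (a - b) (a - b) = 0"
    using DD.diff_mem[OF assms(1,2)] by blast
  then show ?thesis
    using cinner_eq_self_zeroD by fastforce
qed

text \<open>The identity \<open>N\<^sub>j\<^sub>k = D\<^sub>j M\<^sub>j\<^sub>k D\<^sub>k + H\<^sub>j\<^sup>* H\<^sub>k\<close> in weak form, which avoids adjoints and needs \<open>M\<close> only on
  the dense ranges of the defect operators.\<close>

definition linked :: "('u, 'u) opmat \<Rightarrow> ('u, 'u) opmat \<Rightarrow> bool" where
  "linked N M \<longleftrightarrow> (\<forall>j k. j \<le> k \<longrightarrow> (\<forall>x\<in>U k. \<forall>y\<in>U j.
     cinner (N j k x) y = cinner (M j k (D k x)) (D j y) + cinner (col k x) (col j y)))"

lemma linkedD:
  "linked N M \<Longrightarrow> j \<le> k \<Longrightarrow> x \<in> U k \<Longrightarrow> y \<in> U j \<Longrightarrow>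
    cinner (N j k x) y = cinner (M j k (D k x)) (D j y) + cinner (col k x) (col j y)"
  by (simp add: linked_def)

lemma linked_unique_right:
  assumes "linked N M" "linked N M'" "M \<in> UM \<D> \<D>" "M' \<in> UM \<D> \<D>"
  shows "M = M'"
proof (rule UM_eqI[OF assms(3,4)])
  fix j k :: int and z assume jk: "j \<le> k" and z: "z \<in> \<D> k"
  have eq: "M j k (D k x) = M' j k (D k x)" if x: "x \<in> U k" for x
  proof (rule defect_space_eqI)
    show "cinner (M j k (D k x)) (D j y) = cinner (M' j k (D k x)) (D j y)" if "y \<in> U j" for y
      using linkedD[OF assms(1) jk x that] linkedD[OF assms(2) jk x that] by simp
  qed (use x assms D_mem_defect_space UM_mem in blast)+
  show "M j k z = M' j k z"
  proof (rule bop_eq_on_closure[where T = "M j k" and T' = "M' j k" and S = "D k ` U k"])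
    show "csub (closure (D k ` U k))"
      by (rule U.csub_closure_image[OF D_bop])
    show "M j k \<in> bop (closure (D k ` U k)) (\<D> j)" "M' j k \<in> bop (closure (D k ` U k)) (\<D> j)"
      using UM_bop[OF assms(3), of j k] UM_bop[OF assms(4), of j k] by (simp_all add: defect_space_def)
  qed (use eq z in \<open>auto simp: defect_space_def\<close>)
qed

lemma linked_unique_left:
  assumes "linked N M" "linked N' M" "N \<in> UM U U" "N' \<in> UM U U"
  shows "N = N'"
proof (rule UM_eqI[OF assms(3,4)])
  fix j k :: int and x assume jk: "j \<le> k" and x: "x \<in> U k"
  show "N j k x = N' j k x"
  proof (rule U.eq_by_cinner)
    show "cinner y (N j k x) = cinner y (N' j k x)" if "y \<in> U j" for y
      using linkedD[OF assms(1) jk x that] linkedD[OF assms(2) jk x that]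
        cinner_commute[of y "N j k x"] cinner_commute[of y "N' j k x"] by simp
  qed (use UM_mem[OF assms(3) x] UM_mem[OF assms(4) x] in auto)
qed

text \<open>Doubling the upper Gram terms contributed by \<open>linked\<close> yields the full Gram
  sum plus its diagonal. The Gram sum is the squared norm on the left, and by
  \<open>D_norm_sq\<close> the diagonal accounts for the passage from \<open>norm (u k)\<close> to
  \<open>norm (D k (u k))\<close>.\<close>

lemma real_part_form_linked:
  assumes link: "linked N M" and N: "unitriangular U N" and M: "unitriangular \<D> M" and u: "\<And>k. u k \<in> U k"
  shows "real_part_form N m n u - (norm (\<Sum>k\<in>{m..n}. col k (u k)))\<^sup>2 = real_part_form M m n (\<lambda>k. D k (u k))"
proof -
  define I where "I = {m..n}"
  define s where "s j k = Re (cinner (col k (u k)) (col j (u j)))" for j k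
  have "Re (cinner (N j k (u k)) (u j)) = Re (cinner (M j k (D k (u k))) (D j (u j))) + (if j \<le> k then s j k else 0)" for j k
  proof (cases "j \<le> k")
    case True
    then show ?thesis using linkedD[OF link True u u] by (simp add: s_def)
  next
    case False
    then have "N j k (u k) = 0" "M j k (D k (u k)) = 0"
      using N M u D_mem_defect_space[OF u] by (auto simp: unitriangular_def UM_zero)
    then show ?thesis using False by simp
  qed
  then have 1: "(\<Sum>j\<in>I. \<Sum>k\<in>I. Re (cinner (N j k (u k)) (u j)))
      = (\<Sum>j\<in>I. \<Sum>k\<in>I. Re (cinner (M j k (D k (u k))) (D j (u j)))) + (\<Sum>j\<in>I. \<Sum>k\<in>I. if j \<le> k then s j k else 0)"
    by (simp add: sum.distrib)
  have "(norm (\<Sum>k\<in>I. col k (u k)))\<^sup>2 = (\<Sum>j\<in>I. \<Sum>k\<in>I. s j k)"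
    by (simp add: norm_sq_Re cinner.sum_left cinner.sum_right s_def)
  also have "\<dots> = 2 * (\<Sum>j\<in>I. \<Sum>k\<in>I. if j \<le> k then s j k else 0) - (\<Sum>j\<in>I. s j j)"
    by (rule sum_sum_symmetric) (auto simp: I_def s_def Re_cinner_commute)
  finally have 2: "(norm (\<Sum>k\<in>I. col k (u k)))\<^sup>2 = 2 * (\<Sum>j\<in>I. \<Sum>k\<in>I. if j \<le> k then s j k else 0) - (\<Sum>j\<in>I. s j j)" .
  have 3: "(\<Sum>k\<in>I. (norm (D k (u k)))\<^sup>2) = (\<Sum>k\<in>I. (norm (u k))\<^sup>2) - (\<Sum>j\<in>I. s j j)"
    unfolding D_norm_sq[OF u] s_def norm_sq_Re[symmetric] by (rule sum_subtractf)
  show ?thesis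
    unfolding real_part_form_def I_def[symmetric] 1 2 3 by simp
qed

text \<open>In this direction the link is a formula for \<open>N\<close>, and its diagonal is
  \<open>D\<^sub>k\<^sup>2 + H\<^sub>k\<^sup>* H\<^sub>k = I\<close>.\<close>

lemma exists_linked_left:
  assumes M: "unitriangular \<D> M"
  obtains N where "unitriangular U N" "linked N M"
proof -
  have M_UM: "M \<in> UM \<D> \<D>"
    using M by (simp add: unitriangular_def)
  define S where "S j = adjoint_op (U j) (hdsum Y) (col j)" for j
  have S: "S j \<in> bop (hdsum Y) (U j)" for j
    unfolding S_def by (rule bop_adjoint(1)[OF U.csub Y.csub_hdsum col_bop])
  have S_cinner: "cinner (S j z) y = cinner z (col j y)" if "z \<in> hdsum Y" "y \<in> U j" for j y z
    using bop_adjoint(2)[OF U.csub Y.csub_hdsum col_bop that(2,1)]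
    by (metis S_def cinner_commute)
  have D_sub: "D j \<in> bop (U j) (U j)" "restrict (D j) (\<D> j) \<in> bop (\<D> j) (U j)" for j
  proof -
    show "D j \<in> bop (U j) (U j)" by (rule D_bop)
    show "restrict (D j) (\<D> j) \<in> bop (\<D> j) (U j)"
      by (rule bop_restrictI[OF DD.csub, where B = 1])
        (use defect_space_subset[of j] D_norm_le in \<open>auto simp: bop_mem[OF D_bop] bop_add[OF D_bop] bop_scaleC[OF D_bop] subset_iff\<close>)
  qed
  define N where "N j k = (\<lambda>x\<in>U k. if j \<le> k then D j (M j k (D k x)) + S j (col k x) else 0)" for j k
  have M_mem: "M j k (D k x) \<in> \<D> j" if "x \<in> U k" for j k x
    by (rule UM_mem[OF M_UM D_mem_defect_space[OF that]])
  have N_bop: "N j k \<in> bop (U k) (U j)" for j k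
  proof (cases "j \<le> k")
    case True
    have "(\<lambda>x\<in>U k. (\<lambda>x\<in>U k. restrict (D j) (\<D> j) ((\<lambda>x\<in>U k. M j k (D k x)) x)) x + (\<lambda>x\<in>U k. S j (col k x)) x) \<in> bop (U k) (U j)"
      by (rule U.bop_restrict_add[OF U.bop_compose[OF U.bop_compose[OF D_bop_defect_space UM_bop[OF M_UM]] D_sub(2)]
            U.bop_compose[OF col_bop S] U.csub])
    moreover have "(\<lambda>x\<in>U k. (\<lambda>x\<in>U k. restrict (D j) (\<D> j) ((\<lambda>x\<in>U k. M j k (D k x)) x)) x + (\<lambda>x\<in>U k. S j (col k x)) x) = N j k"
      using True by (auto simp: N_def M_mem)
    ultimately show ?thesis by (simp only:)
  next
    case False
    then show ?thesis by (simp add: N_def U.bop_restrict_zero U.csub)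
  qed
  have N_cinner: "cinner (N j k x) y = cinner (M j k (D k x)) (D j y) + cinner (col k x) (col j y)"
    if "j \<le> k" "x \<in> U k" "y \<in> U j" for j k x y
    using that M_mem[OF that(2), of j] defect_space_subset[of j]
    by (simp add: N_def cinner_add_left S_cinner bop_mem[OF col_bop] D_symmetric subset_iff)
  have "N k k x = x" if x: "x \<in> U k" for k x
  proof (rule U.eq_by_cinner)
    show "N k k x \<in> U k" by (rule bop_mem[OF N_bop x])
    have M_diag: "M k k (D k x) = D k x"
      using M D_mem_defect_space[OF x] by (simp add: unitriangular_def)
    show "cinner y (N k k x) = cinner y x" if "y \<in> U k" for y
      using N_cinner[of k k x y] x that D_cinner[OF x that] M_diag
        cinner_commute[of y "N k k x"] cinner_commute[of y x] by simp
  qed (rule x)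
  then have "unitriangular U N"
    using N_bop by (simp add: unitriangular_def UM_def) (simp add: N_def)
  moreover have "linked N M"
    unfolding linked_def using N_cinner by blast
  ultimately show thesis by (rule that)
qed

text \<open>Evaluates the form at vectors supported on \<open>{j, k}\<close>: subtracting the
  columns turns the diagonal into squared defect norms and leaves one kernel entry as mixed term.
  Scaling \<open>x\<close> by \<open>c\<close> gives access to its phase and size.\<close>

lemma form_bound:
  assumes N: "unitriangular U N"
    and pos: "\<And>m n u. (\<forall>k. u k \<in> U k) \<Longrightarrow> (norm (\<Sum>k\<in>{m..n}. col k (u k)))\<^sup>2 \<le> real_part_form N m n u"
    and jk: "j < k" and x: "x \<in> U k" and y: "y \<in> U j"
  shows "cmod (cinner (N j k x) y - cinner (col k x) (col j y)) \<le> norm (D k x) * norm (D j y)"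
proof (rule cmod_le_if_form_nonneg)
  have N_UM: "N \<in> UM U U" and N_diag: "\<And>k u. u \<in> U k \<Longrightarrow> N k k u = u"
    using N by (auto simp: unitriangular_def)
  fix c
  define x' where "x' = c *\<^sub>C x"
  have x': "x' \<in> U k" unfolding x'_def by (rule U.scaleC_mem[OF x])
  define u where "u i = (if i = k then x' else if i = j then y else 0)" for i
  have u: "u i \<in> U i" for i
    using x' y by (simp add: u_def)
  have sum_jk: "sum g {j..k} = g j + g k" if "\<And>i. i \<noteq> j \<Longrightarrow> i \<noteq> k \<Longrightarrow> g i = 0" for g :: "int \<Rightarrow> 'z :: comm_monoid_add"
  proof -
    have "sum g {j..k} = sum g {j, k}"
      by (rule sum.mono_neutral_right) (use jk that in auto)
    then show ?thesis using jk by simp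
  qed
  have uj: "u j = y" and uk: "u k = x'" and u0: "\<And>i. i \<noteq> j \<Longrightarrow> i \<noteq> k \<Longrightarrow> u i = 0"
    using jk by (auto simp: u_def)
  have "N k j y = 0"
    by (rule UM_zero[OF N_UM jk y])
  then have "real_part_form N j k u = (norm y)\<^sup>2 + (norm x')\<^sup>2 + 2 * Re (cinner (N j k x') y)"
    unfolding real_part_form_def
    by (simp add: sum_jk u0 uj uk U.UM_zero_right[OF N_UM] N_diag x' y norm_sq_Re)
  moreover have "(\<Sum>i\<in>{j..k}. col i (u i)) = col j y + col k x'"
    by (subst sum_jk) (simp_all add: u0 uj uk U.bop_zero[OF col_bop])
  ultimately have "(norm (col j y + col k x'))\<^sup>2 \<le> (norm y)\<^sup>2 + (norm x')\<^sup>2 + 2 * Re (cinner (N j k x') y)"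
    using pos[of u j k] u by simp
  then have "0 \<le> (norm (D k x'))\<^sup>2 + (norm (D j y))\<^sup>2 + 2 * Re (cinner (N j k x') y - cinner (col k x') (col j y))"
    using x' y by (simp add: norm_add_sq D_norm_sq Re_cinner_commute[of "col j y"])
  then show "0 \<le> (cmod c)\<^sup>2 * (norm (D k x))\<^sup>2 + (norm (D j y))\<^sup>2
      + 2 * Re (c * (cinner (N j k x) y - cinner (col k x) (col j y)))"
    by (simp add: x'_def bop_scaleC[OF D_bop x] bop_scaleC[OF col_bop x] bop_scaleC[OF UM_bop[OF N_UM] x]
        norm_scaleC power_mult_distrib cinner_scaleC_left algebra_simps)
qed simp_all

text \<open>The kernel entry is a sesquilinear form bounded by the two defect norms, and it is
  factored one variable at a time. For fixed \<open>x\<close> it descends to a functional on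
  \<open>\<D> j\<close>, whose Riesz vector \<open>g x\<close> has norm at most
  \<open>norm (D k x)\<close>; then \<open>g\<close> itself factors through
  \<open>D k\<close>.\<close>

lemma exists_factor:
  assumes N: "unitriangular U N"
    and pos: "\<And>m n u. (\<forall>k. u k \<in> U k) \<Longrightarrow> (norm (\<Sum>k\<in>{m..n}. col k (u k)))\<^sup>2 \<le> real_part_form N m n u"
    and jk: "j < k"
  shows "\<exists>B. B \<in> bop (\<D> k) (\<D> j) \<and> (\<forall>x\<in>U k. \<forall>y\<in>U j.
    cinner (N j k x) y = cinner (B (D k x)) (D j y) + cinner (col k x) (col j y))"
proof -
  have N_bop: "N j k \<in> bop (U k) (U j)"
    using N by (simp add: unitriangular_def UM_bop)
  define s where "s x y = cinner (N j k x) y - cinner (col k x) (col j y)" for x y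
  have s_le: "cmod (s x y) \<le> norm (D k x) * norm (D j y)" if "x \<in> U k" "y \<in> U j" for x y
    unfolding s_def by (rule form_bound[OF N pos jk that])
  have "\<exists>g\<in>\<D> j. norm g \<le> norm (D k x) \<and> (\<forall>y\<in>U j. s x y = cinner g (D j y))" if x: "x \<in> U k" for x
  proof -
    \<comment> \<open>The conjugate makes the functional linear, as \<open>cinner\<close> is
      conjugate-linear in its second argument.\<close>
    define \<phi> where "\<phi> = (\<lambda>y\<in>U j. cnj (s x y))"
    have \<phi>_bop: "\<phi> \<in> bop (U j) UNIV"
      unfolding \<phi>_def
    proof (rule bop_restrictI[OF U.csub, where B = "norm (D k x)"])
      show "cnj (s x (y + z)) = cnj (s x y) + cnj (s x z)" if "y \<in> U j" "z \<in> U j" for y z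
        using that by (simp add: s_def cinner_add_right bop_add[OF col_bop])
      show "cnj (s x (c *\<^sub>C y)) = c *\<^sub>C cnj (s x y)" if "y \<in> U j" for c y
        using that by (simp add: s_def cinner_scaleC_right bop_scaleC[OF col_bop] scaleC_complex_def algebra_simps)
      show "norm (cnj (s x y)) \<le> norm (D k x) * norm y" if "y \<in> U j" for y
        using order_trans[OF s_le[OF x that] mult_left_mono[OF D_norm_le[OF that]]] by simp
    qed simp
    have "norm (\<phi> y) \<le> norm (D k x) * norm (D j y)" if "y \<in> U j" for y
      using s_le[OF x that] that by (simp add: \<phi>_def)
    then obtain T where T: "T \<in> bop (\<D> j) UNIV" "\<And>y. y \<in> U j \<Longrightarrow> T (D j y) = \<phi> y"
      "\<And>z. z \<in> \<D> j \<Longrightarrow> norm (T z) \<le> norm (D k x) * norm z"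
      using U.bop_extension[OF D_bop \<phi>_bop csub_UNIV] unfolding defect_space_def by metis
    obtain g where g: "g \<in> \<D> j" "\<And>z. z \<in> \<D> j \<Longrightarrow> T z = cinner z g"
    proof (rule DD.riesz_representation)
      show "T (z + w) = T z + T w" if "z \<in> \<D> j" "w \<in> \<D> j" for z w
        by (rule bop_add[OF T(1) that])
      show "T (c *\<^sub>C z) = c * T z" if "z \<in> \<D> j" for c z
        using bop_scaleC[OF T(1) that] by (simp add: scaleC_complex_def)
      show "cmod (T z) \<le> norm (D k x) * norm z" if "z \<in> \<D> j" for z
        by (rule T(3)[OF that])
    qed blast
    have "s x y = cinner g (D j y)" if "y \<in> U j" for y
    proof -
      have "cnj (s x y) = cinner (D j y) g"
        using T(2)[OF that] g(2)[OF D_mem_defect_space[OF that]] that by (simp add: \<phi>_def)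
      then show ?thesis
        by (metis cinner_commute complex_cnj_cnj)
    qed
    moreover have "norm g \<le> norm (D k x)"
    proof -
      have "norm g * norm g \<le> norm (D k x) * norm g"
        using T(3)[OF g(1)] g(2)[OF g(1)] by (simp add: cinner_norm norm_power power2_eq_square norm_mult)
      then show ?thesis
        by (cases "norm g = 0") simp_all
    qed
    ultimately show ?thesis using g(1) by blast
  qed
  then obtain g where g: "\<And>x. x \<in> U k \<Longrightarrow> g x \<in> \<D> j" "\<And>x. x \<in> U k \<Longrightarrow> norm (g x) \<le> norm (D k x)"
    "\<And>x y. x \<in> U k \<Longrightarrow> y \<in> U j \<Longrightarrow> s x y = cinner (g x) (D j y)"
    by metis
  have g_bop: "restrict g (U k) \<in> bop (U k) (\<D> j)"
  proof (rule bop_restrictI[OF U.csub g(1), where B = 1])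
    show "g (x + y) = g x + g y" if xy: "x \<in> U k" "y \<in> U k" for x y
    proof (rule defect_space_eqI)
      show "cinner (g (x + y)) (D j z) = cinner (g x + g y) (D j z)" if z: "z \<in> U j" for z
        using xy z by (simp add: cinner_add_left g(3)[symmetric] U.mem s_def bop_add[OF N_bop] bop_add[OF col_bop])
    qed (use xy in \<open>auto intro: g(1) U.mem DD.add_mem\<close>)
    show "g (c *\<^sub>C x) = c *\<^sub>C g x" if x: "x \<in> U k" for c x
    proof (rule defect_space_eqI)
      show "cinner (g (c *\<^sub>C x)) (D j z) = cinner (c *\<^sub>C g x) (D j z)" if z: "z \<in> U j" for z
        using x z by (simp add: cinner_scaleC_left g(3)[symmetric] U.mem s_def bop_scaleC[OF N_bop] bop_scaleC[OF col_bop] right_diff_distrib)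
    qed (use x in \<open>auto intro: g(1) U.mem DD.scaleC_mem\<close>)
    show "norm (g x) \<le> 1 * norm x" if "x \<in> U k" for x
      using g(2)[OF that] D_norm_le[OF that] by simp
  qed
  have "norm (restrict g (U k) x) \<le> 1 * norm (D k x)" if "x \<in> U k" for x
    using g(2)[OF that] that by simp
  then obtain B where B: "B \<in> bop (\<D> k) (\<D> j)" "\<And>x. x \<in> U k \<Longrightarrow> B (D k x) = restrict g (U k) x"
    using U.bop_extension[OF D_bop g_bop DD.csub] unfolding defect_space_def by metis
  then show ?thesis
    using g(3) by (intro exI[of _ B]) (simp add: s_def algebra_simps)
qed

lemma exists_linked_right:
  assumes N: "unitriangular U N"
    and pos: "\<And>m n u. (\<forall>k. u k \<in> U k) \<Longrightarrow> (norm (\<Sum>k\<in>{m..n}. col k (u k)))\<^sup>2 \<le> real_part_form N m n u"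
  obtains M where "unitriangular \<D> M" "linked N M"
proof -
  have "\<forall>j k. \<exists>B. j < k \<longrightarrow> B \<in> bop (\<D> k) (\<D> j) \<and> (\<forall>x\<in>U k. \<forall>y\<in>U j.
      cinner (N j k x) y = cinner (B (D k x)) (D j y) + cinner (col k x) (col j y))"
    using exists_factor[OF N pos] by blast
  then obtain B where B: "\<And>j k. j < k \<Longrightarrow> B j k \<in> bop (\<D> k) (\<D> j)"
    "\<And>j k x y. j < k \<Longrightarrow> x \<in> U k \<Longrightarrow> y \<in> U j \<Longrightarrow>
      cinner (N j k x) y = cinner (B j k (D k x)) (D j y) + cinner (col k x) (col j y)"
    by metis
  \<comment> \<open>For \<open>j = k\<close> the identity is the right entry: the link then reduces
    to \<open>D_cinner\<close>.\<close>
  define M where "M j k = (if j < k then B j k else if j = k then (\<lambda>z\<in>\<D> k. z) else (\<lambda>z\<in>\<D> k. 0))" for j k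
  have "M \<in> UM \<D> \<D>"
    unfolding UM_def using B(1) by (auto simp: M_def DD.bop_restrict_id DD.bop_restrict_zero DD.csub)
  then have "unitriangular \<D> M"
    by (simp add: unitriangular_def M_def)
  moreover have "linked N M"
    unfolding linked_def
  proof (intro allI impI ballI)
    fix j k :: int and x y assume "j \<le> k" and x: "x \<in> U k" and y: "y \<in> U j"
    then consider "j < k" | "j = k" by linarith
    then show "cinner (N j k x) y = cinner (M j k (D k x)) (D j y) + cinner (col k x) (col j y)"
    proof cases
      case 1
      then show ?thesis using B(2) x y by (simp add: M_def)
    next
      case 2
      then show ?thesis
        using x y N D_cinner[of x k y] by (simp add: M_def unitriangular_def D_mem_defect_space)
    qed
  qed
  ultimately show thesis by (rule that)
qed

end

section \<open>Positivity\<close>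

context csubs begin

text \<open>Stacking a zero matrix on \<open>C\<close> expresses the contractivity of
  \<open>C\<close> alone, so the results on pairs, with \<open>H\<close> replaced by zero, apply to
  \<open>C\<close> as well.\<close>

abbreviation zero_mat :: "('a, 'a) opmat" where
  "zero_mat \<equiv> \<lambda>j k. \<lambda>u\<in>V k. 0"

lemma zero_mat_mem_UM: "zero_mat \<in> UM V V"
  by (simp add: UM_def bop_restrict_zero csub)

lemma mat_mult_zero_mat:
  assumes "A \<in> UM V V"
  shows "mat_mult V zero_mat A = zero_mat"
  by (rule UM_eqI[OF mat_mult_mem_UM[OF csubs_self csubs_self csubs_self zero_mat_mem_UM assms] zero_mat_mem_UM])
    (simp add: mat_mult_apply UM_mem[OF assms])

lemma induces_zero_mat: "induces V V zero_mat (\<lambda>u\<in>hdsum V. 0)"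
  unfolding induces_def
proof (intro conjI ballI allI)
  show "(\<lambda>u\<in>hdsum V. 0) \<in> bop (hdsum V) (hdsum V)"
    by (rule csub.bop_restrict_zero[OF csub_hdsum csub_hdsum])
qed (simp add: coord_zero hdsum_def)

lemma mem_UM_inf_ball_iff:
  assumes "C \<in> UM V V"
  shows "C \<in> UM_inf_ball V V \<longleftrightarrow> block_contractive V zero_mat C"
proof -
  have zero: "zero_mat \<in> UM_inf V V" "mat_op V V zero_mat = (\<lambda>u\<in>hdsum V. 0)"
    using induces_zero_mat mat_op_eqI[OF induces_zero_mat] zero_mat_mem_UM by (auto simp: UM_inf_def)
  have "C \<in> UM_inf_ball V V \<longleftrightarrow> C \<in> UM_inf V V \<and> (\<forall>u\<in>hdsum V. norm (mat_op V V C u) \<le> norm u)"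
  proof
    assume "C \<in> UM_inf_ball V V"
    then obtain T where T: "induces V V C T" "T \<in> contractions (hdsum V) (hdsum V)"
      by (auto simp: UM_inf_ball_def)
    then show "C \<in> UM_inf V V \<and> (\<forall>u\<in>hdsum V. norm (mat_op V V C u) \<le> norm u)"
      using assms by (auto simp: UM_inf_def contractions_def mat_op_eqI)
  next
    assume *: "C \<in> UM_inf V V \<and> (\<forall>u\<in>hdsum V. norm (mat_op V V C u) \<le> norm u)"
    then have "induces V V C (mat_op V V C)"
      by (simp add: induces_mat_op)
    moreover from this * have "mat_op V V C \<in> contractions (hdsum V) (hdsum V)"
      by (simp add: contractions_def induces_def)
    ultimately show "C \<in> UM_inf_ball V V"
      using assms by (auto simp: UM_inf_ball_def)
  qed
  also have "\<dots> \<longleftrightarrow> block_contractive V zero_mat C"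
    unfolding block_contractive_iff[OF csubs_self csubs_self zero_mat_mem_UM assms] zero(2)
    using zero(1) by (auto simp: power_mono_iff)
  finally show ?thesis .
qed

lemma mem_UM_inf_ball0_iff:
  assumes "C \<in> UM V V" "strictly_upper V C"
  shows "C \<in> UM_inf_ball0 V V \<longleftrightarrow> (\<forall>m n u. (\<forall>k. u k \<in> V k) \<longrightarrow> 0 \<le> real_part_form (resolvent C) m n u)"
proof -
  have "C \<in> UM_inf_ball0 V V \<longleftrightarrow> block_contractive V zero_mat C"
    using assms by (simp add: UM_inf_ball0_def mem_UM_inf_ball_iff)
  also have "\<dots> \<longleftrightarrow> block_contractive V (mat_mult V zero_mat (mat_diff V (mat_id V) C)) C"
    by (simp add: mat_mult_zero_mat mat_diff_mem_UM csubs_self mat_id_mem_UM assms)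
  also have "\<dots> \<longleftrightarrow> (\<forall>m n u. (\<forall>k. u k \<in> V k) \<longrightarrow> 0 \<le> real_part_form (resolvent C) m n u)"
    unfolding block_contractive_iff_real_part[OF zero_mat_mem_UM assms] by (auto)
  finally show ?thesis .
qed

end

text \<open>The correspondence arises as a relation with existence and uniqueness on both sides;
  this converts it into a map.\<close>

lemma bij_betw_if_total_functional:
  assumes "\<And>a. a \<in> A \<Longrightarrow> \<exists>b\<in>B. R a b" "\<And>b. b \<in> B \<Longrightarrow> \<exists>a\<in>A. R a b"
    and "\<And>a b b'. a \<in> A \<Longrightarrow> b \<in> B \<Longrightarrow> b' \<in> B \<Longrightarrow> R a b \<Longrightarrow> R a b' \<Longrightarrow> b = b'"
    and "\<And>a a' b. a \<in> A \<Longrightarrow> a' \<in> A \<Longrightarrow> b \<in> B \<Longrightarrow> R a b \<Longrightarrow> R a' b \<Longrightarrow> a = a'"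
  shows "\<exists>f. bij_betw f A B"
proof -
  obtain f where f: "\<And>a. a \<in> A \<Longrightarrow> f a \<in> B" "\<And>a. a \<in> A \<Longrightarrow> R a (f a)"
    using assms(1) by metis
  have "bij_betw f A B"
    unfolding bij_betw_def
  proof
    show "inj_on f A"
    proof (rule inj_onI)
      fix a a' assume a: "a \<in> A" "a' \<in> A" "f a = f a'"
      then have "R a' (f a)" using f(2)[of a'] by simp
      then show "a = a'" using assms(4)[OF a(1,2) f(1)[OF a(1)] f(2)[OF a(1)]] by blast
    qed
    show "f ` A = B"
    proof
      show "f ` A \<subseteq> B" using f(1) by blast
      show "B \<subseteq> f ` A"
      proof
        fix b assume b: "b \<in> B"
        then obtain a where a: "a \<in> A" "R a b" using assms(2) by blast
        then have "f a = b" using assms(3)[OF a(1) f(1)[OF a(1)] b f(2)[OF a(1)]] by blast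
        then show "b \<in> f ` A" using a(1) by blast
      qed
    qed
  qed
  then show ?thesis by blast
qed

context UM2_ball_matrix begin

text \<open>A block sees rows \<open>m\<close> to \<open>n\<close> only, while a column has entries
  in all rows up to its index. Padding \<open>u\<close> with zeros on indices \<open>k < m\<close>
  leaves the form unchanged and admits blocks that start earlier, and these exhaust the columns;
  rows beyond \<open>n\<close> are zero.\<close>

lemma sum_col_le_iff:
  assumes N: "N \<in> UM U U"
  shows "(\<forall>m n u. (\<forall>k. u k \<in> U k) \<longrightarrow>
      (\<Sum>j\<in>{m..n}. (norm (\<Sum>k\<in>{m..n}. H j k (u k)))\<^sup>2) \<le> real_part_form N m n u) \<longleftrightarrow>
    (\<forall>m n u. (\<forall>k. u k \<in> U k) \<longrightarrow> (norm (\<Sum>k\<in>{m..n}. col k (u k)))\<^sup>2 \<le> real_part_form N m n u)"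
    (is "?L \<longleftrightarrow> ?R")
proof
  assume R: ?R
  show ?L
  proof (intro allI impI)
    fix m n u assume u: "\<forall>k. u k \<in> U k"
    have "(\<Sum>j\<in>{m..n}. (norm (\<Sum>k\<in>{m..n}. H j k (u k)))\<^sup>2) \<le> (norm (\<Sum>k\<in>{m..n}. col k (u k)))\<^sup>2"
      using sum_norm_coord_le[of "{m..n}" "\<Sum>k\<in>{m..n}. col k (u k)"] u by (simp add: coord_sum coord_col)
    also have "\<dots> \<le> real_part_form N m n u" using R u by blast
    finally show "(\<Sum>j\<in>{m..n}. (norm (\<Sum>k\<in>{m..n}. H j k (u k)))\<^sup>2) \<le> real_part_form N m n u" .
  qed
next
  assume L: ?L
  show ?R
  proof (intro allI impI)
    fix m n u assume u: "\<forall>k. u k \<in> U k"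
    define v where "v k = (if k \<in> {m..n} then u k else 0)" for k
    have v: "\<forall>k. v k \<in> U k" using u by (simp add: v_def)
    define h where "h = (\<Sum>k\<in>{m..n}. col k (u k))"
    have h: "coord h j = (\<Sum>k\<in>{m..n}. H j k (u k))" for j
      using u by (simp add: h_def coord_sum coord_col)
    have h_zero: "coord h j = 0" if "j > n" for j
      unfolding h using that u by (intro sum.neutral) (auto simp: UM_zero[OF H_UM])
    have v_zero: "k \<notin> {m..n} \<Longrightarrow> v k = 0" and v_eq: "k \<in> {m..n} \<Longrightarrow> v k = u k" for k
      by (auto simp: v_def)
    have form: "real_part_form N m' n v = real_part_form N m n u" if m': "m' \<le> m" for m'
    proof -
      have "(\<Sum>j\<in>{m'..n}. \<Sum>k\<in>{m'..n}. Re (cinner (N j k (v k)) (v j)))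
          = (\<Sum>j\<in>{m..n}. \<Sum>k\<in>{m'..n}. Re (cinner (N j k (v k)) (v j)))"
        by (rule sum.mono_neutral_right) (use m' in \<open>auto simp: v_zero\<close>)
      also have "\<dots> = (\<Sum>j\<in>{m..n}. \<Sum>k\<in>{m..n}. Re (cinner (N j k (u k)) (u j)))"
      proof (rule sum.cong[OF refl])
        fix j assume "j \<in> {m..n}"
        then show "(\<Sum>k\<in>{m'..n}. Re (cinner (N j k (v k)) (v j))) = (\<Sum>k\<in>{m..n}. Re (cinner (N j k (u k)) (u j)))"
          by (intro sum.mono_neutral_cong_right) (use m' in \<open>auto simp: v_zero v_eq U.UM_zero_right[OF N]\<close>)
      qed
      moreover have "(\<Sum>k\<in>{m'..n}. (norm (v k))\<^sup>2) = (\<Sum>k\<in>{m..n}. (norm (u k))\<^sup>2)"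
        by (rule sum.mono_neutral_cong_right) (use m' in \<open>auto simp: v_zero v_eq\<close>)
      ultimately show ?thesis by (simp add: real_part_form_def)
    qed
    have "(norm h)\<^sup>2 \<le> real_part_form N m n u"
      unfolding norm_ell2_sq
    proof (rule infsum_le_finite_sums[OF coord_summable])
      fix J :: "int set" assume J: "finite J"
      define m' where "m' = Min (insert m J)"
      have m': "m' \<le> m" "\<And>j. j \<in> J \<Longrightarrow> m' \<le> j" using J by (auto simp: m'_def)
      have "(\<Sum>j\<in>J. (norm (coord h j))\<^sup>2) = (\<Sum>j\<in>J \<inter> {m'..n}. (norm (coord h j))\<^sup>2)"
        by (rule sum.mono_neutral_right) (use J m'(2) h_zero in \<open>force+\<close>)
      also have "\<dots> \<le> (\<Sum>j\<in>{m'..n}. (norm (coord h j))\<^sup>2)"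
        by (rule sum_mono2) auto
      also have "\<dots> = (\<Sum>j\<in>{m'..n}. (norm (\<Sum>k\<in>{m'..n}. H j k (v k)))\<^sup>2)"
      proof (rule sum.cong[OF refl])
        fix j
        have "(\<Sum>k\<in>{m'..n}. H j k (v k)) = (\<Sum>k\<in>{m..n}. H j k (u k))"
          by (rule sum.mono_neutral_cong_right) (use m'(1) in \<open>auto simp: v_zero v_eq U.UM_zero_right[OF H_UM]\<close>)
        then show "(norm (coord h j))\<^sup>2 = (norm (\<Sum>k\<in>{m'..n}. H j k (v k)))\<^sup>2"
          by (simp add: h)
      qed
      also have "\<dots> \<le> real_part_form N m' n v"
        using L v by blast
      also have "\<dots> = real_part_form N m n u" by (rule form[OF m'(1)])
      finally show "(\<Sum>j\<in>J. (norm (coord h j))\<^sup>2) \<le> real_part_form N m n u" .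
    qed
    then show "(norm (\<Sum>k\<in>{m..n}. col k (u k)))\<^sup>2 \<le> real_part_form N m n u"
      by (simp add: h_def)
  qed
qed

text \<open>Only finitely many entries of \<open>M\<close> occur, each of them continuous, and
  \<open>D k\<close> has dense range in \<open>\<D> k\<close>.\<close>

lemma real_part_form_dense:
  assumes M: "M \<in> UM \<D> \<D>"
  shows "(\<forall>m n w. (\<forall>k. w k \<in> \<D> k) \<longrightarrow> 0 \<le> real_part_form M m n w) \<longleftrightarrow>
    (\<forall>m n u. (\<forall>k. u k \<in> U k) \<longrightarrow> 0 \<le> real_part_form M m n (\<lambda>k. D k (u k)))"
    (is "?L \<longleftrightarrow> ?R")
proof
  assume ?L
  then show ?R by (simp add: D_mem_defect_space)
next
  assume R: ?R
  show ?L
  proof (intro allI impI)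
    fix m n w assume w: "\<forall>k. w k \<in> \<D> k"
    have "\<exists>f. (\<forall>i. f i \<in> U k) \<and> (\<lambda>i. D k (f i)) \<longlonglongrightarrow> w k" for k
    proof -
      have "w k \<in> closure (D k ` U k)" using w by (simp add: defect_space_def)
      then obtain h where h: "\<forall>i. h i \<in> D k ` U k" "h \<longlonglongrightarrow> w k"
        unfolding closure_sequential by blast
      then have "\<forall>i. \<exists>x. x \<in> U k \<and> h i = D k x" by blast
      then obtain f where f: "\<And>i. f i \<in> U k" "\<And>i. h i = D k (f i)" by metis
      then have "h = (\<lambda>i. D k (f i))" by blast
      then show ?thesis using f(1) h(2) by blast
    qed
    then obtain f where f: "\<And>k i. f k i \<in> U k" "\<And>k. (\<lambda>i. D k (f k i)) \<longlonglongrightarrow> w k"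
      by metis
    have M_lim: "(\<lambda>i. M j k (D k (f k i))) \<longlonglongrightarrow> M j k (w k)" for j k
      by (rule continuous_on_tendsto_compose[OF DD.bop_continuous_on[OF UM_bop[OF M]] f(2)])
        (use w D_mem_defect_space f(1) in \<open>auto intro!: always_eventually\<close>)
    have "(\<lambda>i. real_part_form M m n (\<lambda>k. D k (f k i))) \<longlonglongrightarrow> real_part_form M m n w"
      unfolding real_part_form_def by (intro tendsto_intros cinner.tendsto M_lim f(2))
    moreover have "0 \<le> real_part_form M m n (\<lambda>k. D k (f k i))" for i
      using R[rule_format, of "\<lambda>k. f k i"] f(1) by simp
    ultimately show "0 \<le> real_part_form M m n w"
      by (intro LIMSEQ_le_const) auto
  qed
qed

lemma linked_positive_iff:
  assumes link: "linked N M" and N: "unitriangular U N" and M: "unitriangular \<D> M"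
  shows "(\<forall>m n u. (\<forall>k. u k \<in> U k) \<longrightarrow>
      (\<Sum>j\<in>{m..n}. (norm (\<Sum>k\<in>{m..n}. H j k (u k)))\<^sup>2) \<le> real_part_form N m n u) \<longleftrightarrow>
    (\<forall>m n w. (\<forall>k. w k \<in> \<D> k) \<longrightarrow> 0 \<le> real_part_form M m n w)"
proof -
  have "real_part_form N m n u - (norm (\<Sum>k\<in>{m..n}. col k (u k)))\<^sup>2 = real_part_form M m n (\<lambda>k. D k (u k))"
    if "\<forall>k. u k \<in> U k" for m n u
    using real_part_form_linked[OF link N M] that by blast
  then have "(norm (\<Sum>k\<in>{m..n}. col k (u k)))\<^sup>2 \<le> real_part_form N m n u \<longleftrightarrow> 0 \<le> real_part_form M m n (\<lambda>k. D k (u k))"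
    if "\<forall>k. u k \<in> U k" for m n u
    using that by (metis diff_ge_0_iff_ge)
  then show ?thesis
    using sum_col_le_iff[of N] real_part_form_dense[of M] N M unfolding unitriangular_def by simp
qed

end

section \<open>The interpolation problem\<close>

locale interpolation_problem = UM2_ball_matrix U Y H
  for U :: "int \<Rightarrow> 'u :: chilbert_space set" and Y :: "int \<Rightarrow> 'y :: chilbert_space set"
    and H :: "('u, 'y) opmat" +
  fixes F :: "int \<Rightarrow> 'u set" and \<omega>1 :: "int \<Rightarrow> 'u \<Rightarrow> 'y" and \<omega>2 :: "int \<Rightarrow> 'u \<Rightarrow> 'u"
  assumes csub_F: "\<And>k. csub (F k)" and F_subset: "\<And>k. F k \<subseteq> U k"
    and \<omega>2_bop: "\<And>k. \<omega>2 k \<in> bop (F k) (U (k - 1))"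
    and \<omega>_contraction: "\<And>k f. f \<in> F k \<Longrightarrow> (norm (\<omega>1 k f))\<^sup>2 + (norm (\<omega>2 k f))\<^sup>2 \<le> (norm f)\<^sup>2"
    and H_diag: "\<And>k f. f \<in> F k \<Longrightarrow> H k k f = \<omega>1 k f"
    and H_shift: "\<And>j k f. j < k \<Longrightarrow> f \<in> F k \<Longrightarrow> H j k f = H j (k - 1) (\<omega>2 k f)"
begin

sublocale F: csubs F
  by standard (rule csub.closed_csubspace[OF csub_F])

abbreviation "FH \<equiv> F_H U Y F H"
abbreviation "\<omega>H \<equiv> omega_H U Y F \<omega>2 H"

lemma F_mem: "f \<in> F k \<Longrightarrow> f \<in> U k"
  using F_subset by blast

lemma \<omega>2_mem: "f \<in> F k \<Longrightarrow> \<omega>2 k f \<in> U (k - 1)"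
  by (rule bop_mem[OF \<omega>2_bop])

text \<open>By \<open>H_shift\<close> the two columns agree in every row \<open>i < k\<close>, and
  in the remaining rows column \<open>j\<close> is zero because \<open>j < k\<close>.\<close>

lemma col_shift_orthogonal:
  assumes f: "f \<in> F k" and y: "y \<in> U j" and jk: "j < k"
  shows "cinner (col k f) (col j y) = cinner (col (k - 1) (\<omega>2 k f)) (col j y)"
  unfolding cinner_ell2_def
proof (rule infsum_cong)
  fix i
  show "cinner (coord (col k f) i) (coord (col j y) i) = cinner (coord (col (k - 1) (\<omega>2 k f)) i) (coord (col j y) i)"
  proof (cases "i < k")
    case True
    then show ?thesis
      by (simp add: coord_col F_mem[OF f] \<omega>2_mem[OF f] H_shift[OF True f])
  next
    case False
    then have "coord (col j y) i = 0"
      using jk y by (simp add: coord_col UM_zero[OF H_UM])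
    then show ?thesis by simp
  qed
qed

text \<open>The column with index \<open>k - 1\<close> has no entry in row \<open>k\<close>, which
  leaves that row to \<open>\<omega>1 k f\<close>; the split is Pythagorean. Through it the
  contractivity of \<open>\<omega>\<close> passes to \<open>\<omega>H\<close>.\<close>

lemma norm_col_shift:
  assumes f: "f \<in> F k"
  shows "(norm (col k f))\<^sup>2 = (norm (\<omega>1 k f))\<^sup>2 + (norm (col (k - 1) (\<omega>2 k f)))\<^sup>2"
proof -
  have "(norm (coord (col k f) i))\<^sup>2
      = (if i = k then (norm (\<omega>1 k f))\<^sup>2 else 0) + (norm (coord (col (k - 1) (\<omega>2 k f)) i))\<^sup>2" for i
  proof -
    consider "i < k" | "i = k" | "i > k" by linarith
    then show ?thesis
      by cases (simp_all add: coord_col F_mem[OF f] \<omega>2_mem[OF f] H_shift[OF _ f] H_diag[OF f] UM_zero[OF H_UM])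
  qed
  moreover have "((\<lambda>i. if i = k then (norm (\<omega>1 k f))\<^sup>2 else 0) has_sum (norm (\<omega>1 k f))\<^sup>2) UNIV"
    by (rule has_sum_finite_neutralI[of "{k}"]) auto
  moreover have "((\<lambda>i. (norm (coord (col (k - 1) (\<omega>2 k f)) i))\<^sup>2) has_sum (norm (col (k - 1) (\<omega>2 k f)))\<^sup>2) UNIV"
    unfolding norm_ell2_sq by (rule has_sum_infsum[OF coord_summable])
  ultimately have "((\<lambda>i. (norm (coord (col k f) i))\<^sup>2) has_sum
      (norm (\<omega>1 k f))\<^sup>2 + (norm (col (k - 1) (\<omega>2 k f)))\<^sup>2) UNIV"
    using has_sum_add by fastforce
  then show ?thesis
    unfolding norm_ell2_sq[of "col k f"] by (rule infsumI)
qed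

lemma norm_D_shift_le:
  assumes f: "f \<in> F k"
  shows "norm (D (k - 1) (\<omega>2 k f)) \<le> norm (D k f)"
proof (rule power2_le_imp_le)
  show "(norm (D (k - 1) (\<omega>2 k f)))\<^sup>2 \<le> (norm (D k f))\<^sup>2"
    using \<omega>_contraction[OF f] by (simp add: D_norm_sq F_mem[OF f] \<omega>2_mem[OF f] norm_col_shift[OF f])
qed simp

lemma D_F_bop: "restrict (D k) (F k) \<in> bop (F k) (U k)"
  by (rule bop_restrictI[OF csub_F, where B = 1])
    (simp_all add: F_mem bop_mem[OF D_bop] bop_add[OF D_bop] bop_scaleC[OF D_bop] D_norm_le)

lemma FH_eq: "FH k = closure (restrict (D k) (F k) ` F k)"
  by (simp add: F_H_def)

lemma csub_FH: "csub (FH k)"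
  unfolding FH_eq by (rule F.csub_closure_image[OF D_F_bop])

lemma D_mem_FH: "f \<in> F k \<Longrightarrow> D k f \<in> FH k"
  unfolding F_H_def by (rule subsetD[OF closure_subset imageI])

lemma FH_subset: "FH k \<subseteq> \<D> k"
  unfolding F_H_def defect_space_def by (intro closure_mono image_mono F_subset)

lemma bop_FH_eqI:
  assumes "T \<in> bop (FH k) W" "T' \<in> bop (FH k) W'" "\<And>f. f \<in> F k \<Longrightarrow> T (D k f) = T' (D k f)" "x \<in> FH k"
  shows "T x = T' x"
proof (rule bop_eq_on_closure[where T = T and T' = T' and S = "D k ` F k"])
  show "csub (closure (D k ` F k))" "T \<in> bop (closure (D k ` F k)) W"
    "T' \<in> bop (closure (D k ` F k)) W'" "x \<in> closure (D k ` F k)"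
    using assms csub_FH[of k] by (simp_all add: F_H_def)
qed (use assms(3) in blast)

lemma \<omega>H: "\<omega>H k \<in> contractions (FH k) (\<D> (k - 1))" "f \<in> F k \<Longrightarrow> \<omega>H k (D k f) = D (k - 1) (\<omega>2 k f)"
proof -
  have g: "(\<lambda>f\<in>F k. D (k - 1) (\<omega>2 k f)) \<in> bop (F k) (\<D> (k - 1))"
    by (rule F.bop_compose[OF \<omega>2_bop D_bop_defect_space])
  obtain T where T: "T \<in> bop (FH k) (\<D> (k - 1))" "\<And>f. f \<in> F k \<Longrightarrow> T (D k f) = D (k - 1) (\<omega>2 k f)"
    "\<And>z. z \<in> FH k \<Longrightarrow> norm (T z) \<le> 1 * norm z"
  proof (rule F.bop_extension[OF D_F_bop g DD.csub])
    show "norm ((\<lambda>f\<in>F k. D (k - 1) (\<omega>2 k f)) f) \<le> 1 * norm (restrict (D k) (F k) f)" if "f \<in> F k" for f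
      using norm_D_shift_le[OF that] that by simp
  qed (simp add: FH_eq)
  have "\<omega>H k = T"
    unfolding omega_H_def
  proof (rule the_equality)
    show "T \<in> contractions (FH k) (\<D> (k - 1)) \<and> (\<forall>f\<in>F k. T (D k f) = D (k - 1) (\<omega>2 k f))"
      using T by (simp add: contractions_def)
    fix S assume S: "S \<in> contractions (FH k) (\<D> (k - 1)) \<and> (\<forall>f\<in>F k. S (D k f) = D (k - 1) (\<omega>2 k f))"
    then have S_bop: "S \<in> bop (FH k) (\<D> (k - 1))"
      by (simp add: contractions_def)
    show "S = T"
    proof (rule bop_eqI[OF S_bop T(1)])
      show "S x = T x" if "x \<in> FH k" for x
        by (rule bop_FH_eqI[OF S_bop T(1) _ that]) (use S T(2) in simp)
    qed
  qed
  with T show "\<omega>H k \<in> contractions (FH k) (\<D> (k - 1))" "f \<in> F k \<Longrightarrow> \<omega>H k (D k f) = D (k - 1) (\<omega>2 k f)"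
    by (simp_all add: contractions_def)
qed

lemma C_condition_iff:
  assumes C: "C \<in> UM \<D> \<D>"
  shows "(\<forall>j k. \<forall>x\<in>FH k. C j k x = (if j = k - 1 then \<omega>H k x else 0)) \<longleftrightarrow>
    (\<forall>j k. \<forall>f\<in>F k. C j k (D k f) = (if j = k - 1 then D (k - 1) (\<omega>2 k f) else 0))"
    (is "?L \<longleftrightarrow> ?R")
proof
  assume ?L
  then show ?R by (simp add: D_mem_FH \<omega>H(2))
next
  assume R: ?R
  show ?L
  proof (intro allI ballI)
    fix j k x assume x: "x \<in> FH k"
    obtain B where B: "B \<ge> 0" "\<And>x. x \<in> \<D> k \<Longrightarrow> norm (C j k x) \<le> B * norm x"
      using bop_bound[OF UM_bop[OF C]] by blast
    have C_bop: "restrict (C j k) (FH k) \<in> bop (FH k) (\<D> j)"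
      by (rule bop_restrictI[OF csub_FH, where B = B])
        (use FH_subset[of k] B(2) in \<open>auto simp: subset_iff UM_mem[OF C] UM_add[OF C] bop_scaleC[OF UM_bop[OF C]]\<close>)
    have "restrict (C j k) (FH k) x = (if j = k - 1 then \<omega>H k else (\<lambda>x\<in>FH k. 0)) x"
    proof (rule bop_FH_eqI[OF C_bop _ _ x])
      show "(if j = k - 1 then \<omega>H k else (\<lambda>x\<in>FH k. 0)) \<in> bop (FH k) (\<D> j)"
        using \<omega>H(1)[of k] csub.bop_restrict_zero[OF csub_FH DD.csub] by (simp add: contractions_def)
      show "restrict (C j k) (FH k) (D k f) = (if j = k - 1 then \<omega>H k else (\<lambda>x\<in>FH k. 0)) (D k f)" if "f \<in> F k" for f
        using R that by (simp add: D_mem_FH \<omega>H(2))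
    qed
    then show "C j k x = (if j = k - 1 then \<omega>H k x else 0)"
      using x by (simp split: if_splits)
  qed
qed

text \<open>\<open>column_shift_iff_resolvent\<close> turns both sides into equalities of resolvent
  columns. Under the link the two columns compared carry the same Gram term, by
  \<open>col_shift_orthogonal\<close>, so it cancels, and density of the range of \<open>D j\<close>
  yields the equivalence.\<close>

lemma linked_interpolation_iff:
  assumes Z: "Z \<in> UM U U" "strictly_upper U Z" and C: "C \<in> UM \<D> \<D>" "strictly_upper \<D> C"
    and link: "linked (U.resolvent Z) (DD.resolvent C)" and f: "f \<in> F k"
  shows "(\<forall>j. Z j k f = (if j = k - 1 then \<omega>2 k f else 0)) \<longleftrightarrow>
    (\<forall>j. C j k (D k f) = (if j = k - 1 then D (k - 1) (\<omega>2 k f) else 0))"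
proof -
  define N where "N = U.resolvent Z"
  define M where "M = DD.resolvent C"
  have N: "N \<in> UM U U" unfolding N_def by (rule U.resolvent(2)[OF Z])
  have M: "M \<in> UM \<D> \<D>" unfolding M_def by (rule DD.resolvent(2)[OF C])
  have fU: "f \<in> U k" and \<omega>U: "\<omega>2 k f \<in> U (k - 1)"
    using f by (auto intro: F_mem \<omega>2_mem)
  have D_mem: "D k f \<in> \<D> k" "D (k - 1) (\<omega>2 k f) \<in> \<D> (k - 1)"
    using fU \<omega>U by (auto intro: D_mem_defect_space)
  have "N j k f = N j (k - 1) (\<omega>2 k f) \<longleftrightarrow> M j k (D k f) = M j (k - 1) (D (k - 1) (\<omega>2 k f))" if jk: "j < k" for j
  proof -
    have N1: "cinner (N j k f) y = cinner (M j k (D k f)) (D j y) + cinner (col k f) (col j y)" if "y \<in> U j" for y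
      using linkedD[OF link _ fU that] jk by (simp add: N_def M_def)
    have N2: "cinner (N j (k - 1) (\<omega>2 k f)) y
        = cinner (M j (k - 1) (D (k - 1) (\<omega>2 k f))) (D j y) + cinner (col k f) (col j y)" if "y \<in> U j" for y
      using linkedD[OF link _ \<omega>U that] jk col_shift_orthogonal[OF f that jk] by (simp add: N_def M_def)
    show ?thesis
    proof
      assume eq: "N j k f = N j (k - 1) (\<omega>2 k f)"
      show "M j k (D k f) = M j (k - 1) (D (k - 1) (\<omega>2 k f))"
      proof (rule defect_space_eqI)
        show "cinner (M j k (D k f)) (D j y) = cinner (M j (k - 1) (D (k - 1) (\<omega>2 k f))) (D j y)" if "y \<in> U j" for y
          using N1[OF that] N2[OF that] eq by simp
      qed (rule UM_mem[OF M D_mem(1)], rule UM_mem[OF M D_mem(2)])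
    next
      assume eq: "M j k (D k f) = M j (k - 1) (D (k - 1) (\<omega>2 k f))"
      show "N j k f = N j (k - 1) (\<omega>2 k f)"
      proof (rule U.eq_by_cinner)
        show "cinner y (N j k f) = cinner y (N j (k - 1) (\<omega>2 k f))" if "y \<in> U j" for y
          using N1[OF that] N2[OF that] eq cinner_commute[of y] by simp
      qed (rule UM_mem[OF N fU], rule UM_mem[OF N \<omega>U])
    qed
  qed
  then show ?thesis
    unfolding U.column_shift_iff_resolvent[OF Z fU \<omega>U] DD.column_shift_iff_resolvent[OF C D_mem]
    by (simp add: N_def M_def)
qed

text \<open>Multiplying (iii) by \<open>I - Z2\<close> solves it for \<open>Z1\<close>, and the
  interpolation condition on \<open>Z1\<close> then follows from those on \<open>H\<close> and
  \<open>Z2\<close>. This reduces membership to conditions on \<open>Z2\<close>.\<close>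

lemma Z_pairs_iff:
  "(Z1, Z2) \<in> Z_pairs U Y F \<omega>1 \<omega>2 H \<longleftrightarrow> Z2 \<in> UM U U \<and> strictly_upper U Z2 \<and>
    Z1 = mat_mult U H (mat_diff U (mat_id U) Z2) \<and>
    (\<forall>m n u. (\<forall>k. u k \<in> U k) \<longrightarrow>
      (\<Sum>j\<in>{m..n}. (norm (\<Sum>k\<in>{m..n}. H j k (u k)))\<^sup>2) \<le> real_part_form (U.resolvent Z2) m n u) \<and>
    (\<forall>j k. \<forall>f\<in>F k. Z2 j k f = (if j = k - 1 then \<omega>2 k f else 0))"
    (is "?L \<longleftrightarrow> ?R")
proof
  assume L: ?L
  then have Z: "Z1 \<in> UM U Y" "Z2 \<in> UM U U" "strictly_upper U Z2"
    by (auto simp: Z_pairs_def UM_inf_def UM_inf0_def)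
  define A where "A = mat_diff U (mat_id U) Z2"
  have A: "A \<in> UM U U"
    unfolding A_def by (rule mat_diff_mem_UM[OF U.csubs_self U.csubs_self U.mat_id_mem_UM Z(2)])
  have "H = mat_mult U Z1 (U.resolvent Z2)"
    using L by (simp add: Z_pairs_def U.resolvent_def)
  then have "mat_mult U H A = mat_mult U Z1 (mat_mult U (U.resolvent Z2) A)"
    using mat_mult_assoc[OF U.csubs_self U.csubs_self U.csubs_self Y.csubs_self Z(1) U.resolvent(2)[OF Z(2,3)] A]
    by simp
  then have Z1: "Z1 = mat_mult U H A"
    by (simp add: A_def U.resolvent(5)[OF Z(2,3)] mat_mult_id_right[OF U.csubs_self Y.csubs_self Z(1)])
  have "block_contractive U Z1 Z2"
    unfolding U.block_contractive_iff[OF Y.csubs_self U.csubs_self Z(1,2)]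
    using L unfolding Z_pairs_def UM_inf0_def by blast
  then have "\<forall>m n u. (\<forall>k. u k \<in> U k) \<longrightarrow>
      (\<Sum>j\<in>{m..n}. (norm (\<Sum>k\<in>{m..n}. H j k (u k)))\<^sup>2) \<le> real_part_form (U.resolvent Z2) m n u"
    unfolding Z1 A_def U.block_contractive_iff_real_part[OF H_UM Z(2,3)] .
  moreover have "\<forall>j k. \<forall>f\<in>F k. Z2 j k f = (if j = k - 1 then \<omega>2 k f else 0)"
    using L unfolding Z_pairs_def by blast
  ultimately show ?R
    using Z(2,3) Z1 unfolding A_def by blast
next
  assume R: ?R
  then have Z: "Z2 \<in> UM U U" "strictly_upper U Z2" and Z1: "Z1 = mat_mult U H (mat_diff U (mat_id U) Z2)"
    by auto
  define A where "A = mat_diff U (mat_id U) Z2"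
  have A: "A \<in> UM U U"
    unfolding A_def by (rule mat_diff_mem_UM[OF U.csubs_self U.csubs_self U.mat_id_mem_UM Z(1)])
  have Z1_UM: "Z1 \<in> UM U Y"
    unfolding Z1 A_def[symmetric] by (rule mat_mult_mem_UM[OF U.csubs_self U.csubs_self Y.csubs_self H_UM A])
  have "block_contractive U Z1 Z2"
    unfolding Z1 U.block_contractive_iff_real_part[OF H_UM Z] using R by blast
  then have bc: "Z1 \<in> UM_inf U Y \<and> Z2 \<in> UM_inf U U \<and>
      (\<forall>u\<in>hdsum U. (norm (mat_op U Y Z1 u))\<^sup>2 + (norm (mat_op U U Z2 u))\<^sup>2 \<le> (norm u)\<^sup>2)"
    unfolding U.block_contractive_iff[OF Y.csubs_self U.csubs_self Z1_UM Z(1)] .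
  have "mat_mult U Z1 (U.resolvent Z2) = mat_mult U H (mat_mult U A (U.resolvent Z2))"
    unfolding Z1 A_def[symmetric]
    by (rule mat_mult_assoc[OF U.csubs_self U.csubs_self U.csubs_self Y.csubs_self H_UM A U.resolvent(2)[OF Z]])
  then have H_eq: "H = mat_mult U Z1 (U.resolvent Z2)"
    by (simp add: A_def U.resolvent(4)[OF Z] mat_mult_id_right[OF U.csubs_self Y.csubs_self H_UM])
  have Z1_F: "Z1 j k f = (if j = k then \<omega>1 k f else 0)" if f: "f \<in> F k" for j k f
  proof -
    have Z2_f: "Z2 i k f = (if i = k - 1 then \<omega>2 k f else 0)" for i
      using R f by blast
    have "Z1 j k f = H j k f - mat_mult U H Z2 j k f"
      unfolding Z1 using mat_mult_diff_right[OF U.csubs_self U.csubs_self H_UM U.mat_id_mem_UM Z(1) F_mem[OF f]]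
      by (simp add: mat_mult_id_right[OF U.csubs_self Y.csubs_self H_UM])
    \<comment> \<open>The index \<open>k - 1\<close> lies in \<open>{j..k}\<close> exactly for
      \<open>j < k\<close>. There \<open>H_shift\<close> makes the difference vanish, and for
      \<open>j = k\<close> only the diagonal entry \<open>\<omega>1 k f\<close> is left.\<close>
    also have "mat_mult U H Z2 j k f = (if j < k then H j (k - 1) (\<omega>2 k f) else 0)"
      using F_mem[OF f] by (simp add: mat_mult_apply Z2_f if_distrib[of "H j _"] U.UM_zero_right[OF H_UM] cong: if_cong)
    finally show ?thesis
    proof -
      assume eq: "Z1 j k f = H j k f - (if j < k then H j (k - 1) (\<omega>2 k f) else 0)"
      consider "j < k" | "j = k" | "j > k" by linarith
      then show ?thesis
        using eq by cases (simp_all add: H_shift[OF _ f] H_diag[OF f] UM_zero[OF H_UM _ F_mem[OF f]])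
    qed
  qed
  have Z2_F: "\<And>j k f. f \<in> F k \<Longrightarrow> Z2 j k f = (if j = k - 1 then \<omega>2 k f else 0)"
    using R by blast
  show ?L
    unfolding Z_pairs_def UM_inf0_def mem_Collect_eq case_prod_conv
    using bc Z(2) Z1_F Z2_F H_eq[unfolded U.resolvent_def] U.resolvent(6)[OF Z] by blast
qed

lemma C_set_iff:
  "C \<in> C_set U Y F \<omega>2 H \<longleftrightarrow> C \<in> UM \<D> \<D> \<and> strictly_upper \<D> C \<and>
    (\<forall>m n w. (\<forall>k. w k \<in> \<D> k) \<longrightarrow> 0 \<le> real_part_form (DD.resolvent C) m n w) \<and>
    (\<forall>j k. \<forall>f\<in>F k. C j k (D k f) = (if j = k - 1 then D (k - 1) (\<omega>2 k f) else 0))"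
proof -
  have "C \<in> UM_inf_ball0 \<D> \<D> \<Longrightarrow> C \<in> UM \<D> \<D> \<and> strictly_upper \<D> C"
    by (simp add: UM_inf_ball0_def UM_inf_ball_def)
  then show ?thesis
    unfolding C_set_def using DD.mem_UM_inf_ball0_iff[of C] C_condition_iff[of C] by blast
qed

lemma C_set_nonempty: "\<exists>C. C \<in> C_set U Y F \<omega>2 H"
proof -
  have "\<forall>k. \<exists>P. P \<in> bop UNIV (FH k) \<and> (\<forall>x\<in>FH k. P x = x) \<and> (\<forall>x. norm (P x) \<le> norm x)"
    using csub.orthogonal_projection[OF csub_FH] by (metis (no_types, lifting))
  then obtain P where P: "\<And>k. P k \<in> bop UNIV (FH k)" "\<And>k x. x \<in> FH k \<Longrightarrow> P k x = x"
    "\<And>k x. norm (P k x) \<le> norm x"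
    by metis
  define E where "E k = (\<lambda>x\<in>\<D> k. \<omega>H k (P k x))" for k
  have \<omega>H_bop: "\<omega>H k \<in> bop (FH k) (\<D> (k - 1))" and \<omega>H_le: "\<And>x. x \<in> FH k \<Longrightarrow> norm (\<omega>H k x) \<le> norm x" for k
    using \<omega>H(1)[of k] by (auto simp: contractions_def)
  have PF: "P k x \<in> FH k" for k x
    by (rule bop_mem[OF P(1)]) simp
  have E_le: "norm (E k x) \<le> norm x" if "x \<in> \<D> k" for k x
    using order_trans[OF \<omega>H_le[OF PF] P(3)] that by (simp add: E_def)
  have E_bop: "E k \<in> bop (\<D> k) (\<D> (k - 1))" for k
    unfolding E_def
  proof (rule bop_restrictI[OF DD.csub, where B = 1])
    show "norm (\<omega>H k (P k x)) \<le> 1 * norm x" for x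
      using order_trans[OF \<omega>H_le[OF PF] P(3)] by simp
  qed (simp_all add: bop_mem[OF \<omega>H_bop] PF bop_add[OF P(1)] bop_scaleC[OF P(1)] bop_add[OF \<omega>H_bop] bop_scaleC[OF \<omega>H_bop])
  define C where "C j k = (if j = k - 1 then E k else (\<lambda>x\<in>\<D> k. 0))" for j k
  have C_UM: "C \<in> UM \<D> \<D>"
    unfolding UM_def using E_bop by (auto simp: C_def DD.bop_restrict_zero DD.csub)
  have C_strict: "strictly_upper \<D> C"
    by (auto simp: strictly_upper_def C_def)
  have "block_contractive \<D> DD.zero_mat C"
    unfolding block_contractive_def
  proof (intro allI impI)
    fix m n w assume w: "\<forall>k. w k \<in> \<D> k"
    have "(\<Sum>j\<in>{m..n}. (norm (\<Sum>k\<in>{m..n}. DD.zero_mat j k (w k)))\<^sup>2 + (norm (\<Sum>k\<in>{m..n}. C j k (w k)))\<^sup>2)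
        = (\<Sum>j\<in>{m..n}. (norm (\<Sum>k\<in>{m..n}. C j k (w k)))\<^sup>2)"
      using w by simp
    also have "\<dots> \<le> (\<Sum>j\<in>{m..n}. if j + 1 \<in> {m..n} then (norm (w (j + 1)))\<^sup>2 else 0)"
    proof (rule sum_mono)
      \<comment> \<open>Row \<open>j\<close> has its only entry in column \<open>j + 1\<close>, so
        distinct rows meet distinct columns, and row \<open>n\<close> is empty within the
        block.\<close>
      fix j
      have "(\<Sum>k\<in>{m..n}. C j k (w k)) = (\<Sum>k\<in>{m..n}. if k = j + 1 then E k (w k) else 0)"
        using w by (intro sum.cong) (auto simp: C_def)
      then have "(\<Sum>k\<in>{m..n}. C j k (w k)) = (if j + 1 \<in> {m..n} then E (j + 1) (w (j + 1)) else 0)"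
        by simp
      then show "(norm (\<Sum>k\<in>{m..n}. C j k (w k)))\<^sup>2 \<le> (if j + 1 \<in> {m..n} then (norm (w (j + 1)))\<^sup>2 else 0)"
        using E_le[of "w (j + 1)" "j + 1"] w by (simp add: power_mono)
    qed
    also have "\<dots> = (\<Sum>j\<in>{m..n} \<inter> {j. j + 1 \<in> {m..n}}. (norm (w (j + 1)))\<^sup>2)"
      by (simp add: sum.inter_restrict)
    also have "\<dots> = (\<Sum>k\<in>(\<lambda>j. j + 1) ` ({m..n} \<inter> {j. j + 1 \<in> {m..n}}). (norm (w k))\<^sup>2)"
      by (subst sum.reindex) (auto simp: inj_on_def)
    also have "\<dots> \<le> (\<Sum>k\<in>{m..n}. (norm (w k))\<^sup>2)"
      by (rule sum_mono2) auto
    finally show "(\<Sum>j\<in>{m..n}. (norm (\<Sum>k\<in>{m..n}. DD.zero_mat j k (w k)))\<^sup>2 + (norm (\<Sum>k\<in>{m..n}. C j k (w k)))\<^sup>2)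
        \<le> (\<Sum>k\<in>{m..n}. (norm (w k))\<^sup>2)" .
  qed
  then have "C \<in> UM_inf_ball0 \<D> \<D>"
    using C_strict by (simp add: UM_inf_ball0_def DD.mem_UM_inf_ball_iff[OF C_UM])
  moreover have "C j k x = (if j = k - 1 then \<omega>H k x else 0)" if "x \<in> FH k" for j k x
    using that FH_subset[of k] P(2)[OF that] by (auto simp: C_def E_def)
  ultimately show ?thesis
    unfolding C_set_def by blast
qed

text \<open>Comparing second components suffices: within \<open>Z_pairs\<close> the first one is
  determined by the second.\<close>

definition corresponds :: "('u, 'y) opmat \<times> ('u, 'u) opmat \<Rightarrow> ('u, 'u) opmat \<Rightarrow> bool" where
  "corresponds p C \<longleftrightarrow> linked (U.resolvent (snd p)) (DD.resolvent C)"

lemma corresponds_right_total: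
  assumes "C \<in> C_set U Y F \<omega>2 H"
  shows "\<exists>p\<in>Z_pairs U Y F \<omega>1 \<omega>2 H. corresponds p C"
proof -
  note C = assms[unfolded C_set_iff]
  define M where "M = DD.resolvent C"
  have M: "unitriangular \<D> M"
    unfolding M_def using C by (intro DD.resolvent(1)) auto
  obtain N where N: "unitriangular U N" "linked N M"
    using exists_linked_left[OF M] .
  define Z2 where "Z2 = U.resolvent_inv N"
  have Z2: "Z2 \<in> UM U U" "strictly_upper U Z2" "U.resolvent Z2 = N"
    unfolding Z2_def by (rule U.resolvent_inv[OF N(1)])+
  have link: "linked (U.resolvent Z2) (DD.resolvent C)"
    using N(2) by (simp add: Z2 M_def)
  have "(mat_mult U H (mat_diff U (mat_id U) Z2), Z2) \<in> Z_pairs U Y F \<omega>1 \<omega>2 H"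
    unfolding Z_pairs_iff
  proof (intro conjI)
    show "\<forall>m n u. (\<forall>k. u k \<in> U k) \<longrightarrow>
        (\<Sum>j\<in>{m..n}. (norm (\<Sum>k\<in>{m..n}. H j k (u k)))\<^sup>2) \<le> real_part_form (U.resolvent Z2) m n u"
      unfolding Z2(3) linked_positive_iff[OF N(2,1) M] using C by (simp add: M_def)
    show "\<forall>j k. \<forall>f\<in>F k. Z2 j k f = (if j = k - 1 then \<omega>2 k f else 0)"
      using linked_interpolation_iff[OF Z2(1,2) _ _ link] C by blast
  qed (use Z2 in auto)
  then show ?thesis
    using link by (intro bexI) (simp_all add: corresponds_def)
qed

text \<open>The positivity of the form has to be used before \<open>C\<close> exists, since it is
  what makes the kernel factor through the defects. The opposite direction has a formula for
  \<open>N\<close> and transfers positivity afterwards.\<close>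

lemma corresponds_left_total:
  assumes "p \<in> Z_pairs U Y F \<omega>1 \<omega>2 H"
  shows "\<exists>C\<in>C_set U Y F \<omega>2 H. corresponds p C"
proof -
  obtain Z1 Z2 where p: "p = (Z1, Z2)" by (cases p)
  note Z = assms[unfolded p Z_pairs_iff]
  define N where "N = U.resolvent Z2"
  have N: "unitriangular U N"
    unfolding N_def using Z by (intro U.resolvent(1)) auto
  then have N_UM: "N \<in> UM U U" by (simp add: unitriangular_def)
  have pos: "(norm (\<Sum>k\<in>{m..n}. col k (u k)))\<^sup>2 \<le> real_part_form N m n u" if "\<forall>k. u k \<in> U k" for m n u
    using Z sum_col_le_iff[OF N_UM] that by (simp add: N_def)
  obtain M where M: "unitriangular \<D> M" "linked N M"
    using exists_linked_right[OF N pos] by blast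
  define C where "C = DD.resolvent_inv M"
  have C: "C \<in> UM \<D> \<D>" "strictly_upper \<D> C" "DD.resolvent C = M"
    unfolding C_def by (rule DD.resolvent_inv[OF M(1)])+
  have link: "linked (U.resolvent Z2) (DD.resolvent C)"
    using M(2) by (simp add: C N_def)
  have "C \<in> C_set U Y F \<omega>2 H"
    unfolding C_set_iff
  proof (intro conjI)
    show "\<forall>m n w. (\<forall>k. w k \<in> \<D> k) \<longrightarrow> 0 \<le> real_part_form (DD.resolvent C) m n w"
      unfolding C(3) linked_positive_iff[OF M(2) N M(1), symmetric] using Z by (simp add: N_def)
    show "\<forall>j k. \<forall>f\<in>F k. C j k (D k f) = (if j = k - 1 then D (k - 1) (\<omega>2 k f) else 0)"
      using linked_interpolation_iff[OF _ _ C(1,2) link] Z by blast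
  qed (use C in auto)
  then show ?thesis
    using link by (intro bexI) (simp_all add: corresponds_def p)
qed

lemma corresponds_right_unique:
  assumes "C \<in> C_set U Y F \<omega>2 H" "C' \<in> C_set U Y F \<omega>2 H" "corresponds p C" "corresponds p C'"
  shows "C = C'"
proof -
  have C: "C \<in> UM \<D> \<D>" "strictly_upper \<D> C" "C' \<in> UM \<D> \<D>" "strictly_upper \<D> C'"
    using assms(1,2) by (simp_all add: C_set_iff)
  have "DD.resolvent C = DD.resolvent C'"
    using assms(3,4) DD.resolvent(2)[OF C(1,2)] DD.resolvent(2)[OF C(3,4)]
    unfolding corresponds_def by (rule linked_unique_right)
  then show ?thesis
    using DD.resolvent_eq_iff[OF C] by blast
qed

lemma corresponds_left_unique:
  assumes "p \<in> Z_pairs U Y F \<omega>1 \<omega>2 H" "p' \<in> Z_pairs U Y F \<omega>1 \<omega>2 H" "corresponds p C" "corresponds p' C"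
  shows "p = p'"
proof -
  obtain Z1 Z2 Z1' Z2' where p: "p = (Z1, Z2)" "p' = (Z1', Z2')" by (cases p, cases p')
  have Z: "Z2 \<in> UM U U" "strictly_upper U Z2" "Z2' \<in> UM U U" "strictly_upper U Z2'"
    and Z1: "Z1 = mat_mult U H (mat_diff U (mat_id U) Z2)" "Z1' = mat_mult U H (mat_diff U (mat_id U) Z2')"
    using assms(1,2) unfolding p Z_pairs_iff by simp_all
  have "U.resolvent Z2 = U.resolvent Z2'"
    using assms(3,4) U.resolvent(2)[OF Z(1,2)] U.resolvent(2)[OF Z(3,4)]
    unfolding corresponds_def p by simp (rule linked_unique_left)
  then have "Z2 = Z2'"
    using U.resolvent_eq_iff[OF Z] by blast
  then show ?thesis
    by (simp add: p Z1)
qed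

theorem Z_pairs_bij_C_set:
  "(\<exists>Z1 Z2. (Z1, Z2) \<in> Z_pairs U Y F \<omega>1 \<omega>2 H) \<and>
    (\<exists>\<Phi>. bij_betw \<Phi> (Z_pairs U Y F \<omega>1 \<omega>2 H) (C_set U Y F \<omega>2 H))"
proof
  show "\<exists>Z1 Z2. (Z1, Z2) \<in> Z_pairs U Y F \<omega>1 \<omega>2 H"
    using C_set_nonempty corresponds_right_total by fast
  show "\<exists>\<Phi>. bij_betw \<Phi> (Z_pairs U Y F \<omega>1 \<omega>2 H) (C_set U Y F \<omega>2 H)"
    by (rule bij_betw_if_total_functional[of _ _ corresponds])
      (use corresponds_left_total corresponds_right_total corresponds_right_unique corresponds_left_unique in blast)+
qed

end

theorem theorem0p2:
  fixes U F :: "int \<Rightarrow> 'u :: chilbert_space set"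
    and Y :: "int \<Rightarrow> 'y :: chilbert_space set"
    and \<omega>1 :: "int \<Rightarrow> 'u \<Rightarrow> 'y" and \<omega>2 :: "int \<Rightarrow> 'u \<Rightarrow> 'u"
    and H :: "('u, 'y) opmat"
  assumes "\<And>k. closed_csubspace (U k)" and "\<And>k. closed_csubspace (Y k)"
    and "\<And>k. closed_csubspace (F k)" and "\<And>k. F k \<subseteq> U k"
    and "\<And>k. \<omega>1 k \<in> bop (F k) (Y k)" and "\<And>k. \<omega>2 k \<in> bop (F k) (U (k - 1))"
    and "\<And>k f. f \<in> F k \<Longrightarrow> (norm (\<omega>1 k f))\<^sup>2 + (norm (\<omega>2 k f))\<^sup>2 \<le> (norm f)\<^sup>2"
    and "H \<in> UM2_ball U Y"
    and "\<And>k f. f \<in> F k \<Longrightarrow> H k k f = \<omega>1 k f"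
    and "\<And>j k f. j < k \<Longrightarrow> f \<in> F k \<Longrightarrow> H j k f = H j (k - 1) (\<omega>2 k f)"
  shows "(\<exists>Z1 Z2. (Z1, Z2) \<in> Z_pairs U Y F \<omega>1 \<omega>2 H) \<and>
    (\<exists>\<Phi>. bij_betw \<Phi> (Z_pairs U Y F \<omega>1 \<omega>2 H) (C_set U Y F \<omega>2 H))"
proof -
  interpret interpolation_problem U Y H F \<omega>1 \<omega>2
    by unfold_locales (use assms in auto)
  show ?thesis by (rule Z_pairs_bij_C_set)
qed

end
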